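(* Let $H$ be a weak Hopf algebra with invertible antipode $S$. Then the data $({H_{par}^w},{A_{par}^w},{\tilde A_{par}^w},s,t,\tilde s,\tilde t,\underline{\Delta}_l,\underline{\Delta}_r,\underline{\epsilon}_l,\underline{\epsilon}_r)$, together with the antipode $\mathcal S$, described in the context, define a Hopf algebroid structure on ${H_{par}^w}$.
   Context: All algebras are associative and unital over a field $\Bbbk$; Sweedler notation $\Delta(h)=h_1\otimes h_2$, $\Delta(1_H)=1_1\otimes1_2$. A weak Hopf algebra is $(H,m,u,\Delta,\varepsilon,S)$ with $H$ an algebra, $(H,\Delta,\varepsilon)$ a coalgebra, and for all $g,h,k$: $\Delta(kh)=\Delta(k)\Delta(h)$; $\varepsilon(kh_1)\varepsilon(h_2g)=\varepsilon(khg)=\varepsilon(kh_2)\varepsilon(h_1g)$; $(1\otimes\Delta(1))(\Delta(1)\otimes1)=\Delta^2(1)=(\Delta(1)\otimes1)(1\otimes\Delta(1))$; $h_1S(h_2)=\varepsilon(1_1h)1_2$; $S(h_1)h_2=1_1\varepsilon(h1_2)$; $S(h)=S(h_1)h_2S(h_3)$. ${H_{par}^w}=T(H)/I$, where $T(H)$ is the tensor algebra of the vector space $H$ and $I$ is the ideal generated by, for all $h,k\in H$: $1_H-1_{T(H)}$; $h\otimes k_1\otimes S(k_2)-hk_1\otimes S(k_2)$; $h\otimes S(k_1)\otimes k_2-hS(k_1)\otimes k_2$; $h_1\otimes S(h_2)\otimes k-h_1\otimes S(h_2)k$; $S(h_1)\otimes h_2\otimes k-S(h_1)\otimes h_2k$;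 $h-h_1\otimes S(h_2)\otimes h_3$; $[h]$ is the class of $h$. Put $E_h=[h_1][S(h_2)]$, $\tilde E_h=[S(h_1)][h_2]$; ${A_{par}^w}$ is the subalgebra generated by the $E_h$ and ${\tilde A_{par}^w}$ the subalgebra generated by the $\tilde E_h$. Let $\mathcal S,\mathcal S'\colon{H_{par}^w}\to{H_{par}^w}$ be the algebra anti-morphisms with $\mathcal S([h^1]\cdots[h^n])=[S(h^n)]\cdots[S(h^1)]$ and $\mathcal S'([h^1]\cdots[h^n])=[S^{-1}(h^n)]\cdots[S^{-1}(h^1)]$. Structure maps: $s(a)=a$, $t(a)=\mathcal S'(a)$ for $a\in{A_{par}^w}$; $\tilde s(\tilde a)=\tilde a$, $\tilde t(\tilde a)=\mathcal S'(\tilde a)$ for $\tilde a\in{\tilde A_{par}^w}$; $\underline{\Delta}_l([h^1]\cdots[h^n])=[h^1_1]\cdots[h^n_1]\otimes_{{A_{par}^w}}[h^1_2]\cdots[h^n_2]$, $\underline{\epsilon}_l([h^1]\cdots[h^n])=E_{h^1_1}E_{h^1_2h^2_1}\cdots E_{h^1_n h^2_{n-1}\cdots h^n}$ (i.e. $E_{h^1_1}E_{h^1_2h^2_1}\cdots E_{h^1\cdots h^n}$ with coproduct indices distributed accordingly); $\underline{\Delta}_r([h^1]\cdots[h^n])=[h^1_1]\cdots[h^n_1]\otimes_{{\tilde A_{par}^w}}[h^1_2]\cdots[h^n_2]$, $\underline{\epsilon}_r([h^1]\cdots[h^n])=\tilde E_{h^1_1h^2_1\cdots h^n_1}\tilde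 E_{h^2_2\cdots h^n_2}\cdots\tilde E_{h^n}$. Hopf algebroid: given an algebra $A$, a left bialgebroid $(\mathcal H,A,s,t,\underline\Delta_l,\underline\epsilon_l)$ consists of an algebra $\mathcal H$, an algebra morphism $s\colon A\to\mathcal H$ and an anti-morphism $t\colon A\to\mathcal H$ with commuting images, making $\mathcal H$ an $A$-bimodule via $a\triangleright h\triangleleft b=s(a)t(b)h$, such that $(\mathcal H,\underline\Delta_l,\underline\epsilon_l)$ is an $A$-coring (coassociative, counital $A$-bimodule maps $\underline\Delta_l\colon\mathcal H\to\mathcal H\otimes_A\mathcal H$, $\underline\epsilon_l\colon\mathcal H\to A$), $\underline\Delta_l$ lands in $\{\sum h_i\otimes k_i:\sum h_it(a)\otimes k_i=\sum h_i\otimes k_is(a)\ \forall a\}$ and is an algebra morphism into it, and $\underline\epsilon_l(hk)=\underline\epsilon_l(hs(\underline\epsilon_l(k)))=\underline\epsilon_l(ht(\underline\epsilon_l(k)))$. A right bialgebroid $(\mathcal H,\tilde A,\tilde s,\tilde t,\underline\Delta_r,\underline\epsilon_r)$ is defined symmetrically with bimodule structure $a\triangleright h\triangleleft b=h\tilde s(a)\tilde t(b)$, Takeuchi condition $\sum\tilde s(a)h_i\otimes k_i=\sum h_i\otimes\tilde t(a)k_i$, and $\underline\epsilon_r(hk)=\underline\epsilon_r(\tilde s(\underline\epsilon_r(h))k)=\underline\epsilon_r(\tilde t(\underline\epsilon_r(h))k)$. With $A\cong\tilde A^{op}$, a Hopf algebroid is a left bialgebroid over $A$ and right bialgebroid over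 $\tilde A$ on the same $\mathcal H$ plus an algebra anti-morphism $\mathcal S\colon\mathcal H\to\mathcal H$ such that: (i) $s\circ\underline\epsilon_l\circ\tilde t=\tilde t$, $t\circ\underline\epsilon_l\circ\tilde s=\tilde s$, $\tilde s\circ\underline\epsilon_r\circ t=t$, $\tilde t\circ\underline\epsilon_r\circ s=s$; (ii) $(\underline\Delta_l\otimes_{\tilde A}I)\circ\underline\Delta_r=(I\otimes_A\underline\Delta_r)\circ\underline\Delta_l$ and $(I\otimes_{\tilde A}\underline\Delta_l)\circ\underline\Delta_r=(\underline\Delta_r\otimes_AI)\circ\underline\Delta_l$; (iii) $\mathcal S(t(a)h\tilde t(\tilde b))=\tilde s(\tilde b)\mathcal S(h)s(a)$; (iv) $\mu\circ(\mathcal S\otimes I)\circ\underline\Delta_l=\tilde s\circ\underline\epsilon_r$ and $\mu\circ(I\otimes\mathcal S)\circ\underline\Delta_r=s\circ\underline\epsilon_l$.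
   Formalization: For the right bialgebroid the bimodule structure is taken as a▷h◁b = h t̃(a) s̃(b) instead of h s̃(a) t̃(b), which is not a bimodule action when Ã is noncommutative; the tensor product over Ã, the bimodule-map and the counit conditions follow this convention. *)

theory Defs
  imports Main "HOL-Library.Poly_Mapping"
begin

text \<open>Elements of all vector spaces below are represented by finitely supported
  functions (finite formal linear combinations) of type 'x =>0 'k, modulo explicitly
  given subspaces / ideals of relations.\<close>

definition fsc :: "'k::field \<Rightarrow> ('x \<Rightarrow>\<^sub>0 'k) \<Rightarrow> ('x \<Rightarrow>\<^sub>0 'k)" where
  "fsc c p = Poly_Mapping.map (\<lambda>a. c * a) p"

inductive_set lspan :: "('x \<Rightarrow>\<^sub>0 'k::field) set \<Rightarrow> ('x \<Rightarrow>\<^sub>0 'k) set" for G where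
  lspan_zero: "0 \<in> lspan G"
| lspan_gen: "g \<in> G \<Longrightarrow> g \<in> lspan G"
| lspan_add: "x \<in> lspan G \<Longrightarrow> y \<in> lspan G \<Longrightarrow> x + y \<in> lspan G"
| lspan_sc: "x \<in> lspan G \<Longrightarrow> fsc c x \<in> lspan G"

section \<open>Tensor powers: representatives with Poly_Mapping.keys x1 # ... # xn meaning x1 (x) ... (x) xn\<close>

definition fsw :: "('a list \<Rightarrow>\<^sub>0 'k::field) \<Rightarrow> ('a list \<Rightarrow> ('y \<Rightarrow>\<^sub>0 'k)) \<Rightarrow> ('y \<Rightarrow>\<^sub>0 'k)" where
  "fsw D f = (\<Sum>xs\<in>Poly_Mapping.keys D. fsc (Poly_Mapping.lookup D xs) (f xs))"

lemma fsw_cong [fundef_cong]: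
  "D = D' \<Longrightarrow> (\<And>xs. xs \<in> Poly_Mapping.keys D' \<Longrightarrow> f xs = g xs) \<Longrightarrow> fsw D f = fsw D' g"
  unfolding fsw_def by (auto intro: sum.cong)

definition kcontr :: "('a list \<Rightarrow> 'k::field) \<Rightarrow> ('a list \<Rightarrow>\<^sub>0 'k) \<Rightarrow> 'k" where
  "kcontr f X = (\<Sum>xs\<in>Poly_Mapping.keys X. Poly_Mapping.lookup X xs * f xs)"

definition hcontr :: "('k::field \<Rightarrow> 'h \<Rightarrow> 'h::ring_1) \<Rightarrow> ('h list \<Rightarrow> 'h) \<Rightarrow> ('h list \<Rightarrow>\<^sub>0 'k) \<Rightarrow> 'h" where
  "hcontr sc f X = (\<Sum>xs\<in>Poly_Mapping.keys X. sc (Poly_Mapping.lookup X xs) (f xs))"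

definition splice :: "nat \<Rightarrow> ('a \<Rightarrow> ('a list \<Rightarrow>\<^sub>0 'k::field)) \<Rightarrow> ('a list \<Rightarrow>\<^sub>0 'k) \<Rightarrow> ('a list \<Rightarrow>\<^sub>0 'k)" where
  "splice i f X = (\<Sum>xs\<in>Poly_Mapping.keys X. \<Sum>ys\<in>Poly_Mapping.keys (f (xs!i)).
      Poly_Mapping.single (take i xs @ ys @ drop (Suc i) xs) (Poly_Mapping.lookup X xs * Poly_Mapping.lookup (f (xs!i)) ys))"

definition tmul :: "('a \<Rightarrow> 'a \<Rightarrow> 'a) \<Rightarrow> ('a list \<Rightarrow>\<^sub>0 'k::field) \<Rightarrow> ('a list \<Rightarrow>\<^sub>0 'k) \<Rightarrow> ('a list \<Rightarrow>\<^sub>0 'k)" where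
  "tmul m X Y = (\<Sum>xs\<in>Poly_Mapping.keys X. \<Sum>ys\<in>Poly_Mapping.keys Y. Poly_Mapping.single (map2 m xs ys) (Poly_Mapping.lookup X xs * Poly_Mapping.lookup Y ys))"

definition tcons :: "'a \<Rightarrow> ('a list \<Rightarrow>\<^sub>0 'k::field) \<Rightarrow> ('a list \<Rightarrow>\<^sub>0 'k)" where
  "tcons a X = (\<Sum>xs\<in>Poly_Mapping.keys X. Poly_Mapping.single (a # xs) (Poly_Mapping.lookup X xs))"
definition tsnoc :: "('a list \<Rightarrow>\<^sub>0 'k::field) \<Rightarrow> 'a \<Rightarrow> ('a list \<Rightarrow>\<^sub>0 'k)" where
  "tsnoc X a = (\<Sum>xs\<in>Poly_Mapping.keys X. Poly_Mapping.single (xs @ [a]) (Poly_Mapping.lookup X xs))"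

definition kalg :: "('k::field \<Rightarrow> 'h::ring_1 \<Rightarrow> 'h) \<Rightarrow> bool" where
  "kalg sc \<longleftrightarrow> (\<forall>c x y. sc c (x + y) = sc c x + sc c y) \<and> (\<forall>c d x. sc (c + d) x = sc c x + sc d x)
     \<and> (\<forall>c d x. sc (c * d) x = sc c (sc d x)) \<and> (\<forall>x. sc 1 x = x)
     \<and> (\<forall>c x y. sc c (x * y) = sc c x * y) \<and> (\<forall>c x y. sc c (x * y) = x * sc c y)"

text \<open>Multilinearity relations: H^(x)n is the quotient of formal combinations of lists of
  length n by the span of these.\<close>
definition mlin_gens :: "('k::field \<Rightarrow> 'h::ring_1 \<Rightarrow> 'h) \<Rightarrow> ('h list \<Rightarrow>\<^sub>0 'k) set" where
  "mlin_gens sc =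
     {Poly_Mapping.single (us @ [a + b] @ vs) 1 - Poly_Mapping.single (us @ [a] @ vs) 1
        - Poly_Mapping.single (us @ [b] @ vs) 1 | us a b vs. True}
   \<union> {Poly_Mapping.single (us @ [sc c a] @ vs) 1 - fsc c (Poly_Mapping.single (us @ [a] @ vs) 1)
        | us c a vs. True}"

definition htens_eq :: "('k::field \<Rightarrow> 'h::ring_1 \<Rightarrow> 'h) \<Rightarrow> ('h list \<Rightarrow>\<^sub>0 'k) \<Rightarrow> ('h list \<Rightarrow>\<^sub>0 'k) \<Rightarrow> bool" where
  "htens_eq sc X Y \<longleftrightarrow> X - Y \<in> lspan (mlin_gens sc)"

text \<open>Weak Hopf algebra (H, m, u, Delta, eps, S); Delta h is a representative of an element of
  H (x) H (Poly_Mapping.keys are lists [h1, h2]).\<close>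
definition weak_hopf :: "('k::field \<Rightarrow> 'h::ring_1 \<Rightarrow> 'h) \<Rightarrow> ('h \<Rightarrow> ('h list \<Rightarrow>\<^sub>0 'k)) \<Rightarrow> ('h \<Rightarrow> 'k) \<Rightarrow> ('h \<Rightarrow> 'h) \<Rightarrow> bool" where
  "weak_hopf sc \<Delta> \<epsilon> S \<longleftrightarrow>
     kalg sc
   \<and> (\<forall>h. \<forall>xs\<in>Poly_Mapping.keys (\<Delta> h). length xs = 2)
   \<and> (\<forall>x y. htens_eq sc (\<Delta> (x + y)) (\<Delta> x + \<Delta> y)) \<and> (\<forall>c x. htens_eq sc (\<Delta> (sc c x)) (fsc c (\<Delta> x)))
   \<and> (\<forall>x y. \<epsilon> (x + y) = \<epsilon> x + \<epsilon> y) \<and> (\<forall>c x. \<epsilon> (sc c x) = c * \<epsilon> x)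
   \<and> (\<forall>x y. S (x + y) = S x + S y) \<and> (\<forall>c x. S (sc c x) = sc c (S x))
   \<and> (\<forall>h. htens_eq sc (splice 0 \<Delta> (\<Delta> h)) (splice 1 \<Delta> (\<Delta> h)))
   \<and> (\<forall>h. hcontr sc (\<lambda>xs. sc (\<epsilon> (xs!0)) (xs!1)) (\<Delta> h) = h)
   \<and> (\<forall>h. hcontr sc (\<lambda>xs. sc (\<epsilon> (xs!1)) (xs!0)) (\<Delta> h) = h)
   \<and> (\<forall>k h. htens_eq sc (\<Delta> (k * h)) (tmul (*) (\<Delta> k) (\<Delta> h)))
   \<and> (\<forall>k h g. kcontr (\<lambda>xs. \<epsilon> (k * xs!0) * \<epsilon> (xs!1 * g)) (\<Delta> h) = \<epsilon> (k * h * g))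
   \<and> (\<forall>k h g. kcontr (\<lambda>xs. \<epsilon> (k * xs!1) * \<epsilon> (xs!0 * g)) (\<Delta> h) = \<epsilon> (k * h * g))
   \<and> htens_eq sc (tmul (*) (tcons 1 (\<Delta> 1)) (tsnoc (\<Delta> 1) 1)) (splice 0 \<Delta> (\<Delta> 1))
   \<and> htens_eq sc (splice 0 \<Delta> (\<Delta> 1)) (tmul (*) (tsnoc (\<Delta> 1) 1) (tcons 1 (\<Delta> 1)))
   \<and> (\<forall>h. hcontr sc (\<lambda>xs. xs!0 * S (xs!1)) (\<Delta> h) = hcontr sc (\<lambda>xs. sc (\<epsilon> (xs!0 * h)) (xs!1)) (\<Delta> 1))
   \<and> (\<forall>h. hcontr sc (\<lambda>xs. S (xs!0) * xs!1) (\<Delta> h) = hcontr sc (\<lambda>xs. sc (\<epsilon> (h * xs!1)) (xs!0)) (\<Delta> 1))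
   \<and> (\<forall>h. S h = hcontr sc (\<lambda>xs. S (xs!0) * xs!1 * S (xs!2)) (splice 0 \<Delta> (\<Delta> h)))"

text \<open>T(H) is the free k-algebra on the set H (formal combinations of words, i.e. 'h list =>0 'k)
  modulo linearity in each letter; these linearity relations are included among the generators
  of the ideal below. The word [h] stands for the class [h].\<close>

definition wd :: "'h list \<Rightarrow> ('h list \<Rightarrow>\<^sub>0 'k::field)" where
  "wd u = Poly_Mapping.single u 1"

definition fone :: "('h list \<Rightarrow>\<^sub>0 'k::field)" where
  "fone = wd []"

definition fmul :: "('h list \<Rightarrow>\<^sub>0 'k::field) \<Rightarrow> ('h list \<Rightarrow>\<^sub>0 'k) \<Rightarrow> ('h list \<Rightarrow>\<^sub>0 'k)" where
  "fmul p q = (\<Sum>u\<in>Poly_Mapping.keys p. \<Sum>v\<in>Poly_Mapping.keys q. Poly_Mapping.single (u @ v) (Poly_Mapping.lookup p u * Poly_Mapping.lookup q v))"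

definition par_gens :: "('k::field \<Rightarrow> 'h::ring_1 \<Rightarrow> 'h) \<Rightarrow> ('h \<Rightarrow> ('h list \<Rightarrow>\<^sub>0 'k)) \<Rightarrow> ('h \<Rightarrow> 'h)
    \<Rightarrow> ('h list \<Rightarrow>\<^sub>0 'k) set" where
  "par_gens sc \<Delta> S =
     {wd (u @ [a + b] @ v) - wd (u @ [a] @ v) - wd (u @ [b] @ v) | u a b v. True}
   \<union> {wd (u @ [sc c a] @ v) - fsc c (wd (u @ [a] @ v)) | u c a v. True}
   \<union> {wd [1] - wd []}
   \<union> {fsw (\<Delta> k) (\<lambda>xs. wd [h, xs!0, S (xs!1)] - wd [h * xs!0, S (xs!1)]) | h k. True}
   \<union> {fsw (\<Delta> k) (\<lambda>xs. wd [h, S (xs!0), xs!1] - wd [h * S (xs!0), xs!1]) | h k. True}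
   \<union> {fsw (\<Delta> h) (\<lambda>xs. wd [xs!0, S (xs!1), k] - wd [xs!0, S (xs!1) * k]) | h k. True}
   \<union> {fsw (\<Delta> h) (\<lambda>xs. wd [S (xs!0), xs!1, k] - wd [S (xs!0), xs!1 * k]) | h k. True}
   \<union> {wd [h] - fsw (splice 0 \<Delta> (\<Delta> h)) (\<lambda>xs. wd [xs!0, S (xs!1), xs!2]) | h. True}"

inductive_set fideal :: "('h list \<Rightarrow>\<^sub>0 'k::field) set \<Rightarrow> ('h list \<Rightarrow>\<^sub>0 'k) set" for G where
  fideal_zero: "0 \<in> fideal G"
| fideal_gen: "g \<in> G \<Longrightarrow> g \<in> fideal G"
| fideal_add: "x \<in> fideal G \<Longrightarrow> y \<in> fideal G \<Longrightarrow> x + y \<in> fideal G"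
| fideal_lmul: "x \<in> fideal G \<Longrightarrow> fmul a x \<in> fideal G"
| fideal_rmul: "x \<in> fideal G \<Longrightarrow> fmul x a \<in> fideal G"

definition peq :: "('k::field \<Rightarrow> 'h::ring_1 \<Rightarrow> 'h) \<Rightarrow> ('h \<Rightarrow> ('h list \<Rightarrow>\<^sub>0 'k)) \<Rightarrow> ('h \<Rightarrow> 'h)
    \<Rightarrow> ('h list \<Rightarrow>\<^sub>0 'k) \<Rightarrow> ('h list \<Rightarrow>\<^sub>0 'k) \<Rightarrow> bool" where
  "peq sc \<Delta> S x y \<longleftrightarrow> x - y \<in> fideal (par_gens sc \<Delta> S)"

definition Ep :: "('h::ring_1 \<Rightarrow> ('h list \<Rightarrow>\<^sub>0 'k::field)) \<Rightarrow> ('h \<Rightarrow> 'h) \<Rightarrow> 'h \<Rightarrow> ('h list \<Rightarrow>\<^sub>0 'k)" where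
  "Ep \<Delta> S h = fsw (\<Delta> h) (\<lambda>xs. wd [xs!0, S (xs!1)])"
definition Et :: "('h::ring_1 \<Rightarrow> ('h list \<Rightarrow>\<^sub>0 'k::field)) \<Rightarrow> ('h \<Rightarrow> 'h) \<Rightarrow> 'h \<Rightarrow> ('h list \<Rightarrow>\<^sub>0 'k)" where
  "Et \<Delta> S h = fsw (\<Delta> h) (\<lambda>xs. wd [S (xs!0), xs!1])"

inductive_set subalg :: "('h list \<Rightarrow>\<^sub>0 'k::field) set \<Rightarrow> ('h list \<Rightarrow>\<^sub>0 'k) set" for G where
  subalg_scalar: "fsc c fone \<in> subalg G"
| subalg_gen: "g \<in> G \<Longrightarrow> g \<in> subalg G"
| subalg_add: "x \<in> subalg G \<Longrightarrow> y \<in> subalg G \<Longrightarrow> x + y \<in> subalg G"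
| subalg_mul: "x \<in> subalg G \<Longrightarrow> y \<in> subalg G \<Longrightarrow> fmul x y \<in> subalg G"

definition Apar :: "('h::ring_1 \<Rightarrow> ('h list \<Rightarrow>\<^sub>0 'k::field)) \<Rightarrow> ('h \<Rightarrow> 'h) \<Rightarrow> ('h list \<Rightarrow>\<^sub>0 'k) set" where
  "Apar \<Delta> S = subalg (range (Ep \<Delta> S))"
definition Atpar :: "('h::ring_1 \<Rightarrow> ('h list \<Rightarrow>\<^sub>0 'k::field)) \<Rightarrow> ('h \<Rightarrow> 'h) \<Rightarrow> ('h list \<Rightarrow>\<^sub>0 'k) set" where
  "Atpar \<Delta> S = subalg (range (Et \<Delta> S))"

text \<open>Anti-morphisms induced by f: [h^1]...[h^n] |-> [f h^n]...[f h^1].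
  antiw S is the antipode \<S>, antiw (inv S) is \<S>'.\<close>
definition antiw :: "('h \<Rightarrow> 'h) \<Rightarrow> ('h list \<Rightarrow>\<^sub>0 'k::field) \<Rightarrow> ('h list \<Rightarrow>\<^sub>0 'k)" where
  "antiw f p = (\<Sum>u\<in>Poly_Mapping.keys p. Poly_Mapping.single (rev (map f u)) (Poly_Mapping.lookup p u))"

text \<open>Coproduct of a word: [h^1]...[h^n] |-> [h^1_1]...[h^n_1] (x) [h^1_2]...[h^n_2];
  tensors of H_par^w are represented by Poly_Mapping.keys that are lists of words.\<close>
fun dword :: "('h::ring_1 \<Rightarrow> ('h list \<Rightarrow>\<^sub>0 'k::field)) \<Rightarrow> 'h list \<Rightarrow> ('h list list \<Rightarrow>\<^sub>0 'k)" where
  "dword \<Delta> [] = Poly_Mapping.single [[], []] 1"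
| "dword \<Delta> (h # u) = (\<Sum>xs\<in>Poly_Mapping.keys (\<Delta> h). \<Sum>ws\<in>Poly_Mapping.keys (dword \<Delta> u).
      Poly_Mapping.single [xs!0 # ws!0, xs!1 # ws!1] (Poly_Mapping.lookup (\<Delta> h) xs * Poly_Mapping.lookup (dword \<Delta> u) ws))"

definition DeltaP :: "('h::ring_1 \<Rightarrow> ('h list \<Rightarrow>\<^sub>0 'k::field)) \<Rightarrow> ('h list \<Rightarrow>\<^sub>0 'k) \<Rightarrow> ('h list list \<Rightarrow>\<^sub>0 'k)" where
  "DeltaP \<Delta> p = (\<Sum>u\<in>Poly_Mapping.keys p. fsc (Poly_Mapping.lookup p u) (dword \<Delta> u))"

text \<open>eps_l([h^1]...[h^n]) = E_{h^1_1} E_{h^1_2 h^2_1} ... E_{h^1_n h^2_{n-1} ... h^n},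
  computed by the recursion eps_l([h][g]w) = E_{h_1} eps_l([h_2 g] w).\<close>
function epsl :: "('h::ring_1 \<Rightarrow> ('h list \<Rightarrow>\<^sub>0 'k::field)) \<Rightarrow> ('h \<Rightarrow> 'h) \<Rightarrow> 'h list \<Rightarrow> ('h list \<Rightarrow>\<^sub>0 'k)" where
  "epsl \<Delta> S [] = fone"
| "epsl \<Delta> S [h] = Ep \<Delta> S h"
| "epsl \<Delta> S (h # g # u) = fsw (\<Delta> h) (\<lambda>xs. fmul (Ep \<Delta> S (xs!0)) (epsl \<Delta> S ((xs!1 * g) # u)))"
  by pat_completeness auto
termination by (relation "measure (\<lambda>(_, _, u). length u)") auto

text \<open>eps_r([h^1]...[h^n]) = E~_{h^1_1 h^2_1 ... h^n_1} E~_{h^2_2 ... h^n_2} ... E~_{h^n},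
  computed on the reversed word by eps_r(w[g][h]) = eps_r(w[g h_1]) E~_{h_2}.\<close>
function epsr_rev :: "('h::ring_1 \<Rightarrow> ('h list \<Rightarrow>\<^sub>0 'k::field)) \<Rightarrow> ('h \<Rightarrow> 'h) \<Rightarrow> 'h list \<Rightarrow> ('h list \<Rightarrow>\<^sub>0 'k)" where
  "epsr_rev \<Delta> S [] = fone"
| "epsr_rev \<Delta> S [h] = Et \<Delta> S h"
| "epsr_rev \<Delta> S (h # g # u) = fsw (\<Delta> h) (\<lambda>xs. fmul (epsr_rev \<Delta> S ((g * xs!0) # u)) (Et \<Delta> S (xs!1)))"
  by pat_completeness auto
termination by (relation "measure (\<lambda>(_, _, u). length u)") auto

definition EpsL :: "('h::ring_1 \<Rightarrow> ('h list \<Rightarrow>\<^sub>0 'k::field)) \<Rightarrow> ('h \<Rightarrow> 'h) \<Rightarrow> ('h list \<Rightarrow>\<^sub>0 'k) \<Rightarrow> ('h list \<Rightarrow>\<^sub>0 'k)" where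
  "EpsL \<Delta> S p = (\<Sum>u\<in>Poly_Mapping.keys p. fsc (Poly_Mapping.lookup p u) (epsl \<Delta> S u))"
definition EpsR :: "('h::ring_1 \<Rightarrow> ('h list \<Rightarrow>\<^sub>0 'k::field)) \<Rightarrow> ('h \<Rightarrow> 'h) \<Rightarrow> ('h list \<Rightarrow>\<^sub>0 'k) \<Rightarrow> ('h list \<Rightarrow>\<^sub>0 'k)" where
  "EpsR \<Delta> S p = (\<Sum>u\<in>Poly_Mapping.keys p. fsc (Poly_Mapping.lookup p u) (epsr_rev \<Delta> S (rev u)))"

fun ttens :: "('h list \<Rightarrow>\<^sub>0 'k::field) list \<Rightarrow> ('h list list \<Rightarrow>\<^sub>0 'k)" where
  "ttens [] = Poly_Mapping.single [] 1"
| "ttens (p # ps) = (\<Sum>u\<in>Poly_Mapping.keys p. \<Sum>ws\<in>Poly_Mapping.keys (ttens ps).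
      Poly_Mapping.single (u # ws) (Poly_Mapping.lookup p u * Poly_Mapping.lookup (ttens ps) ws))"

text \<open>Which base algebra the i-th (x) is over:
  LA: over A_par^w, with bimodule a>h<b = s(a)t(b)h, i.e. t(a)x (x) y = x (x) s(a)y;
  RA: over A~_par^w, with bimodule a>h<b = h t~(a)s~(b), i.e. x s~(a) (x) y = x (x) y t~(a).\<close>
datatype side = LA | RA

definition tgens :: "('k::field \<Rightarrow> 'h::ring_1 \<Rightarrow> 'h) \<Rightarrow> ('h \<Rightarrow> ('h list \<Rightarrow>\<^sub>0 'k)) \<Rightarrow> ('h \<Rightarrow> 'h)
    \<Rightarrow> side list \<Rightarrow> ('h list list \<Rightarrow>\<^sub>0 'k) set" where
  "tgens sc \<Delta> S bs =
     {ttens (ps[i := x]) | ps i x. length ps = Suc (length bs) \<and> i < length ps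
        \<and> x \<in> fideal (par_gens sc \<Delta> S)}
   \<union> {ttens (ps[i := fmul (antiw (inv S) a) x, Suc i := y]) - ttens (ps[i := x, Suc i := fmul a y])
        | ps i x y a. length ps = Suc (length bs) \<and> i < length bs \<and> bs!i = LA \<and> a \<in> Apar \<Delta> S}
   \<union> {ttens (ps[i := fmul x a, Suc i := y]) - ttens (ps[i := x, Suc i := fmul y (antiw (inv S) a)])
        | ps i x y a. length ps = Suc (length bs) \<and> i < length bs \<and> bs!i = RA \<and> a \<in> Atpar \<Delta> S}"

definition teq :: "('k::field \<Rightarrow> 'h::ring_1 \<Rightarrow> 'h) \<Rightarrow> ('h \<Rightarrow> ('h list \<Rightarrow>\<^sub>0 'k)) \<Rightarrow> ('h \<Rightarrow> 'h)
    \<Rightarrow> side list \<Rightarrow> ('h list list \<Rightarrow>\<^sub>0 'k) \<Rightarrow> ('h list list \<Rightarrow>\<^sub>0 'k) \<Rightarrow> bool" where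
  "teq sc \<Delta> S bs X Y \<longleftrightarrow> X - Y \<in> lspan (tgens sc \<Delta> S bs)"

definition slotl :: "nat \<Rightarrow> ('h list \<Rightarrow>\<^sub>0 'k::field) \<Rightarrow> ('h list list \<Rightarrow>\<^sub>0 'k) \<Rightarrow> ('h list list \<Rightarrow>\<^sub>0 'k)" where
  "slotl i p X = (\<Sum>ws\<in>Poly_Mapping.keys X. \<Sum>u\<in>Poly_Mapping.keys p. Poly_Mapping.single (ws[i := u @ ws!i]) (Poly_Mapping.lookup p u * Poly_Mapping.lookup X ws))"
definition slotr :: "nat \<Rightarrow> ('h list \<Rightarrow>\<^sub>0 'k::field) \<Rightarrow> ('h list list \<Rightarrow>\<^sub>0 'k) \<Rightarrow> ('h list list \<Rightarrow>\<^sub>0 'k)" where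
  "slotr i p X = (\<Sum>ws\<in>Poly_Mapping.keys X. \<Sum>u\<in>Poly_Mapping.keys p. Poly_Mapping.single (ws[i := ws!i @ u]) (Poly_Mapping.lookup X ws * Poly_Mapping.lookup p u))"

definition tcontr :: "('h list \<Rightarrow> 'h list \<Rightarrow> ('h list \<Rightarrow>\<^sub>0 'k::field)) \<Rightarrow> ('h list list \<Rightarrow>\<^sub>0 'k) \<Rightarrow> ('h list \<Rightarrow>\<^sub>0 'k)" where
  "tcontr f X = (\<Sum>ws\<in>Poly_Mapping.keys X. fsc (Poly_Mapping.lookup X ws) (f (ws!0) (ws!1)))"

text \<open>s = inclusion of A_par^w, t = \<S>' restricted to A_par^w, Delta_l = DeltaP, eps_l = EpsL.\<close>
definition par_left_bialgebroid :: "('k::field \<Rightarrow> 'h::ring_1 \<Rightarrow> 'h) \<Rightarrow> ('h \<Rightarrow> ('h list \<Rightarrow>\<^sub>0 'k)) \<Rightarrow> ('h \<Rightarrow> 'h) \<Rightarrow> bool" where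
  "par_left_bialgebroid sc \<Delta> S \<longleftrightarrow>
   (let P = peq sc \<Delta> S; A = Apar \<Delta> S; t = antiw (inv S); \<Delta>l = DeltaP \<Delta>; \<epsilon>l = EpsL \<Delta> S;
        T2 = teq sc \<Delta> S [LA]; T3 = teq sc \<Delta> S [LA, LA] in
     \<comment> \<open>t is a well-defined algebra anti-morphism A -> H, with image commuting with s(A)\<close>
     (\<forall>a\<in>A. \<forall>b\<in>A. P a b \<longrightarrow> P (t a) (t b))
   \<and> (\<forall>a\<in>A. \<forall>b\<in>A. P (t (a + b)) (t a + t b) \<and> P (t (fmul a b)) (fmul (t b) (t a)))
   \<and> (\<forall>a\<in>A. \<forall>c. P (t (fsc c a)) (fsc c (t a))) \<and> P (t fone) fone
   \<and> (\<forall>a\<in>A. \<forall>b\<in>A. P (fmul a (t b)) (fmul (t b) a))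
     \<comment> \<open>Delta_l : H -> H (x)_A H well defined, linear, A-bimodule map\<close>
   \<and> (\<forall>x y. P x y \<longrightarrow> T2 (\<Delta>l x) (\<Delta>l y))
   \<and> (\<forall>x y. T2 (\<Delta>l (x + y)) (\<Delta>l x + \<Delta>l y)) \<and> (\<forall>c x. T2 (\<Delta>l (fsc c x)) (fsc c (\<Delta>l x)))
   \<and> (\<forall>a\<in>A. \<forall>b\<in>A. \<forall>h. T2 (\<Delta>l (fmul (fmul a (t b)) h)) (slotl 0 a (slotl 1 (t b) (\<Delta>l h))))
     \<comment> \<open>coassociativity in H (x)_A H (x)_A H\<close>
   \<and> (\<forall>h. T3 (splice 0 (dword \<Delta>) (\<Delta>l h)) (splice 1 (dword \<Delta>) (\<Delta>l h)))
     \<comment> \<open>eps_l : H -> A well defined, linear, A-bimodule map\<close>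
   \<and> (\<forall>x y. P x y \<longrightarrow> P (\<epsilon>l x) (\<epsilon>l y)) \<and> (\<forall>x. \<exists>a\<in>A. P (\<epsilon>l x) a)
   \<and> (\<forall>x y. P (\<epsilon>l (x + y)) (\<epsilon>l x + \<epsilon>l y)) \<and> (\<forall>c x. P (\<epsilon>l (fsc c x)) (fsc c (\<epsilon>l x)))
   \<and> (\<forall>a\<in>A. \<forall>b\<in>A. \<forall>h. P (\<epsilon>l (fmul (fmul a (t b)) h)) (fmul (fmul a (\<epsilon>l h)) b))
     \<comment> \<open>counitality: s(eps(h_1)) h_2 = h = t(eps(h_2)) h_1\<close>
   \<and> (\<forall>h. P (tcontr (\<lambda>u v. fmul (\<epsilon>l (wd u)) (wd v)) (\<Delta>l h)) h)
   \<and> (\<forall>h. P (tcontr (\<lambda>u v. fmul (t (\<epsilon>l (wd v))) (wd u)) (\<Delta>l h)) h)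
     \<comment> \<open>Takeuchi condition and multiplicativity\<close>
   \<and> (\<forall>a\<in>A. \<forall>h. T2 (slotr 0 (t a) (\<Delta>l h)) (slotr 1 a (\<Delta>l h)))
   \<and> (\<forall>x y. T2 (\<Delta>l (fmul x y)) (tmul (@) (\<Delta>l x) (\<Delta>l y)))
   \<and> T2 (\<Delta>l fone) (ttens [fone, fone])
     \<comment> \<open>eps_l(hk) = eps_l(h s(eps_l k)) = eps_l(h t(eps_l k))\<close>
   \<and> (\<forall>x y. P (\<epsilon>l (fmul x y)) (\<epsilon>l (fmul x (\<epsilon>l y))) \<and> P (\<epsilon>l (fmul x y)) (\<epsilon>l (fmul x (t (\<epsilon>l y))))))"

text \<open>s~ = inclusion of A~_par^w, t~ = \<S>' restricted to A~_par^w, Delta_r = DeltaP, eps_r = EpsR.\<close>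
definition par_right_bialgebroid :: "('k::field \<Rightarrow> 'h::ring_1 \<Rightarrow> 'h) \<Rightarrow> ('h \<Rightarrow> ('h list \<Rightarrow>\<^sub>0 'k)) \<Rightarrow> ('h \<Rightarrow> 'h) \<Rightarrow> bool" where
  "par_right_bialgebroid sc \<Delta> S \<longleftrightarrow>
   (let P = peq sc \<Delta> S; A = Atpar \<Delta> S; t = antiw (inv S); \<Delta>r = DeltaP \<Delta>; \<epsilon>r = EpsR \<Delta> S;
        T2 = teq sc \<Delta> S [RA]; T3 = teq sc \<Delta> S [RA, RA] in
     (\<forall>a\<in>A. \<forall>b\<in>A. P a b \<longrightarrow> P (t a) (t b))
   \<and> (\<forall>a\<in>A. \<forall>b\<in>A. P (t (a + b)) (t a + t b) \<and> P (t (fmul a b)) (fmul (t b) (t a)))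
   \<and> (\<forall>a\<in>A. \<forall>c. P (t (fsc c a)) (fsc c (t a))) \<and> P (t fone) fone
   \<and> (\<forall>a\<in>A. \<forall>b\<in>A. P (fmul a (t b)) (fmul (t b) a))
     \<comment> \<open>Delta_r : H -> H (x)_A~ H well defined, linear, bimodule map for a>h<b = h t~(a) s~(b)\<close>
   \<and> (\<forall>x y. P x y \<longrightarrow> T2 (\<Delta>r x) (\<Delta>r y))
   \<and> (\<forall>x y. T2 (\<Delta>r (x + y)) (\<Delta>r x + \<Delta>r y)) \<and> (\<forall>c x. T2 (\<Delta>r (fsc c x)) (fsc c (\<Delta>r x)))
   \<and> (\<forall>a\<in>A. \<forall>b\<in>A. \<forall>h. T2 (\<Delta>r (fmul h (fmul (t a) b))) (slotr 0 (t a) (slotr 1 b (\<Delta>r h))))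
   \<and> (\<forall>h. T3 (splice 0 (dword \<Delta>) (\<Delta>r h)) (splice 1 (dword \<Delta>) (\<Delta>r h)))
   \<and> (\<forall>x y. P x y \<longrightarrow> P (\<epsilon>r x) (\<epsilon>r y)) \<and> (\<forall>x. \<exists>a\<in>A. P (\<epsilon>r x) a)
   \<and> (\<forall>x y. P (\<epsilon>r (x + y)) (\<epsilon>r x + \<epsilon>r y)) \<and> (\<forall>c x. P (\<epsilon>r (fsc c x)) (fsc c (\<epsilon>r x)))
   \<and> (\<forall>a\<in>A. \<forall>b\<in>A. \<forall>h. P (\<epsilon>r (fmul h (fmul (t a) b))) (fmul (fmul a (\<epsilon>r h)) b))
     \<comment> \<open>counitality: h_2 t~(eps(h_1)) = h = h_1 s~(eps(h_2))\<close>
   \<and> (\<forall>h. P (tcontr (\<lambda>u v. fmul (wd v) (t (\<epsilon>r (wd u)))) (\<Delta>r h)) h)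
   \<and> (\<forall>h. P (tcontr (\<lambda>u v. fmul (wd u) (\<epsilon>r (wd v))) (\<Delta>r h)) h)
     \<comment> \<open>Takeuchi condition: s~(a)h_i (x) k_i = h_i (x) t~(a)k_i; multiplicativity\<close>
   \<and> (\<forall>a\<in>A. \<forall>h. T2 (slotl 0 a (\<Delta>r h)) (slotl 1 (t a) (\<Delta>r h)))
   \<and> (\<forall>x y. T2 (\<Delta>r (fmul x y)) (tmul (@) (\<Delta>r x) (\<Delta>r y)))
   \<and> T2 (\<Delta>r fone) (ttens [fone, fone])
     \<comment> \<open>eps_r(hk) = eps_r(s~(eps_r h) k) = eps_r(t~(eps_r h) k)\<close>
   \<and> (\<forall>x y. P (\<epsilon>r (fmul x y)) (\<epsilon>r (fmul (\<epsilon>r x) y)) \<and> P (\<epsilon>r (fmul x y)) (\<epsilon>r (fmul (t (\<epsilon>r x)) y))))"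

definition par_hopf_compat :: "('k::field \<Rightarrow> 'h::ring_1 \<Rightarrow> 'h) \<Rightarrow> ('h \<Rightarrow> ('h list \<Rightarrow>\<^sub>0 'k)) \<Rightarrow> ('h \<Rightarrow> 'h) \<Rightarrow> bool" where
  "par_hopf_compat sc \<Delta> S \<longleftrightarrow>
   (let P = peq sc \<Delta> S; A = Apar \<Delta> S; At = Atpar \<Delta> S; t = antiw (inv S); \<SS> = antiw S;
        \<Delta>' = DeltaP \<Delta>; \<epsilon>l = EpsL \<Delta> S; \<epsilon>r = EpsR \<Delta> S in
     \<comment> \<open>A is isomorphic to A~^op\<close>
     (\<exists>\<phi>. (\<forall>a\<in>A. \<exists>b\<in>At. P (\<phi> a) b) \<and> (\<forall>a\<in>A. \<forall>b\<in>A. P a b \<longleftrightarrow> P (\<phi> a) (\<phi> b))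
        \<and> (\<forall>b\<in>At. \<exists>a\<in>A. P (\<phi> a) b)
        \<and> (\<forall>a\<in>A. \<forall>b\<in>A. P (\<phi> (a + b)) (\<phi> a + \<phi> b) \<and> P (\<phi> (fmul a b)) (fmul (\<phi> b) (\<phi> a)))
        \<and> (\<forall>a\<in>A. \<forall>c. P (\<phi> (fsc c a)) (fsc c (\<phi> a))) \<and> P (\<phi> fone) fone)
     \<comment> \<open>the antipode \<S> (and \<S>') are well-defined algebra anti-morphisms of H_par^w\<close>
   \<and> (\<forall>x y. P x y \<longrightarrow> P (\<SS> x) (\<SS> y) \<and> P (t x) (t y))
   \<and> (\<forall>x y. P (\<SS> (fmul x y)) (fmul (\<SS> y) (\<SS> x)) \<and> P (t (fmul x y)) (fmul (t y) (t x)))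
   \<and> (\<forall>x y. P (\<SS> (x + y)) (\<SS> x + \<SS> y) \<and> P (t (x + y)) (t x + t y))
   \<and> (\<forall>c x. P (\<SS> (fsc c x)) (fsc c (\<SS> x)) \<and> P (t (fsc c x)) (fsc c (t x)))
   \<and> P (\<SS> fone) fone \<and> P (t fone) fone
     \<comment> \<open>(i)\<close>
   \<and> (\<forall>b\<in>At. P (\<epsilon>l (t b)) (t b) \<and> P (t (\<epsilon>l b)) b)
   \<and> (\<forall>a\<in>A. P (\<epsilon>r (t a)) (t a) \<and> P (t (\<epsilon>r a)) a)
     \<comment> \<open>(ii)\<close>
   \<and> (\<forall>h. teq sc \<Delta> S [LA, RA] (splice 0 (dword \<Delta>) (\<Delta>' h)) (splice 1 (dword \<Delta>) (\<Delta>' h)))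
   \<and> (\<forall>h. teq sc \<Delta> S [RA, LA] (splice 1 (dword \<Delta>) (\<Delta>' h)) (splice 0 (dword \<Delta>) (\<Delta>' h)))
     \<comment> \<open>(iii)\<close>
   \<and> (\<forall>a\<in>A. \<forall>b\<in>At. \<forall>h. P (\<SS> (fmul (fmul (t a) h) (t b))) (fmul (fmul b (\<SS> h)) a))
     \<comment> \<open>(iv)\<close>
   \<and> (\<forall>h. P (tcontr (\<lambda>u v. fmul (\<SS> (wd u)) (wd v)) (\<Delta>' h)) (\<epsilon>r h))
   \<and> (\<forall>h. P (tcontr (\<lambda>u v. fmul (wd u) (\<SS> (wd v))) (\<Delta>' h)) (\<epsilon>l h)))"

end

theory Submission
  imports Defs Complex_Main
begin

text \<open>Two elements of a quotient of a space of formal combinations agree iff all linear functionals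
  vanishing on the relations agree on them. So every identity in $H$, in $H^w_{par}$ and in the balanced
  tensor squares is checked on scalar-valued functionals of letters, words and pairs of words, where
  Sweedler notation becomes literal: a bilinear functional evaluated on a coproduct.

  In $H^w_{par}$ one has $[h]E_k = E_{h_1 k}[h_2]$ and $E_h \tilde E_k = \tilde E_k E_h$, while
  $t(E_h) = [h_2][S^{-1}(h_1)] = \tilde E_{S^{-1}(h)}$. These give the Takeuchi condition, and with it the
  well-definedness of $\Delta_l$ and $\Delta_l(a) = a \otimes 1$, $\Delta_l(t(a)) = 1 \otimes t(a)$. The
  counit satisfies $\epsilon_l(x) = x_1 \mathcal S(x_2)$; as $\varphi(x \mathcal S(y))$ is balanced over
  $\tilde A$, its well-definedness is that of $\Delta_r$. Passing to $H^{op,cop}$ and reversing words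
  exchanges the left and the right structure; passing to $H^{cop}$ exchanges \<open>S\<close> and its inverse.\<close>

section \<open>Evaluation functionals and finite formal sums\<close>

text \<open>What shapes the proof is that Delta(1) need not be 1 (x) 1, and that the tensor squares
  over the base algebras carry no product outside the Takeuchi subspace. So Delta_l cannot be given
  on generators and extended multiplicatively. Instead a balanced functional is pulled back to
  words, and each defining relation is checked between arbitrary words u and v. The context can be
  stripped because F(u_1 x v_1, u_2 y v_2), summed over the coproducts of u and v, is balanced in x
  and y again; for a single letter u = h this comes from exchanging the letter with E_k and
  cancelling T(h_2) h_1, where T is the inverse of S. Such cancellations leave a stray copy of
  Delta(1). It lies in H_s (x) H_t, and the bracket is multiplicative once one factor is in H_s or
  H_t, so the copy can be moved along words until a neighbouring coproduct absorbs it. The axioms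
  are not assumed for T: the symmetry between H and H^cop is derived from S reversing products and
  coproducts, which in the weak setting needs a proof of its own.\<close>

definition ev :: "('x \<Rightarrow> 'k) \<Rightarrow> ('x \<Rightarrow>\<^sub>0 'k::field) \<Rightarrow> 'k" where
  "ev f p = (\<Sum>u\<in>Poly_Mapping.keys p. Poly_Mapping.lookup p u * f u)"

lemma ev_superset:
  assumes "finite A" "Poly_Mapping.keys p \<subseteq> A"
  shows "ev f p = (\<Sum>u\<in>A. Poly_Mapping.lookup p u * f u)"
  unfolding ev_def using assms
  by (intro sum.mono_neutral_left) (auto simp: in_keys_iff)

lemma ev_zero [simp]: "ev f 0 = 0"
  by (simp add: ev_def)

lemma ev_single [simp]: "ev f (Poly_Mapping.single u c) = c * f u"
  by (subst ev_superset[of "{u}"]) auto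

lemma ev_add [simp]: "ev f (p + q) = ev f p + ev f q"
proof -
  let ?A = "Poly_Mapping.keys p \<union> Poly_Mapping.keys q"
  have "ev f (p + q) = (\<Sum>u\<in>?A. Poly_Mapping.lookup (p + q) u * f u)"
    using keys_add[of p q] by (intro ev_superset) auto
  moreover have "ev f p = (\<Sum>u\<in>?A. Poly_Mapping.lookup p u * f u)"
    "ev f q = (\<Sum>u\<in>?A. Poly_Mapping.lookup q u * f u)"
    by (auto intro!: ev_superset)
  ultimately show ?thesis
    by (simp add: lookup_add distrib_right sum.distrib)
qed

lemma ev_minus [simp]: "ev f (p - q) = ev f p - ev f q"
proof -
  have "ev f (p - q + q) = ev f (p - q) + ev f q"
    by (rule ev_add)
  then show ?thesis by simp
qed

lemma ev_fsc [simp]: "ev f (fsc c p) = c * ev f p"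
proof -
  have l: "Poly_Mapping.lookup (fsc c p) u = c * Poly_Mapping.lookup p u" for u
    by (simp add: fsc_def map.rep_eq when_def)
  then have "Poly_Mapping.keys (fsc c p) \<subseteq> Poly_Mapping.keys p"
    by (auto simp: in_keys_iff)
  then show ?thesis
    by (subst ev_superset[of "Poly_Mapping.keys p"])
      (auto simp: l ev_def sum_distrib_left mult.assoc)
qed

lemma ev_sum [simp]: "ev f (\<Sum>i\<in>I. p i) = (\<Sum>i\<in>I. ev f (p i))"
  by (induction I rule: infinite_finite_induct) auto

lemma ev_plus_fun: "ev (\<lambda>x. f x + g x) p = ev f p + ev g p"
  by (simp add: ev_def distrib_left sum.distrib)

lemma ev_scale_fun: "ev (\<lambda>x. c * f x) p = c * ev f p"
  by (simp add: ev_def sum_distrib_left mult.left_commute)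

lemma ev_swap: "ev (\<lambda>x. ev (\<lambda>y. f x y) q) p = ev (\<lambda>y. ev (\<lambda>x. f x y) p) q"
  unfolding ev_def sum_distrib_left
  by (subst sum.swap) (simp add: mult.left_commute)

text \<open>Any two such operators commute, which is what permits interchanging iterated Sweedler sums.\<close>

definition finop :: "(('x \<Rightarrow> 'k::field) \<Rightarrow> 'k) \<Rightarrow> bool" where
  "finop \<Theta> \<longleftrightarrow> (\<exists>p. \<forall>f. \<Theta> f = ev f p)"

lemma finop_ev: "finop (\<lambda>f. ev f p)"
  by (auto simp: finop_def)

text \<open>Substituting evaluations into an evaluation gives an evaluation, even when the inner one
  depends on the outer variable. A whole nest of Sweedler sums can thus be exchanged with another by
  one use of \<open>finop_swap\<close>.\<close>

lemma finop_comp: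
  assumes "finop \<Theta>" "\<And>x. finop (\<Omega> x)"
  shows "finop (\<lambda>f. \<Theta> (\<lambda>x. \<Omega> x (\<lambda>y. f (g x y))))"
proof -
  from assms(1) obtain p where p: "\<And>f. \<Theta> f = ev f p" by (auto simp: finop_def)
  from assms(2) have "\<forall>x. \<exists>q. \<forall>f. \<Omega> x f = ev f q" by (auto simp: finop_def)
  then obtain q where q: "\<And>x f. \<Omega> x f = ev f (q x)" by metis
  define r where "r = (\<Sum>x\<in>Poly_Mapping.keys p. \<Sum>y\<in>Poly_Mapping.keys (q x).
      Poly_Mapping.single (g x y) (Poly_Mapping.lookup p x * Poly_Mapping.lookup (q x) y))"
  have "\<Theta> (\<lambda>x. \<Omega> x (\<lambda>y. f (g x y))) = ev f r" for f
    by (simp add: p q r_def) (simp add: ev_def sum_distrib_left mult.assoc)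
  then show ?thesis by (auto simp: finop_def)
qed

lemma finop_map:
  assumes "finop \<Theta>"
  shows "finop (\<lambda>f. \<Theta> (\<lambda>x. f (g x)))"
proof -
  have "finop (\<lambda>f. f x)" for x :: 'b
    unfolding finop_def by (rule exI[of _ "Poly_Mapping.single x 1"]) simp
  from finop_comp[OF assms this, where g = "\<lambda>x _. g x"] show ?thesis by simp
qed

lemma finop_plus:
  assumes "finop \<Theta>" "finop \<Omega>"
  shows "finop (\<lambda>f. \<Theta> f + \<Omega> f)"
proof -
  from assms obtain p q where "\<And>f. \<Theta> f = ev f p" "\<And>f. \<Omega> f = ev f q"
    by (auto simp: finop_def)
  then have "\<forall>f. \<Theta> f + \<Omega> f = ev f (p + q)" by simp
  then show ?thesis unfolding finop_def by blast
qed

lemma finop_point: "finop (\<lambda>f. c * f x)"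
  unfolding finop_def by (rule exI[of _ "Poly_Mapping.single x c"]) simp

lemma finop_swap:
  assumes "finop \<Theta>" "finop \<Omega>"
  shows "\<Theta> (\<lambda>x. \<Omega> (\<lambda>y. f x y)) = \<Omega> (\<lambda>y. \<Theta> (\<lambda>x. f x y))"
proof -
  from assms obtain p q where "\<And>f. \<Theta> f = ev f p" "\<And>f. \<Omega> f = ev f q"
    by (auto simp: finop_def)
  then show ?thesis by (simp add: ev_swap[of f])
qed

lemma finop_add_fun: "finop \<Theta> \<Longrightarrow> \<Theta> (\<lambda>x. f x + g x) = \<Theta> f + \<Theta> g"
  by (auto simp: finop_def ev_plus_fun)

lemma finop_scale_fun: "finop \<Theta> \<Longrightarrow> \<Theta> (\<lambda>x. c * f x) = c * \<Theta> f"
  by (auto simp: finop_def ev_scale_fun)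

section \<open>Linear and multilinear functionals\<close>

definition lin :: "('k::field \<Rightarrow> 'h::ab_group_add \<Rightarrow> 'h) \<Rightarrow> ('h \<Rightarrow> 'k) \<Rightarrow> bool" where
  "lin sc f \<longleftrightarrow> (\<forall>x y. f (x + y) = f x + f y) \<and> (\<forall>c x. f (sc c x) = c * f x)"

definition vlin :: "('k::field \<Rightarrow> 'h::ab_group_add \<Rightarrow> 'h) \<Rightarrow> ('h \<Rightarrow> 'h) \<Rightarrow> bool" where
  "vlin sc g \<longleftrightarrow> (\<forall>x y. g (x + y) = g x + g y) \<and> (\<forall>c x. g (sc c x) = sc c (g x))"

text \<open>Words depending on x through exactly one letter, linearly. The closure rules let the
  simplifier discharge the linearity side conditions of Sweedler manipulations on words.\<close>

definition llin :: "('k::field \<Rightarrow> 'h::ab_group_add \<Rightarrow> 'h) \<Rightarrow> ('h \<Rightarrow> 'h list) \<Rightarrow> bool" where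
  "llin sc G \<longleftrightarrow> (\<exists>u v g. vlin sc g \<and> G = (\<lambda>x. u @ g x # v))"

text \<open>Words of all lengths are treated at once: these are the linear functionals on T(H),
  recorded by their values on words.\<close>

definition pml :: "('k::field \<Rightarrow> 'h::ab_group_add \<Rightarrow> 'h) \<Rightarrow> ('h list \<Rightarrow> 'k) \<Rightarrow> bool" where
  "pml sc \<phi> \<longleftrightarrow> (\<forall>u v. lin sc (\<lambda>x. \<phi> (u @ x # v)))"

lemma lin_vlin: "lin sc f \<Longrightarrow> vlin sc g \<Longrightarrow> lin sc (\<lambda>x. f (g x))"
  by (auto simp: lin_def vlin_def)

lemma vlin_comp: "vlin sc f \<Longrightarrow> vlin sc g \<Longrightarrow> vlin sc (\<lambda>x. f (g x))"
  by (auto simp: vlin_def)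

lemma vlin_id [simp]: "vlin sc (\<lambda>x. x)"
  by (auto simp: vlin_def)

lemma llin_head [simp]: "vlin sc g \<Longrightarrow> llin sc (\<lambda>x. g x # v)"
  unfolding llin_def by (metis append_Nil)

lemma llin_append_left [simp]: "llin sc G \<Longrightarrow> llin sc (\<lambda>x. u @ G x)"
  unfolding llin_def by (metis append_assoc)

lemma llin_append_right [simp]: "llin sc G \<Longrightarrow> llin sc (\<lambda>x. G x @ v)"
  unfolding llin_def by (auto simp: fun_eq_iff) (metis append_Cons append_assoc)

lemma llin_tail [simp]: "llin sc G \<Longrightarrow> llin sc (\<lambda>x. a # G x)"
  using llin_append_left[of sc G "[a]"] by simp

lemma llin_rev [simp]: "llin sc G \<Longrightarrow> llin sc (\<lambda>x. rev (G x))"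
  unfolding llin_def by (fastforce simp: fun_eq_iff)

lemma llin_map [simp]: "vlin sc f \<Longrightarrow> llin sc G \<Longrightarrow> llin sc (\<lambda>x. map f (G x))"
proof -
  assume f: "vlin sc f" and "llin sc G"
  then obtain u v g where "vlin sc g" "G = (\<lambda>x. u @ g x # v)"
    unfolding llin_def by blast
  then have "vlin sc (\<lambda>x. f (g x))" "(\<lambda>x. map f (G x)) = (\<lambda>x. map f u @ f (g x) # map f v)"
    using f by (auto intro: vlin_comp)
  then show ?thesis unfolding llin_def by blast
qed

lemma pml_lin: "pml sc \<phi> \<Longrightarrow> llin sc G \<Longrightarrow> lin sc (\<lambda>x. \<phi> (G x))"
  unfolding pml_def llin_def by (auto intro: lin_vlin[of sc "\<lambda>x. \<phi> (_ @ x # _)"])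

lemma lin_scale [simp]: "lin sc f \<Longrightarrow> lin sc (\<lambda>x. c * f x)"
  by (auto simp: lin_def algebra_simps)

lemma lin_scale_right [simp]: "lin sc f \<Longrightarrow> lin sc (\<lambda>x. f x * c)"
  by (auto simp: lin_def algebra_simps)

lemma lin_finop:
  "finop \<Theta> \<Longrightarrow> (\<And>y. lin sc (\<lambda>x. K x y)) \<Longrightarrow> lin sc (\<lambda>x. \<Theta> (\<lambda>y. K x y))"
proof -
  assume \<Theta>: "finop \<Theta>" and K: "\<And>y. lin sc (\<lambda>x. K x y)"
  have "K (x + x') = (\<lambda>y. K x y + K x' y)" "K (sc c x) = (\<lambda>y. c * K x y)" for x x' c
    using K by (auto simp: lin_def)
  with \<Theta> show ?thesis
    by (simp add: lin_def finop_add_fun finop_scale_fun)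
qed

lemma pml_comp:
  assumes "pml sc \<phi>" "\<And>u v. llin sc (\<lambda>x. G (u @ x # v))"
  shows "pml sc (\<lambda>w. \<phi> (G w))"
  unfolding pml_def by (intro allI pml_lin[OF assms(1)] assms(2))

lemma pml_finop:
  "finop \<Theta> \<Longrightarrow> (\<And>y. pml sc (\<lambda>w. K w y)) \<Longrightarrow> pml sc (\<lambda>w. \<Theta> (\<lambda>y. K w y))"
  unfolding pml_def by (auto intro: lin_finop)

section \<open>Sweedler calculus\<close>

text \<open>\<open>SW h F\<close> stands for $F(h_1, h_2)$ for a bilinear scalar-valued \<open>F\<close>. Neither a multiplication
  of the type nor a tensor product type is used, so that the opposite and the co-opposite
  structures are instances on the same type.\<close>

locale sweedler =
  fixes sc :: "'k::field \<Rightarrow> 'h::ab_group_add \<Rightarrow> 'h"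
    and mul :: "'h \<Rightarrow> 'h \<Rightarrow> 'h" (infixl "\<odot>" 70)
    and one :: 'h
    and SW :: "'h \<Rightarrow> ('h \<Rightarrow> 'h \<Rightarrow> 'k) \<Rightarrow> 'k"
  assumes mul_left: "vlin sc (\<lambda>x. x \<odot> y)"
    and mul_right: "vlin sc (\<lambda>y. x \<odot> y)"
    and mul_assoc: "x \<odot> y \<odot> z = x \<odot> (y \<odot> z)"
    and one_left [simp]: "one \<odot> x = x"
    and one_right [simp]: "x \<odot> one = x"
    and SW_fin: "finop (\<lambda>f. SW h (\<lambda>a b. f (a, b)))"
    and SW_lin: "\<lbrakk>\<And>b. lin sc (\<lambda>a. F a b); \<And>a. lin sc (\<lambda>b. F a b)\<rbrakk> \<Longrightarrow> lin sc (\<lambda>h. SW h F)"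
    and SW_coassoc: "\<lbrakk>\<And>b c. lin sc (\<lambda>a. G a b c); \<And>a c. lin sc (\<lambda>b. G a b c); \<And>a b. lin sc (\<lambda>c. G a b c)\<rbrakk>
      \<Longrightarrow> SW h (\<lambda>a b. SW a (\<lambda>c d. G c d b)) = SW h (\<lambda>a b. SW b (\<lambda>c d. G a c d))"
    and SW_mul: "\<lbrakk>\<And>b. lin sc (\<lambda>a. F a b); \<And>a. lin sc (\<lambda>b. F a b)\<rbrakk>
      \<Longrightarrow> SW (x \<odot> y) F = SW x (\<lambda>a b. SW y (\<lambda>c d. F (a \<odot> c) (b \<odot> d)))"
begin

abbreviation L where "L \<equiv> lin sc"
abbreviation VL where "VL \<equiv> vlin sc"

lemma SW_add: "SW h (\<lambda>a b. F a b + G a b) = SW h F + SW h G"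
  using finop_add_fun[OF SW_fin, of h "\<lambda>(a, b). F a b" "\<lambda>(a, b). G a b"] by simp

lemma SW_scale: "SW h (\<lambda>a b. c * F a b) = c * SW h F"
  using finop_scale_fun[OF SW_fin, of h c "\<lambda>(a, b). F a b"] by simp

lemma SW_scale_right: "SW h (\<lambda>a b. F a b * c) = SW h F * c"
  using SW_scale[of h c F] by (simp add: mult.commute)

lemma SW_finop_swap:
  assumes "finop \<Theta>"
  shows "SW h (\<lambda>a b. \<Theta> (\<lambda>x. F a b x)) = \<Theta> (\<lambda>x. SW h (\<lambda>a b. F a b x))"
  using finop_swap[OF SW_fin assms, of h "\<lambda>(a, b). F a b"] by simp

lemma SW_swap: "SW h (\<lambda>a b. SW k (\<lambda>c d. F a b c d)) = SW k (\<lambda>c d. SW h (\<lambda>a b. F a b c d))"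
  using SW_finop_swap[OF SW_fin, of h k "\<lambda>a b (c, d). F a b c d"] by simp

lemma SW_cong: "(\<And>a b. F a b = G a b) \<Longrightarrow> SW h F = SW h G"
  by presburger

lemma finop_SW: "(\<And>a b. finop (\<lambda>f. \<Omega> a b (\<lambda>y. f y))) \<Longrightarrow> finop (\<lambda>f. SW h (\<lambda>a b. \<Omega> a b (\<lambda>y. f (g a b y))))"
  using finop_comp[OF SW_fin, where \<Omega> = "\<lambda>(a, b). \<Omega> a b" and g = "\<lambda>(a, b). g a b"] by auto

lemma lin_mul_left [simp]: "VL g \<Longrightarrow> VL (\<lambda>x. g x \<odot> y)"
  by (rule vlin_comp[OF mul_left])

lemma lin_mul_right [simp]: "VL g \<Longrightarrow> VL (\<lambda>x. y \<odot> g x)"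
  by (rule vlin_comp[OF mul_right])

lemma lin_SW [simp]:
  "\<lbrakk>VL g; \<And>b. L (\<lambda>a. F a b); \<And>a. L (\<lambda>b. F a b)\<rbrakk> \<Longrightarrow> L (\<lambda>x. SW (g x) (\<lambda>a b. F a b))"
  by (rule lin_vlin[of sc "\<lambda>h. SW h F"]) (auto intro: SW_lin)

lemma lin_SW_inside [simp]:
  "(\<And>a b. L (\<lambda>x. F x a b)) \<Longrightarrow> L (\<lambda>x. SW h (\<lambda>a b. F x a b))"
  using lin_finop[OF SW_fin, of sc "\<lambda>x (a, b). F x a b"] by auto

text \<open>Iterated coproducts in right-nested normal form. Rewriting with \<open>legs\<close>
  brings differently bracketed coproducts to this form, where they can be compared.\<close>

definition SW3 where "SW3 h F = SW h (\<lambda>a r. SW r (\<lambda>b c. F a b c))"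
definition SW4 where "SW4 h F = SW h (\<lambda>a r. SW3 r (\<lambda>b c d. F a b c d))"
definition SW5 where "SW5 h F = SW h (\<lambda>a r. SW4 r (\<lambda>b c d e. F a b c d e))"
definition SW6 where "SW6 h F = SW h (\<lambda>a r. SW5 r (\<lambda>b c d e f. F a b c d e f))"

lemmas SWn_defs = SW3_def SW4_def SW5_def SW6_def

lemma lin_SW3_inside [simp]:
  "(\<And>a b c. L (\<lambda>x. F x a b c)) \<Longrightarrow> L (\<lambda>x. SW3 h (\<lambda>a b c. F x a b c))"
  by (simp add: SWn_defs)
lemma lin_SW4_inside [simp]:
  "(\<And>a b c d. L (\<lambda>x. F x a b c d)) \<Longrightarrow> L (\<lambda>x. SW4 h (\<lambda>a b c d. F x a b c d))"
  by (simp add: SWn_defs)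

lemma lin_SW3 [simp]:
  "\<lbrakk>VL g; \<And>b c. L (\<lambda>a. F a b c); \<And>a c. L (\<lambda>b. F a b c); \<And>a b. L (\<lambda>c. F a b c)\<rbrakk>
    \<Longrightarrow> L (\<lambda>x. SW3 (g x) (\<lambda>a b c. F a b c))"
  by (simp add: SWn_defs)

lemma SW3_SW_swap: "SW3 h (\<lambda>a b c. SW k (\<lambda>x y. F a b c x y)) = SW k (\<lambda>x y. SW3 h (\<lambda>a b c. F a b c x y))"
  unfolding SW3_def by (rule trans[OF SW_cong SW_swap]) (rule SW_swap)
lemma SW4_SW_swap: "SW4 h (\<lambda>a b c d. SW k (\<lambda>x y. F a b c d x y)) = SW k (\<lambda>x y. SW4 h (\<lambda>a b c d. F a b c d x y))"
  unfolding SW4_def by (rule trans[OF SW_cong SW_swap]) (rule SW3_SW_swap)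

lemma SW2_leg1:
  "\<lbrakk>\<And>b c. L (\<lambda>a. F a b c); \<And>a c. L (\<lambda>b. F a b c); \<And>a b. L (\<lambda>c. F a b c)\<rbrakk>
    \<Longrightarrow> SW h (\<lambda>a b. SW a (\<lambda>x y. F x y b)) = SW3 h F"
  by (simp add: SW_coassoc SW3_def)
lemma SW2_leg2: "SW h (\<lambda>a b. SW b (\<lambda>x y. F a x y)) = SW3 h F"
  by (simp add: SW3_def)

text \<open>Splitting the first leg is where coassociativity enters. A split of a later leg takes
  place inside the tail and is the same statement for one leg fewer.\<close>

lemma SW3_leg1:
  assumes "\<And>b c d. L (\<lambda>a. F a b c d)" "\<And>a c d. L (\<lambda>b. F a b c d)"
    "\<And>a b d. L (\<lambda>c. F a b c d)" "\<And>a b c. L (\<lambda>d. F a b c d)"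
  shows "SW3 h (\<lambda>a b c. SW a (\<lambda>x y. F x y b c)) = SW4 h F"
proof -
  have "SW3 h (\<lambda>a b c. SW a (\<lambda>x y. F x y b c)) = SW h (\<lambda>a r. SW a (\<lambda>x y. SW r (\<lambda>b c. F x y b c)))"
    unfolding SW3_def by (intro SW_cong SW_swap)
  also have "\<dots> = SW4 h F"
    unfolding SW4_def SW3_def by (rule SW_coassoc) (simp_all add: assms)
  finally show ?thesis .
qed
lemma SW3_leg2:
  assumes "\<And>a c d. L (\<lambda>b. F a b c d)"
    "\<And>a b d. L (\<lambda>c. F a b c d)" "\<And>a b c. L (\<lambda>d. F a b c d)"
  shows "SW3 h (\<lambda>a b c. SW b (\<lambda>x y. F a x y c)) = SW4 h F"
  unfolding SW4_def by (simp add: SW3_def[of h] SW2_leg1 assms)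
lemma SW3_leg3: "SW3 h (\<lambda>a b c. SW c (\<lambda>x y. F a b x y)) = SW4 h F"
  by (simp add: SWn_defs)

lemma SW4_leg1:
  assumes "\<And>b c d e. L (\<lambda>a. F a b c d e)" "\<And>a c d e. L (\<lambda>b. F a b c d e)"
    "\<And>a b d e. L (\<lambda>c. F a b c d e)" "\<And>a b c e. L (\<lambda>d. F a b c d e)" "\<And>a b c d. L (\<lambda>e. F a b c d e)"
  shows "SW4 h (\<lambda>a b c d. SW a (\<lambda>x y. F x y b c d)) = SW5 h F"
proof -
  have "SW4 h (\<lambda>a b c d. SW a (\<lambda>x y. F x y b c d)) = SW h (\<lambda>a r. SW a (\<lambda>x y. SW3 r (\<lambda>b c d. F x y b c d)))"
    unfolding SW4_def by (intro SW_cong SW3_SW_swap)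
  also have "\<dots> = SW h (\<lambda>a b. SW b (\<lambda>c d. SW3 d (\<lambda>x y z. F a c x y z)))"
    by (rule SW_coassoc) (simp_all add: assms)
  also have "\<dots> = SW5 h F"
    unfolding SW5_def SW4_def by simp
  finally show ?thesis .
qed
lemma SW4_leg2:
  assumes "\<And>a c d e. L (\<lambda>b. F a b c d e)"
    "\<And>a b d e. L (\<lambda>c. F a b c d e)" "\<And>a b c e. L (\<lambda>d. F a b c d e)" "\<And>a b c d. L (\<lambda>e. F a b c d e)"
  shows "SW4 h (\<lambda>a b c d. SW b (\<lambda>x y. F a x y c d)) = SW5 h F"
  unfolding SW5_def by (simp add: SW4_def[of h] SW3_leg1 assms)
lemma SW4_leg3:
  assumes "\<And>a b d e. L (\<lambda>c. F a b c d e)" "\<And>a b c e. L (\<lambda>d. F a b c d e)" "\<And>a b c d. L (\<lambda>e. F a b c d e)"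
  shows "SW4 h (\<lambda>a b c d. SW c (\<lambda>x y. F a b x y d)) = SW5 h F"
  unfolding SW5_def by (simp add: SW4_def[of h] SW3_leg2 assms)
lemma SW4_leg4: "SW4 h (\<lambda>a b c d. SW d (\<lambda>x y. F a b c x y)) = SW5 h F"
  by (simp add: SWn_defs)

lemma SW5_leg2:
  assumes "\<And>a c d e f. L (\<lambda>b. F a b c d e f)" "\<And>a b d e f. L (\<lambda>c. F a b c d e f)"
    "\<And>a b c e f. L (\<lambda>d. F a b c d e f)" "\<And>a b c d f. L (\<lambda>e. F a b c d e f)" "\<And>a b c d e. L (\<lambda>f. F a b c d e f)"
  shows "SW5 h (\<lambda>a b c d e. SW b (\<lambda>x y. F a x y c d e)) = SW6 h F"
  unfolding SW6_def by (simp add: SW5_def[of h] SW4_leg1 assms)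
lemma SW5_leg3:
  assumes "\<And>a b d e f. L (\<lambda>c. F a b c d e f)"
    "\<And>a b c e f. L (\<lambda>d. F a b c d e f)" "\<And>a b c d f. L (\<lambda>e. F a b c d e f)" "\<And>a b c d e. L (\<lambda>f. F a b c d e f)"
  shows "SW5 h (\<lambda>a b c d e. SW c (\<lambda>x y. F a b x y d e)) = SW6 h F"
  unfolding SW6_def by (simp add: SW5_def[of h] SW4_leg2 assms)
lemma SW5_leg4:
  assumes "\<And>a b c e f. L (\<lambda>d. F a b c d e f)" "\<And>a b c d f. L (\<lambda>e. F a b c d e f)" "\<And>a b c d e. L (\<lambda>f. F a b c d e f)"
  shows "SW5 h (\<lambda>a b c d e. SW d (\<lambda>x y. F a b c x y e)) = SW6 h F"
  unfolding SW6_def by (simp add: SW5_def[of h] SW4_leg3 assms)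
lemma SW5_leg5: "SW5 h (\<lambda>a b c d e. SW e (\<lambda>x y. F a b c d x y)) = SW6 h F"
  by (simp add: SWn_defs)

lemma SW2_leg1_SW3:
  assumes "\<And>b c d. L (\<lambda>a. F a b c d)" "\<And>a c d. L (\<lambda>b. F a b c d)"
    "\<And>a b d. L (\<lambda>c. F a b c d)" "\<And>a b c. L (\<lambda>d. F a b c d)"
  shows "SW h (\<lambda>a b. SW3 a (\<lambda>x y z. F x y z b)) = SW4 h F"
proof -
  have "SW h (\<lambda>a b. SW3 a (\<lambda>x y z. F x y z b)) = SW3 h (\<lambda>x l b. SW l (\<lambda>y z. F x y z b))"
    unfolding SW3_def[of "_ :: 'h" "\<lambda>x y z. F x y z _"] by (rule SW2_leg1) (simp_all add: assms)
  also have "\<dots> = SW4 h F"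
    by (rule SW3_leg2) (simp_all add: assms)
  finally show ?thesis .
qed

lemma SW2_leg2_SW3: "SW h (\<lambda>a b. SW3 b (\<lambda>x y z. F a x y z)) = SW4 h F"
  by (simp add: SW4_def)

lemma SW3_leg1_SW4:
  assumes "\<And>b c d e f. L (\<lambda>a. F a b c d e f)" "\<And>a c d e f. L (\<lambda>b. F a b c d e f)"
    "\<And>a b d e f. L (\<lambda>c. F a b c d e f)" "\<And>a b c e f. L (\<lambda>d. F a b c d e f)"
    "\<And>a b c d f. L (\<lambda>e. F a b c d e f)" "\<And>a b c d e. L (\<lambda>f. F a b c d e f)"
  shows "SW3 h (\<lambda>n r s. SW4 n (\<lambda>a b c d. F a b c d r s)) = SW6 h F"
proof -
  have "SW3 h (\<lambda>n r s. SW4 n (\<lambda>a b c d. F a b c d r s)) = SW4 h (\<lambda>a m r s. SW3 m (\<lambda>b c d. F a b c d r s))"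
    unfolding SW4_def[of "_ :: 'h" "\<lambda>a b c d. F a b c d _ _"] by (rule SW3_leg1) (simp_all add: assms)
  also have "\<dots> = SW5 h (\<lambda>a b l r s. SW l (\<lambda>c d. F a b c d r s))"
    unfolding SW3_def by (rule SW4_leg2) (simp_all add: assms)
  also have "\<dots> = SW6 h F"
    by (rule SW5_leg3) (simp_all add: assms)
  finally show ?thesis .
qed

lemmas legs = SW2_leg1 SW2_leg2 SW3_leg1 SW3_leg2 SW3_leg3 SW4_leg1 SW4_leg2 SW4_leg3 SW4_leg4
  SW5_leg2 SW5_leg3 SW5_leg4 SW5_leg5 SW2_leg1_SW3 SW2_leg2_SW3

text \<open>Multiplicativity for the product 1 y: although Delta(1) may differ from 1 (x) 1, a
  coproduct absorbs it as a factor.\<close>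

lemma SW_one_left:
  "\<lbrakk>\<And>b. L (\<lambda>a. F a b); \<And>a. L (\<lambda>b. F a b)\<rbrakk>
    \<Longrightarrow> SW one (\<lambda>a b. SW y (\<lambda>c d. F (a \<odot> c) (b \<odot> d))) = SW y F"
  using SW_mul[of F one y] by simp
lemma SW_one_right:
  "\<lbrakk>\<And>b. L (\<lambda>a. F a b); \<And>a. L (\<lambda>b. F a b)\<rbrakk>
    \<Longrightarrow> SW y (\<lambda>a b. SW one (\<lambda>c d. F (a \<odot> c) (b \<odot> d))) = SW y F"
  using SW_mul[of F y one] by simp

end

lemma sweedler_cop:
  assumes "sweedler sc mul one SW"
  shows "sweedler sc mul one (\<lambda>h F. SW h (\<lambda>a b. F b a))"
proof -
  interpret sweedler sc mul one SW by fact
  show ?thesis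
  proof
    show "finop (\<lambda>f. SW h (\<lambda>a b. f (b, a)))" for h
      using finop_map[OF SW_fin, where g = "\<lambda>(a, b). (b, a)"] by simp
  qed (simp_all add: mul_left mul_right mul_assoc SW_lin SW_mul SW_coassoc)
qed

lemma sweedler_op:
  assumes "sweedler sc mul one SW"
  shows "sweedler sc (\<lambda>x y. mul y x) one SW"
proof -
  interpret sweedler sc mul one SW by fact
  show ?thesis
  proof
    fix F x y
    assume "\<And>b. lin sc (\<lambda>a. F a b)" "\<And>a. lin sc (\<lambda>b. F a b)"
    then show "SW (mul y x) F = SW x (\<lambda>a b. SW y (\<lambda>c d. F (mul c a) (mul d b)))"
      by (subst SW_swap) (simp add: SW_mul)
  qed (simp_all add: mul_left mul_right mul_assoc SW_lin SW_coassoc SW_fin)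
qed

section \<open>Weak bialgebras\<close>

text \<open>\<open>separation\<close> and \<open>SW_vector\<close> concern only the vector space:
  functionals separate points, and a Sweedler sum of vectors exists as a vector. They connect the
  functional calculus with genuine elements such as \<open>et h\<close>.\<close>

locale wbialg = sweedler sc mul one SW
  for sc :: "'k::field \<Rightarrow> 'h::ab_group_add \<Rightarrow> 'h"
    and mul :: "'h \<Rightarrow> 'h \<Rightarrow> 'h" (infixl "\<odot>" 70) and one :: 'h
    and SW :: "'h \<Rightarrow> ('h \<Rightarrow> 'h \<Rightarrow> 'k) \<Rightarrow> 'k" +
  fixes \<epsilon> :: "'h \<Rightarrow> 'k"
  assumes separation: "(\<And>f. lin sc f \<Longrightarrow> f x = f y) \<Longrightarrow> x = y"
    and SW_vector: "\<exists>z. \<forall>f. lin sc f \<longrightarrow> f z = SW h (\<lambda>a b. f (\<gamma> a b))"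
    and eps_lin: "lin sc \<epsilon>"
    and counit_left: "lin sc f \<Longrightarrow> SW h (\<lambda>a b. \<epsilon> a * f b) = f h"
    and counit_right: "lin sc f \<Longrightarrow> SW h (\<lambda>a b. \<epsilon> b * f a) = f h"
    and eps_mul: "SW h (\<lambda>a b. \<epsilon> (k \<odot> a) * \<epsilon> (b \<odot> g)) = \<epsilon> (k \<odot> h \<odot> g)"
    and eps_mul_flip: "SW h (\<lambda>a b. \<epsilon> (k \<odot> b) * \<epsilon> (a \<odot> g)) = \<epsilon> (k \<odot> h \<odot> g)"
    and unit: "\<lbrakk>\<And>b c. lin sc (\<lambda>a. G a b c); \<And>a c. lin sc (\<lambda>b. G a b c); \<And>a b. lin sc (\<lambda>c. G a b c)\<rbrakk>
      \<Longrightarrow> SW one (\<lambda>a b. SW b (\<lambda>c d. G a c d)) = SW one (\<lambda>a b. SW one (\<lambda>c d. G a (c \<odot> b) d))"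
    and unit_flip: "\<lbrakk>\<And>b c. lin sc (\<lambda>a. G a b c); \<And>a c. lin sc (\<lambda>b. G a b c); \<And>a b. lin sc (\<lambda>c. G a b c)\<rbrakk>
      \<Longrightarrow> SW one (\<lambda>a b. SW b (\<lambda>c d. G a c d)) = SW one (\<lambda>a b. SW one (\<lambda>c d. G a (b \<odot> c) d))"

lemma wbialg_cop:
  assumes "wbialg sc mul one SW \<epsilon>"
  shows "wbialg sc mul one (\<lambda>h F. SW h (\<lambda>a b. F b a)) \<epsilon>"
proof -
  interpret wbialg sc mul one SW \<epsilon> by fact
  interpret c: sweedler sc mul one "\<lambda>h F. SW h (\<lambda>a b. F b a)"
    by (rule sweedler_cop) unfold_locales
  show ?thesis
  proof
    fix G :: "'b \<Rightarrow> 'b \<Rightarrow> 'b \<Rightarrow> 'a"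
    assume G: "\<And>b c. lin sc (\<lambda>a. G a b c)" "\<And>a c. lin sc (\<lambda>b. G a b c)" "\<And>a b. lin sc (\<lambda>c. G a b c)"
    have *: "SW one (\<lambda>a b. SW a (\<lambda>c d. G b d c)) = SW one (\<lambda>a b. SW b (\<lambda>c d. G d c a))"
      using G by (intro SW_coassoc)
    show "SW one (\<lambda>a b. SW a (\<lambda>c d. G b d c)) = SW one (\<lambda>a b. SW one (\<lambda>c d. G b (mul d a) c))"
      unfolding * using G by (subst unit_flip) (auto intro: SW_swap)
    show "SW one (\<lambda>a b. SW a (\<lambda>c d. G b d c)) = SW one (\<lambda>a b. SW one (\<lambda>c d. G b (mul a d) c))"
      unfolding * using G by (subst unit) (auto intro: SW_swap)
  qed (simp_all add: eps_lin counit_left counit_right eps_mul eps_mul_flip SW_vector separation)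
qed

lemma wbialg_op:
  assumes "wbialg sc mul one SW \<epsilon>"
  shows "wbialg sc (\<lambda>x y. mul y x) one SW \<epsilon>"
proof -
  interpret wbialg sc mul one SW \<epsilon> by fact
  interpret o: sweedler sc "\<lambda>x y. mul y x" one SW
    by (rule sweedler_op) unfold_locales
  show ?thesis
  proof
    show "SW h (\<lambda>a b. \<epsilon> (mul a k) * \<epsilon> (mul g b)) = \<epsilon> (mul g (mul h k))" for h k g
      using eps_mul_flip[of h g k] by (simp add: mult.commute mul_assoc)
    show "SW h (\<lambda>a b. \<epsilon> (mul b k) * \<epsilon> (mul g a)) = \<epsilon> (mul g (mul h k))" for h k g
      using eps_mul[of h g k] by (simp add: mult.commute mul_assoc)
  qed (simp_all add: eps_lin counit_left counit_right SW_vector separation unit[symmetric] unit_flip[symmetric])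
qed

lemma wbialg_opcop:
  "wbialg sc mul one SW \<epsilon> \<Longrightarrow> wbialg sc (\<lambda>x y. mul y x) one (\<lambda>h F. SW h (\<lambda>a b. F b a)) \<epsilon>"
  by (rule wbialg_op[OF wbialg_cop])

text \<open>The target and source subalgebras $H_t$ and $H_s$, described by
  $\Delta(x) = x 1_1 \otimes 1_2 = 1_1 x \otimes 1_2$ and $\Delta(x) = 1_1 \otimes x 1_2 = 1_1 \otimes 1_2 x$.\<close>

definition Htgt :: "('k::field \<Rightarrow> 'h::ab_group_add \<Rightarrow> 'h) \<Rightarrow> ('h \<Rightarrow> 'h \<Rightarrow> 'h) \<Rightarrow> 'h
    \<Rightarrow> ('h \<Rightarrow> ('h \<Rightarrow> 'h \<Rightarrow> 'k) \<Rightarrow> 'k) \<Rightarrow> 'h \<Rightarrow> bool" where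
  "Htgt sc mul one SW x \<longleftrightarrow> (\<forall>F. (\<forall>b. lin sc (\<lambda>a. F a b)) \<longrightarrow> (\<forall>a. lin sc (\<lambda>b. F a b)) \<longrightarrow>
     SW x F = SW one (\<lambda>a b. F (mul x a) b) \<and> SW x F = SW one (\<lambda>a b. F (mul a x) b))"

definition Hsrc :: "('k::field \<Rightarrow> 'h::ab_group_add \<Rightarrow> 'h) \<Rightarrow> ('h \<Rightarrow> 'h \<Rightarrow> 'h) \<Rightarrow> 'h
    \<Rightarrow> ('h \<Rightarrow> ('h \<Rightarrow> 'h \<Rightarrow> 'k) \<Rightarrow> 'k) \<Rightarrow> 'h \<Rightarrow> bool" where
  "Hsrc sc mul one SW x \<longleftrightarrow> (\<forall>F. (\<forall>b. lin sc (\<lambda>a. F a b)) \<longrightarrow> (\<forall>a. lin sc (\<lambda>b. F a b)) \<longrightarrow>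
     SW x F = SW one (\<lambda>a b. F a (mul x b)) \<and> SW x F = SW one (\<lambda>a b. F a (mul b x)))"

lemma all_flip2: "(\<forall>F. P (\<lambda>a b. F b a)) \<longleftrightarrow> (\<forall>F. P F)"
  by (auto dest: spec[of _ "\<lambda>a b. _ b a"])

lemma Htgt_opcop [simp]:
  "Htgt sc (\<lambda>x y. mul y x) one (\<lambda>h F. SW h (\<lambda>a b. F b a)) = Hsrc sc mul one SW"
proof
  fix x
  show "Htgt sc (\<lambda>x y. mul y x) one (\<lambda>h F. SW h (\<lambda>a b. F b a)) x = Hsrc sc mul one SW x"
    unfolding Htgt_def Hsrc_def
    by (subst (2) all_flip2[symmetric]) auto
qed

lemma Hsrc_opcop [simp]:
  "Hsrc sc (\<lambda>x y. mul y x) one (\<lambda>h F. SW h (\<lambda>a b. F b a)) = Htgt sc mul one SW"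
proof
  fix x
  show "Hsrc sc (\<lambda>x y. mul y x) one (\<lambda>h F. SW h (\<lambda>a b. F b a)) x = Htgt sc mul one SW x"
    unfolding Htgt_def Hsrc_def
    by (subst (2) all_flip2[symmetric]) auto
qed

lemma Htgt_cop [simp]:
  "Htgt sc mul one (\<lambda>h F. SW h (\<lambda>a b. F b a)) = Hsrc sc mul one SW"
proof
  fix x
  show "Htgt sc mul one (\<lambda>h F. SW h (\<lambda>a b. F b a)) x = Hsrc sc mul one SW x"
    unfolding Htgt_def Hsrc_def
    by (subst (2) all_flip2[symmetric]) auto
qed

lemma Hsrc_cop [simp]:
  "Hsrc sc mul one (\<lambda>h F. SW h (\<lambda>a b. F b a)) = Htgt sc mul one SW"
proof
  fix x
  show "Hsrc sc mul one (\<lambda>h F. SW h (\<lambda>a b. F b a)) x = Htgt sc mul one SW x"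
    unfolding Htgt_def Hsrc_def
    by (subst (2) all_flip2[symmetric]) auto
qed

context sweedler
begin

abbreviation Ht where "Ht \<equiv> Htgt sc mul one SW"
abbreviation Hs where "Hs \<equiv> Hsrc sc mul one SW"

lemma Ht_left: "\<lbrakk>Ht x; \<And>b. L (\<lambda>a. F a b); \<And>a. L (\<lambda>b. F a b)\<rbrakk> \<Longrightarrow> SW x F = SW one (\<lambda>a b. F (x \<odot> a) b)"
  and Ht_right: "\<lbrakk>Ht x; \<And>b. L (\<lambda>a. F a b); \<And>a. L (\<lambda>b. F a b)\<rbrakk> \<Longrightarrow> SW x F = SW one (\<lambda>a b. F (a \<odot> x) b)"
  unfolding Htgt_def by blast+

lemma Hs_left: "\<lbrakk>Hs x; \<And>b. L (\<lambda>a. F a b); \<And>a. L (\<lambda>b. F a b)\<rbrakk> \<Longrightarrow> SW x F = SW one (\<lambda>a b. F a (x \<odot> b))"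
  unfolding Hsrc_def by blast

text \<open>Delta(h) Delta(x) = Delta(h) Delta(1) (x (x) 1) for x in H_t, and Delta(h) absorbs
  Delta(1).\<close>

lemma SW_mul_Ht:
  assumes "Ht x" "\<And>b. L (\<lambda>a. F a b)" "\<And>a. L (\<lambda>b. F a b)"
  shows "SW (h \<odot> x) F = SW h (\<lambda>a b. F (a \<odot> x) b)"
proof -
  have [simp]: "VL g \<Longrightarrow> L (\<lambda>x. F (g x) b)" "VL g \<Longrightarrow> L (\<lambda>x. F b (g x))" for g b
    using assms by (auto intro: lin_vlin[of sc "\<lambda>x. F x b"] lin_vlin[of sc "F b"])
  have "SW (h \<odot> x) F = SW h (\<lambda>a b. SW x (\<lambda>c d. F (a \<odot> c) (b \<odot> d)))"
    by (simp add: SW_mul)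
  also have "\<dots> = SW h (\<lambda>a b. SW one (\<lambda>c d. F ((a \<odot> c) \<odot> x) (b \<odot> d)))"
    by (simp add: Ht_right[OF assms(1)] mul_assoc)
  also have "\<dots> = SW h (\<lambda>a b. F (a \<odot> x) b)"
    by (rule SW_one_right[of "\<lambda>a b. F (a \<odot> x) b"]) simp_all
  finally show ?thesis .
qed

end

section \<open>The target and source maps, and the location of Delta(1)\<close>

context wbialg
begin

lemma lin_eps [simp]: "VL g \<Longrightarrow> L (\<lambda>x. \<epsilon> (g x))"
  by (rule lin_vlin[OF eps_lin])

text \<open>The target map \<epsilon>(1_1 h) 1_2 and the source map 1_1 \<epsilon>(h 1_2), picked
  out by the values of functionals on them.\<close>

definition et where "et h = (SOME z. \<forall>f. L f \<longrightarrow> f z = SW one (\<lambda>a b. \<epsilon> (a \<odot> h) * f b))"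
definition es where "es h = (SOME z. \<forall>f. L f \<longrightarrow> f z = SW one (\<lambda>a b. \<epsilon> (h \<odot> b) * f a))"

lemma et: assumes "L f" shows "f (et h) = SW one (\<lambda>a b. \<epsilon> (a \<odot> h) * f b)"
proof -
  obtain z where z: "\<forall>f. L f \<longrightarrow> f z = SW one (\<lambda>a b. f (sc (\<epsilon> (a \<odot> h)) b))"
    using SW_vector[of one "\<lambda>a b. sc (\<epsilon> (a \<odot> h)) b"] by blast
  then have "\<forall>f. L f \<longrightarrow> f z = SW one (\<lambda>a b. \<epsilon> (a \<odot> h) * f b)"
    by (simp add: lin_def)
  then have "\<forall>f. L f \<longrightarrow> f (et h) = SW one (\<lambda>a b. \<epsilon> (a \<odot> h) * f b)"
    unfolding et_def by (rule someI)
  with assms show ?thesis by blast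
qed

text \<open>The definition of \<open>es\<close> is literally that of \<open>et\<close> in
  H^{op,cop}, so each property of \<open>es\<close> below is inherited from one of
  \<open>et\<close>.\<close>

lemma es_eq_et: "es = wbialg.et sc (\<lambda>x y. mul y x) one (\<lambda>h F. SW h (\<lambda>a b. F b a)) \<epsilon>"
  unfolding es_def wbialg.et_def[OF wbialg_opcop[OF wbialg_axioms]] by (rule refl)

lemma es: assumes "L f" shows "f (es h) = SW one (\<lambda>a b. \<epsilon> (h \<odot> b) * f a)"
  unfolding es_eq_et by (rule wbialg.et[OF wbialg_opcop[OF wbialg_axioms] assms])

lemma vlin_et [simp]: "VL g \<Longrightarrow> VL (\<lambda>x. et (g x))"
proof (rule vlin_comp[of _ et])
  have *: "L (\<lambda>x. f (et x))" if "L f" for f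
    unfolding et[OF that] by simp
  show "VL et"
    unfolding vlin_def
  proof (intro conjI allI)
    fix x y c
    show "et (x + y) = et x + et y"
      by (rule separation) (use * in \<open>auto simp: lin_def\<close>)
    show "et (sc c x) = sc c (et x)"
      by (rule separation) (use * in \<open>auto simp: lin_def\<close>)
  qed
qed

lemma vlin_es [simp]: "VL g \<Longrightarrow> VL (\<lambda>x. es (g x))"
  unfolding es_eq_et by (rule wbialg.vlin_et[OF wbialg_opcop[OF wbialg_axioms]])

lemma eps_et: "\<epsilon> (k \<odot> et h) = \<epsilon> (k \<odot> h)"
  using eps_mul_flip[of one k h] by (subst et[of "\<lambda>z. \<epsilon> (k \<odot> z)"]) (simp_all add: mult.commute)

lemma et_mul_et: "et (h \<odot> et g) = et (h \<odot> g)"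
  by (rule separation) (simp add: et mul_assoc[symmetric] eps_et)

lemma es_es_mul: "es (es h \<odot> g) = es (h \<odot> g)"
  unfolding es_eq_et by (rule wbialg.et_mul_et[OF wbialg_opcop[OF wbialg_axioms]])

lemma et_one [simp]: "et one = one"
  by (rule separation) (simp add: et counit_left)
lemma es_one [simp]: "es one = one"
  unfolding es_eq_et by (rule wbialg.et_one[OF wbialg_opcop[OF wbialg_axioms]])

text \<open>Contracting the first leg of Delta^2(1) with \<epsilon>(_ h) turns the two
  factorisations of Delta^2(1) into the two descriptions of the coproduct of
  \<open>et h\<close>.\<close>

lemma Ht_et: "Ht (et h)"
proof -
  have "SW (et h) F = SW one (\<lambda>a b. F (et h \<odot> a) b) \<and> SW (et h) F = SW one (\<lambda>a b. F (a \<odot> et h) b)"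
    if F: "\<And>b. L (\<lambda>a. F a b)" "\<And>a. L (\<lambda>b. F a b)" for F
  proof -
    have [simp]: "VL g \<Longrightarrow> L (\<lambda>x. F (g x) b)" "VL g \<Longrightarrow> L (\<lambda>x. F b (g x))" for g b
      using F by (auto intro: lin_vlin[of sc "\<lambda>x. F x b"] lin_vlin[of sc "F b"])
    have 0: "SW (et h) F = SW one (\<lambda>a b. SW b (\<lambda>c d. \<epsilon> (a \<odot> h) * F c d))"
      by (subst et[of "\<lambda>z. SW z F"]) (simp_all add: SW_scale)
    have "SW (et h) F = SW one (\<lambda>a b. SW one (\<lambda>c d. \<epsilon> (a \<odot> h) * F (b \<odot> c) d))"
      unfolding 0 by (rule unit_flip) simp_all
    also have "\<dots> = SW one (\<lambda>c d. F (et h \<odot> c) d)"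
      by (subst SW_swap) (simp add: et[of "\<lambda>z. F (z \<odot> _) _", symmetric])
    finally have 1: "SW (et h) F = SW one (\<lambda>c d. F (et h \<odot> c) d)" .
    have "SW (et h) F = SW one (\<lambda>a b. SW one (\<lambda>c d. \<epsilon> (a \<odot> h) * F (c \<odot> b) d))"
      unfolding 0 by (rule unit) simp_all
    also have "\<dots> = SW one (\<lambda>c d. F (c \<odot> et h) d)"
      by (subst SW_swap) (simp add: et[of "\<lambda>z. F (_ \<odot> z) _", symmetric])
    finally show ?thesis using 1 by simp
  qed
  then show ?thesis unfolding Htgt_def by blast
qed

lemma Hs_es: "Hs (es h)"
  using wbialg.Ht_et[OF wbialg_opcop[OF wbialg_axioms], of h] by (simp add: es_eq_et)

text \<open>Contracting both outer legs of Delta^2(1) leaves the middle leg, which the two unit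
  axioms write as the product in either order.\<close>

lemma et_es_commute: "et h \<odot> es g = es g \<odot> et h"
proof (rule separation)
  fix f assume f: "L f"
  have [simp]: "VL u \<Longrightarrow> L (\<lambda>x. f (u x))" for u by (rule lin_vlin[OF f])
  have "f (et h \<odot> es g) = SW one (\<lambda>a b. SW one (\<lambda>c d. \<epsilon> (a \<odot> h) * (\<epsilon> (g \<odot> d) * f (b \<odot> c))))"
    by (subst et[of "\<lambda>z. f (z \<odot> es g)"], simp, simp add: es[of "\<lambda>z. f (_ \<odot> z)"] SW_scale)
  also have "\<dots> = SW one (\<lambda>a b. SW b (\<lambda>c d. \<epsilon> (a \<odot> h) * (\<epsilon> (g \<odot> d) * f c)))"
    by (rule unit_flip[symmetric]) simp_all
  also have "\<dots> = SW one (\<lambda>a b. SW one (\<lambda>c d. \<epsilon> (a \<odot> h) * (\<epsilon> (g \<odot> d) * f (c \<odot> b))))"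
    by (rule unit) simp_all
  also have "\<dots> = f (es g \<odot> et h)"
    by (subst et[of "\<lambda>z. f (es g \<odot> z)"], simp, simp add: es[of "\<lambda>z. f (z \<odot> _)"] SW_scale)
  finally show "f (et h \<odot> es g) = f (es g \<odot> et h)" .
qed

text \<open>Insert a counit into the first leg of 1_1 h (x) 1_2 and write Delta^2(1) as two copies
  of Delta(1). One copy is absorbed by Delta(h), the other produces \<open>et\<close>.\<close>

lemma SW_et:
  assumes F: "\<And>b. L (\<lambda>a. F a b)" "\<And>a. L (\<lambda>b. F a b)"
  shows "SW h (\<lambda>a b. F a (et b)) = SW one (\<lambda>a b. F (a \<odot> h) b)"
proof -
  have [simp]: "VL g \<Longrightarrow> L (\<lambda>x. F (g x) b)" "VL g \<Longrightarrow> L (\<lambda>x. F b (g x))" for g b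
    using F by (auto intro: lin_vlin[of sc "\<lambda>x. F x b"] lin_vlin[of sc "F b"])
  have "SW one (\<lambda>a b. F (a \<odot> h) b) = SW one (\<lambda>a b. SW (a \<odot> h) (\<lambda>x y. \<epsilon> y * F x b))"
    by (simp add: counit_right)
  also have "\<dots> = SW one (\<lambda>a b. SW a (\<lambda>p q. SW h (\<lambda>c d. \<epsilon> (q \<odot> d) * F (p \<odot> c) b)))"
    by (simp add: SW_mul)
  also have "\<dots> = SW one (\<lambda>p b. SW b (\<lambda>q b. SW h (\<lambda>c d. \<epsilon> (q \<odot> d) * F (p \<odot> c) b)))"
    by (rule SW_coassoc) simp_all
  also have "\<dots> = SW one (\<lambda>p b. SW one (\<lambda>q r. SW h (\<lambda>c d. \<epsilon> ((q \<odot> b) \<odot> d) * F (p \<odot> c) r)))"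
    by (rule unit) simp_all
  also have "\<dots> = SW one (\<lambda>q r. SW one (\<lambda>p b. SW h (\<lambda>c d. \<epsilon> (q \<odot> (b \<odot> d)) * F (p \<odot> c) r)))"
    by (subst SW_swap) (simp add: mul_assoc)
  also have "\<dots> = SW one (\<lambda>q r. SW h (\<lambda>c d. \<epsilon> (q \<odot> d) * F c r))"
    by (intro SW_cong SW_one_left[of "\<lambda>c d. \<epsilon> (_ \<odot> d) * F c _"]) simp_all
  also have "\<dots> = SW h (\<lambda>a b. F a (et b))"
    by (subst SW_swap) (simp add: et[of "F _"] F)
  finally show ?thesis ..
qed

lemma SW_es:
  "\<lbrakk>\<And>b. L (\<lambda>a. F a b); \<And>a. L (\<lambda>b. F a b)\<rbrakk> \<Longrightarrow> SW h (\<lambda>a b. F (es a) b) = SW one (\<lambda>a b. F a (h \<odot> b))"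
  unfolding es_eq_et by (rule wbialg.SW_et[OF wbialg_opcop[OF wbialg_axioms]])

text \<open>This is \<open>SW_et\<close> in H^op. The target map there is h |-> \<epsilon>(h 1_1)
  1_2, a further counital map, and is therefore written out.\<close>

lemma SW_eps_right:
  assumes F: "\<And>b. L (\<lambda>a. F a b)" "\<And>a. L (\<lambda>b. F a b)"
  shows "SW h (\<lambda>a b. SW one (\<lambda>c d. \<epsilon> (b \<odot> c) * F a d)) = SW one (\<lambda>a b. F (h \<odot> a) b)"
  using wbialg.SW_et[OF wbialg_op[OF wbialg_axioms], of F h] F
  by (simp add: wbialg.et[OF wbialg_op[OF wbialg_axioms]])

text \<open>\<open>SW_et\<close> and \<open>SW_es\<close> at h = 1. This places Delta(1) in H_s (x)
  H_t, which makes commutation rules available for its legs.\<close>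

lemma SW_one_es_et:
  assumes F: "\<And>b. L (\<lambda>a. F a b)" "\<And>a. L (\<lambda>b. F a b)"
  shows "SW one (\<lambda>a b. F (es a) (et b)) = SW one F"
proof -
  have [simp]: "VL g \<Longrightarrow> L (\<lambda>x. F (g x) b)" "VL g \<Longrightarrow> L (\<lambda>x. F b (g x))" for g b
    using F by (auto intro: lin_vlin[of sc "\<lambda>x. F x b"] lin_vlin[of sc "F b"])
  have "SW one (\<lambda>a b. F (es a) (et b)) = SW one (\<lambda>a b. F (es (a \<odot> one)) b)"
    by (rule SW_et) simp_all
  also have "\<dots> = SW one (\<lambda>a b. F (es a) b)" by simp
  also have "\<dots> = SW one (\<lambda>a b. F a (one \<odot> b))"
    by (rule SW_es) simp_all
  finally show ?thesis by simp
qed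

end

section \<open>The antipode of a weak Hopf algebra\<close>

locale wantipode = wbialg sc mul one SW \<epsilon>
  for sc :: "'k::field \<Rightarrow> 'h::ab_group_add \<Rightarrow> 'h"
    and mul :: "'h \<Rightarrow> 'h \<Rightarrow> 'h" (infixl "\<odot>" 70) and one :: 'h
    and SW :: "'h \<Rightarrow> ('h \<Rightarrow> 'h \<Rightarrow> 'k) \<Rightarrow> 'k" and \<epsilon> :: "'h \<Rightarrow> 'k" +
  fixes S :: "'h \<Rightarrow> 'h"
  assumes S_vlin: "vlin sc S"
    and S_target: "lin sc f \<Longrightarrow> SW h (\<lambda>a b. f (a \<odot> S b)) = SW one (\<lambda>a b. \<epsilon> (a \<odot> h) * f b)"
    and S_source: "lin sc f \<Longrightarrow> SW h (\<lambda>a b. f (S a \<odot> b)) = SW one (\<lambda>a b. \<epsilon> (h \<odot> b) * f a)"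
    and S_triple: "lin sc f \<Longrightarrow> f (S h) = SW h (\<lambda>a r. SW r (\<lambda>b c. f (S a \<odot> b \<odot> S c)))"

lemma wantipode_opcop:
  assumes "wantipode sc mul one SW \<epsilon> S"
  shows "wantipode sc (\<lambda>x y. mul y x) one (\<lambda>h F. SW h (\<lambda>a b. F b a)) \<epsilon> S"
proof -
  interpret wantipode sc mul one SW \<epsilon> S by fact
  interpret o: wbialg sc "\<lambda>x y. mul y x" one "\<lambda>h F. SW h (\<lambda>a b. F b a)" \<epsilon>
    by (rule wbialg_opcop) unfold_locales
  show ?thesis
  proof
    fix f h assume f: "L f"
    have [simp]: "VL u \<Longrightarrow> L (\<lambda>x. f (u x))" "VL u \<Longrightarrow> VL (\<lambda>x. S (u x))" for u
      by (auto intro: lin_vlin[OF f] vlin_comp[OF S_vlin])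
    show "f (S h) = SW h (\<lambda>r a. SW r (\<lambda>c b. f (mul (S c) (mul b (S a)))))"
      using S_triple[OF f, of h] by (subst SW_coassoc) (simp_all add: mul_assoc)
  qed (simp_all add: S_vlin S_target S_source)
qed

context wantipode
begin

lemma vlin_S [simp]: "VL g \<Longrightarrow> VL (\<lambda>x. S (g x))"
  by (rule vlin_comp[OF S_vlin])

lemma et_S: "L f \<Longrightarrow> SW h (\<lambda>a b. f (a \<odot> S b)) = f (et h)"
  by (simp add: S_target et)
lemma es_S: "L f \<Longrightarrow> SW h (\<lambda>a b. f (S a \<odot> b)) = f (es h)"
  by (simp add: S_source es)

lemma S_et:
  assumes f: "L f" shows "SW h (\<lambda>a b. f (S a \<odot> et b)) = f (S h)"
proof -
  have [simp]: "VL u \<Longrightarrow> L (\<lambda>x. f (u x))" for u by (rule lin_vlin[OF f])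
  show ?thesis
    unfolding S_triple[OF f, of h] by (simp add: et_S[of "\<lambda>z. f (S _ \<odot> z)", symmetric] mul_assoc)
qed

lemma S_es:
  assumes f: "L f" shows "SW h (\<lambda>a b. f (es a \<odot> S b)) = f (S h)"
  unfolding es_eq_et by (rule wantipode.S_et[OF wantipode_opcop[OF wantipode_axioms] f])

lemma S_one [simp]: "S one = one"
proof (rule separation)
  fix f assume f: "L f"
  have [simp]: "VL u \<Longrightarrow> L (\<lambda>x. f (u x))" for u by (rule lin_vlin[OF f])
  have "f (S one) = SW one (\<lambda>a b. f (S a \<odot> et b))"
    by (simp add: S_et f)
  also have "\<dots> = SW one (\<lambda>a b. f (S (a \<odot> one) \<odot> b))"
    by (rule SW_et) simp_all
  also have "\<dots> = f one"
    using f by (simp add: es_S)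
  finally show "f (S one) = f one" .
qed

lemma et_mul_Ht: "L f \<Longrightarrow> f (et (h \<odot> et x)) = SW h (\<lambda>a b. f (a \<odot> et x \<odot> S b))"
proof -
  assume f: "L f"
  have [simp]: "VL u \<Longrightarrow> L (\<lambda>x. f (u x))" for u by (rule lin_vlin[OF f])
  have "f (et (h \<odot> et x)) = SW (h \<odot> et x) (\<lambda>a b. f (a \<odot> S b))"
    by (simp add: et_S f)
  also have "\<dots> = SW h (\<lambda>a b. f (a \<odot> et x \<odot> S b))"
    by (rule SW_mul_Ht[OF Ht_et]) simp_all
  finally show ?thesis .
qed

lemma es_mul_Hs: "L f \<Longrightarrow> f (es (es x \<odot> h)) = SW h (\<lambda>a b. f (S a \<odot> (es x \<odot> b)))"
  unfolding es_eq_et by (rule wantipode.et_mul_Ht[OF wantipode_opcop[OF wantipode_axioms]])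

text \<open>Uniqueness of convolution inverses, with \<open>es\<close> and \<open>et\<close> in the
  role of the unit: both sides reduce to \<open>?M\<close>, which is es(h_1 g_1) S(g_2)
  S(h_2).\<close>

lemma S_mul: "S (h \<odot> g) = S g \<odot> S h"
proof (rule separation)
  fix f assume f: "L f"
  have [simp]: "VL u \<Longrightarrow> L (\<lambda>x. f (u x))" for u by (rule lin_vlin[OF f])
  let ?M = "SW h (\<lambda>p z. SW g (\<lambda>q y. f (es (p \<odot> q) \<odot> (S y \<odot> S z))))"
  have "f (S (h \<odot> g)) = SW h (\<lambda>a b. SW g (\<lambda>c d. f (S (a \<odot> c) \<odot> et (b \<odot> et d))))"
    by (subst S_et[symmetric]) (simp_all add: f SW_mul et_mul_et)
  also have "\<dots> = SW h (\<lambda>a b. SW g (\<lambda>c d. SW b (\<lambda>x z. f (S (a \<odot> c) \<odot> (x \<odot> et d \<odot> S z)))))"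
    by (simp add: et_mul_Ht[of "\<lambda>w. f (_ \<odot> w)"])
  also have "\<dots> = SW h (\<lambda>a b. SW b (\<lambda>x z. SW g (\<lambda>c d. f (S (a \<odot> c) \<odot> (x \<odot> et d \<odot> S z)))))"
    by (intro SW_cong SW_swap)
  also have "\<dots> = SW h (\<lambda>a b. SW b (\<lambda>x z. SW g (\<lambda>c d. SW d (\<lambda>w y. f (S (a \<odot> c) \<odot> (x \<odot> (w \<odot> S y) \<odot> S z))))))"
    by (simp add: et_S[of "\<lambda>w. f (_ \<odot> (_ \<odot> w \<odot> _))", symmetric])
  also have "\<dots> = SW h (\<lambda>p z. SW p (\<lambda>a x. SW g (\<lambda>q y. SW q (\<lambda>c w. f (S (a \<odot> c) \<odot> (x \<odot> (w \<odot> S y) \<odot> S z))))))"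
    by (simp add: legs)
  also have "\<dots> = SW h (\<lambda>p z. SW g (\<lambda>q y. SW p (\<lambda>a x. SW q (\<lambda>c w. f (S (a \<odot> c) \<odot> (x \<odot> (w \<odot> S y) \<odot> S z))))))"
    by (intro SW_cong SW_swap)
  also have "\<dots> = SW h (\<lambda>p z. SW g (\<lambda>q y. SW (p \<odot> q) (\<lambda>a x. f ((S a \<odot> x) \<odot> (S y \<odot> S z)))))"
    by (simp add: SW_mul mul_assoc)
  also have "\<dots> = ?M"
    by (simp add: es_S[of "\<lambda>w. f (w \<odot> _)"])
  finally have 1: "f (S (h \<odot> g)) = ?M" .
  have "?M = SW h (\<lambda>p z. SW g (\<lambda>q y. f (es (es p \<odot> q) \<odot> (S y \<odot> S z))))"
    by (simp add: es_es_mul)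
  also have "\<dots> = SW h (\<lambda>p z. SW g (\<lambda>q y. SW q (\<lambda>a b. f (S a \<odot> (es p \<odot> b) \<odot> (S y \<odot> S z)))))"
    by (simp add: es_mul_Hs[of "\<lambda>w. f (w \<odot> _)"])
  also have "\<dots> = SW h (\<lambda>p z. SW g (\<lambda>a d. SW d (\<lambda>b y. f (S a \<odot> es p \<odot> (b \<odot> S y) \<odot> S z))))"
    by (simp add: legs mul_assoc)
  also have "\<dots> = SW h (\<lambda>p z. SW g (\<lambda>a d. f (S a \<odot> es p \<odot> et d \<odot> S z)))"
    by (simp add: et_S[of "\<lambda>w. f (_ \<odot> w \<odot> _)"])
  \<comment> \<open>Commuting \<open>et\<close> past \<open>es\<close> separates the two variables,
    leaving S(g_1) et(g_2) = S(g) and es(h_1) S(h_2) = S(h).\<close>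
  also have "\<dots> = SW h (\<lambda>p z. SW g (\<lambda>a d. f ((S a \<odot> et d) \<odot> (es p \<odot> S z))))"
    by (simp add: mul_assoc) (simp add: mul_assoc[symmetric] et_es_commute)
  also have "\<dots> = SW h (\<lambda>p z. f (S g \<odot> (es p \<odot> S z)))"
    by (simp add: S_et[of "\<lambda>w. f (w \<odot> _)"])
  also have "\<dots> = f (S g \<odot> S h)"
    by (simp add: S_es[of "\<lambda>w. f (_ \<odot> w)"])
  finally show "f (S (h \<odot> g)) = f (S g \<odot> S h)" using 1 by simp
qed

text \<open>For x in H_t, es(x) = S(x_1) x_2 = S(1_1 x) 1_2 = S(x) S(1_1) 1_2, and the last two
  factors give es(1) = 1.\<close>

lemma S_Ht: "Ht x \<Longrightarrow> S x = es x"
proof (rule separation)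
  fix f assume x: "Ht x" and f: "L f"
  have [simp]: "VL u \<Longrightarrow> L (\<lambda>x. f (u x))" for u by (rule lin_vlin[OF f])
  have "f (es x) = SW x (\<lambda>a b. f (S a \<odot> b))"
    by (simp add: es_S f)
  also have "\<dots> = SW one (\<lambda>a b. f (S x \<odot> (S a \<odot> b)))"
    by (subst Ht_right[OF x]) (simp_all add: S_mul mul_assoc)
  also have "\<dots> = f (S x)"
    by (subst es_S[of "\<lambda>w. f (_ \<odot> w)"]) simp_all
  finally show "f (S x) = f (es x)" ..
qed

lemma S_Hs: "Hs x \<Longrightarrow> S x = et x"
  using wantipode.S_Ht[OF wantipode_opcop[OF wantipode_axioms], of x]
    wbialg.es_eq_et[OF wbialg_opcop[OF wbialg_axioms]] by simp

text \<open>On the legs of Delta(1) the antipode acts as \<open>es\<close> and \<open>et\<close>.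
  Expanding both maps, the weak multiplicativity of the counit fuses the three copies of Delta(1)
  into two, and \<open>SW_et\<close> removes one more.\<close>

lemma SW_one_S:
  assumes F: "\<And>b. L (\<lambda>a. F a b)" "\<And>a. L (\<lambda>b. F a b)"
  shows "SW one (\<lambda>a b. F (S b) (S a)) = SW one F"
proof -
  have [simp]: "VL g \<Longrightarrow> L (\<lambda>x. F (g x) b)" "VL g \<Longrightarrow> L (\<lambda>x. F b (g x))" for g b
    using F by (auto intro: lin_vlin[of sc "\<lambda>x. F x b"] lin_vlin[of sc "F b"])
  have "SW one (\<lambda>a b. F (S b) (S a)) = SW one (\<lambda>a b. F (S (et b)) (S (es a)))"
    by (rule SW_one_es_et[symmetric]) simp_all
  also have "\<dots> = SW one (\<lambda>a b. F (es (et b)) (et (es a)))"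
    by (simp add: S_Ht[OF Ht_et] S_Hs[OF Hs_es])
  also have "\<dots> = SW one (\<lambda>a b. F (es b) (et a))"
    by (rule SW_one_es_et) simp_all
  also have "\<dots> = SW one (\<lambda>a b. SW one (\<lambda>p q. SW one (\<lambda>c d. (\<epsilon> (p \<odot> a) * \<epsilon> (b \<odot> d)) * F c q)))"
    by (simp add: es[of "\<lambda>z. F z _"] et[of "F _"] F SW_scale mult.assoc)
  also have "\<dots> = SW one (\<lambda>p q. SW one (\<lambda>a b. SW one (\<lambda>c d. (\<epsilon> (p \<odot> a) * \<epsilon> (b \<odot> d)) * F c q)))"
    by (rule SW_swap)
  also have "\<dots> = SW one (\<lambda>p q. SW one (\<lambda>c d. SW one (\<lambda>a b. (\<epsilon> (p \<odot> a) * \<epsilon> (b \<odot> d)) * F c q)))"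
    by (intro SW_cong SW_swap)
  also have "\<dots> = SW one (\<lambda>p q. SW one (\<lambda>c d. \<epsilon> (p \<odot> d) * F c q))"
    by (simp add: SW_scale_right eps_mul)
  also have "\<dots> = SW one (\<lambda>c d. F c (et d))"
    by (subst SW_swap) (simp add: et[of "F _"] F)
  also have "\<dots> = SW one F"
    using F by (subst SW_et) simp_all
  finally show ?thesis .
qed

text \<open>This would be Delta(h_1) Delta(S(h_2)) with the coproduct of the antipode inserted, but
  that formula is what the present one serves to prove, so the derivation stays within H_t.\<close>

lemma SW_et_S:
  assumes F: "\<And>b. L (\<lambda>a. F a b)" "\<And>a. L (\<lambda>b. F a b)"
  shows "SW (et h) F = SW4 h (\<lambda>a b c d. F (a \<odot> S d) (b \<odot> S c))"
proof -
  have [simp]: "VL g \<Longrightarrow> L (\<lambda>x. F (g x) b)" "VL g \<Longrightarrow> L (\<lambda>x. F b (g x))" for g b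
    using F by (auto intro: lin_vlin[of sc "\<lambda>x. F x b"] lin_vlin[of sc "F b"])
  have "SW4 h (\<lambda>a b c d. F (a \<odot> S d) (b \<odot> S c)) = SW3 h (\<lambda>a p d. SW p (\<lambda>b c. F (a \<odot> S d) (b \<odot> S c)))"
    by (simp add: legs)
  also have "\<dots> = SW3 h (\<lambda>a p d. F (a \<odot> S d) (et p))"
    by (simp add: et_S[of "F _"] F)
  also have "\<dots> = SW h (\<lambda>q d. SW q (\<lambda>a p. F (a \<odot> S d) (et p)))"
    by (simp add: legs)
  also have "\<dots> = SW h (\<lambda>q d. SW one (\<lambda>x y. F ((x \<odot> q) \<odot> S d) y))"
    by (intro SW_cong SW_et) simp_all
  also have "\<dots> = SW one (\<lambda>x y. SW h (\<lambda>q d. F (x \<odot> (q \<odot> S d)) y))"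
    by (subst SW_swap) (simp add: mul_assoc)
  also have "\<dots> = SW one (\<lambda>x y. F (x \<odot> et h) y)"
    by (simp add: et_S[of "\<lambda>z. F (_ \<odot> z) _"])
  also have "\<dots> = SW (et h) F"
    by (rule Ht_right[OF Ht_et, symmetric]) simp_all
  finally show ?thesis ..
qed

lemma SW_es_S:
  assumes F: "\<And>b. L (\<lambda>a. F a b)" "\<And>a. L (\<lambda>b. F a b)"
  shows "SW (es h) F = SW4 h (\<lambda>a b c d. F (S b \<odot> c) (S a \<odot> d))"
proof -
  interpret o: sweedler sc "\<lambda>x y. mul y x" one "\<lambda>h F. SW h (\<lambda>a b. F b a)"
    by (rule sweedler_op[OF sweedler_cop[OF sweedler_axioms]])
  have [simp]: "VL g \<Longrightarrow> L (\<lambda>x. F (g x) b)" "VL g \<Longrightarrow> L (\<lambda>x. F b (g x))" for g b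
    using F by (auto intro: lin_vlin[of sc "\<lambda>x. F x b"] lin_vlin[of sc "F b"])
  have "SW (es h) F = o.SW4 h (\<lambda>a b c d. F (S c \<odot> b) (S d \<odot> a))"
    using wantipode.SW_et_S[OF wantipode_opcop[OF wantipode_axioms], of "\<lambda>a b. F b a" h] F
    by (simp add: es_eq_et)
  also have "\<dots> = SW4 h (\<lambda>a b c d. F (S b \<odot> c) (S a \<odot> d))"
    unfolding o.SWn_defs by (simp add: legs)
  finally show ?thesis .
qed

text \<open>Start from S(h) = S(h_1) et(h_2), where Delta of the last factor is known from
  \<open>SW_et_S\<close>. Regrouping turns Delta(S(h_1)) Delta(h_2) into Delta(es(h_1)), known from
  \<open>SW_es_S\<close>, and the rest collapses up to a factor Delta(1).\<close>

lemma SW_S: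
  assumes F: "\<And>b. L (\<lambda>a. F a b)" "\<And>a. L (\<lambda>b. F a b)"
  shows "SW (S h) F = SW h (\<lambda>a b. F (S b) (S a))"
proof -
  have [simp]: "VL g \<Longrightarrow> L (\<lambda>x. F (g x) b)" "VL g \<Longrightarrow> L (\<lambda>x. F b (g x))" for g b
    using F by (auto intro: lin_vlin[of sc "\<lambda>x. F x b"] lin_vlin[of sc "F b"])
  have "SW (S h) F = SW h (\<lambda>a b. SW (S a \<odot> et b) F)"
    by (subst S_et[of "\<lambda>z. SW z F"]) simp_all
  also have "\<dots> = SW h (\<lambda>a b. SW (S a) (\<lambda>x y. SW4 b (\<lambda>p q r s. F (x \<odot> (p \<odot> S s)) (y \<odot> (q \<odot> S r)))))"
    by (simp add: SW_mul SW_et_S)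
  also have "\<dots> = SW h (\<lambda>a b. SW4 b (\<lambda>p q r s. SW (S a) (\<lambda>x y. F (x \<odot> (p \<odot> S s)) (y \<odot> (q \<odot> S r)))))"
    by (simp add: SW4_SW_swap)
  also have "\<dots> = SW5 h (\<lambda>a p q r s. SW (S a) (\<lambda>x y. F (x \<odot> (p \<odot> S s)) (y \<odot> (q \<odot> S r))))"
    by (simp add: SW5_def)
  also have "\<dots> = SW4 h (\<lambda>a m r s. SW m (\<lambda>p q. SW (S a) (\<lambda>x y. F (x \<odot> (p \<odot> S s)) (y \<odot> (q \<odot> S r)))))"
    by (simp add: legs)
  also have "\<dots> = SW4 h (\<lambda>a m r s. SW (S a \<odot> m) (\<lambda>x y. F (x \<odot> S s) (y \<odot> S r)))"
    by (subst SW_swap) (simp add: SW_mul mul_assoc)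
  also have "\<dots> = SW3 h (\<lambda>n r s. SW n (\<lambda>a m. SW (S a \<odot> m) (\<lambda>x y. F (x \<odot> S s) (y \<odot> S r))))"
    by (simp add: legs)
  also have "\<dots> = SW3 h (\<lambda>n r s. SW (es n) (\<lambda>x y. F (x \<odot> S s) (y \<odot> S r)))"
    by (subst es_S[of "\<lambda>z. SW z _"]) simp_all
  also have "\<dots> = SW3 h (\<lambda>n r s. SW4 n (\<lambda>a b c d. F ((S b \<odot> c) \<odot> S s) ((S a \<odot> d) \<odot> S r)))"
    by (simp add: SW_es_S)
  also have "\<dots> = SW6 h (\<lambda>a b c d r s. F ((S b \<odot> c) \<odot> S s) (S a \<odot> (d \<odot> S r)))"
    by (simp add: SW3_leg1_SW4 mul_assoc)
  also have "\<dots> = SW5 h (\<lambda>a b c e s. SW e (\<lambda>d r. F ((S b \<odot> c) \<odot> S s) (S a \<odot> (d \<odot> S r))))"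
    by (simp add: legs)
  also have "\<dots> = SW5 h (\<lambda>a b c e s. F ((S b \<odot> c) \<odot> S s) (S a \<odot> et e))"
    by (simp add: et_S[of "\<lambda>z. F _ (_ \<odot> z)"])
  also have "\<dots> = SW4 h (\<lambda>a b g s. SW g (\<lambda>c e. F ((S b \<odot> c) \<odot> S s) (S a \<odot> et e)))"
    by (simp add: legs)
  also have "\<dots> = SW4 h (\<lambda>a b g s. SW one (\<lambda>x y. F ((S b \<odot> (x \<odot> g)) \<odot> S s) (S a \<odot> y)))"
    by (simp add: SW_et[of "\<lambda>c e. F ((S _ \<odot> c) \<odot> S _) (S _ \<odot> e)"])
  also have "\<dots> = SW3 h (\<lambda>a b k. SW k (\<lambda>g s. SW one (\<lambda>x y. F ((S b \<odot> x) \<odot> (g \<odot> S s)) (S a \<odot> y))))"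
    by (simp add: legs mul_assoc)
  also have "\<dots> = SW3 h (\<lambda>a b k. SW one (\<lambda>x y. F ((S b \<odot> x) \<odot> et k) (S a \<odot> y)))"
    by (simp add: et_S[of "\<lambda>z. SW one (\<lambda>x y. F ((S _ \<odot> x) \<odot> z) (S _ \<odot> y))"])
  \<comment> \<open>Projecting the legs of Delta(1) to H_s and H_t makes the left one commute with
    \<open>et k\<close>.\<close>
  also have "\<dots> = SW3 h (\<lambda>a b k. SW one (\<lambda>x y. F ((S b \<odot> es x) \<odot> et k) (S a \<odot> et y)))"
    by (simp add: SW_one_es_et[of "\<lambda>x y. F ((S _ \<odot> x) \<odot> et _) (S _ \<odot> y)"])
  also have "\<dots> = SW3 h (\<lambda>a b k. SW one (\<lambda>x y. F ((S b \<odot> et k) \<odot> es x) (S a \<odot> et y)))"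
    by (simp add: mul_assoc et_es_commute)
  also have "\<dots> = SW3 h (\<lambda>a b k. SW one (\<lambda>x y. F ((S b \<odot> et k) \<odot> x) (S a \<odot> y)))"
    by (simp add: SW_one_es_et[of "\<lambda>x y. F ((S _ \<odot> et _) \<odot> x) (S _ \<odot> y)"])
  also have "\<dots> = SW h (\<lambda>a l. SW one (\<lambda>x y. F (S l \<odot> x) (S a \<odot> y)))"
    by (simp add: SW3_def S_et[of "\<lambda>z. SW one (\<lambda>x y. F (z \<odot> x) (S _ \<odot> y))"])
  \<comment> \<open>Rewriting Delta(1) through S moves it inside the antipodes, as a left factor of
    Delta(h), where it is absorbed.\<close>
  also have "\<dots> = SW h (\<lambda>a l. SW one (\<lambda>x y. F (S l \<odot> S y) (S a \<odot> S x)))"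
    by (simp add: SW_one_S[of "\<lambda>x y. F (S _ \<odot> x) (S _ \<odot> y)"])
  also have "\<dots> = SW one (\<lambda>x y. SW h (\<lambda>a l. F (S (y \<odot> l)) (S (x \<odot> a))))"
    by (subst SW_swap) (simp add: S_mul)
  also have "\<dots> = SW h (\<lambda>a l. F (S l) (S a))"
    by (rule SW_one_left) simp_all
  finally show ?thesis .
qed

lemma SW_mul_S:
  assumes F: "\<And>b. L (\<lambda>a. F a b)" "\<And>a. L (\<lambda>b. F a b)"
  shows "SW h (\<lambda>a r. SW r (\<lambda>b c. F a (b \<odot> S c))) = SW one (\<lambda>a b. F (a \<odot> h) b)"
  using F by (simp add: et_S[of "F _"] SW_et)

text \<open>The source map has a second form \<epsilon>(h 1_1) S(1_2), which is the local fact
  \<open>es'\<close>; it makes \<open>SW_eps_right\<close> applicable.\<close>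

lemma SW_mul_S_inner:
  assumes F: "\<And>b. L (\<lambda>a. F a b)" "\<And>a. L (\<lambda>b. F a b)"
  shows "SW h (\<lambda>a r. SW r (\<lambda>b c. F a (S b \<odot> c))) = SW one (\<lambda>a b. F (h \<odot> a) (S b))"
proof -
  have [simp]: "VL g \<Longrightarrow> L (\<lambda>x. F (g x) b)" "VL g \<Longrightarrow> L (\<lambda>x. F b (g x))" for g b
    using F by (auto intro: lin_vlin[of sc "\<lambda>x. F x b"] lin_vlin[of sc "F b"])
  have es': "SW one (\<lambda>a b. \<epsilon> (h \<odot> a) * f (S b)) = f (es h)" if f: "L f" for f h
  proof -
    have [simp]: "VL u \<Longrightarrow> L (\<lambda>x. f (u x))" for u by (rule lin_vlin[OF f])
    have "SW one (\<lambda>a b. \<epsilon> (h \<odot> a) * f (S b)) = SW one (\<lambda>a b. \<epsilon> (h \<odot> a) * f (S (et b)))"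
      by (subst SW_et[of "\<lambda>a b. \<epsilon> (h \<odot> a) * f (S b)"]) simp_all
    also have "\<dots> = SW one (\<lambda>a b. \<epsilon> (h \<odot> a) * f (es (et b)))"
      by (simp add: S_Ht[OF Ht_et])
    also have "\<dots> = SW one (\<lambda>a b. \<epsilon> (h \<odot> a) * f (es b))"
      by (subst SW_et[of "\<lambda>a b. \<epsilon> (h \<odot> a) * f (es b)"]) simp_all
    also have "\<dots> = SW one (\<lambda>a b. SW one (\<lambda>c d. (\<epsilon> (h \<odot> a) * \<epsilon> (b \<odot> d)) * f c))"
      by (simp add: es[OF f] SW_scale mult.assoc)
    also have "\<dots> = SW one (\<lambda>c d. SW one (\<lambda>a b. (\<epsilon> (h \<odot> a) * \<epsilon> (b \<odot> d)) * f c))"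
      by (rule SW_swap)
    also have "\<dots> = f (es h)"
      by (simp add: SW_scale_right eps_mul es[OF f])
    finally show ?thesis .
  qed
  have "SW h (\<lambda>a r. SW r (\<lambda>b c. F a (S b \<odot> c))) = SW h (\<lambda>a b. SW one (\<lambda>c d. \<epsilon> (b \<odot> c) * F a (S d)))"
    using F by (simp add: es_S[of "F _"] es'[of "F _"])
  also have "\<dots> = SW one (\<lambda>a b. F (h \<odot> a) (S b))"
    by (rule SW_eps_right) simp_all
  finally show ?thesis .
qed

lemma SW_S_mul:
  assumes F: "\<And>b. L (\<lambda>a. F a b)" "\<And>a. L (\<lambda>b. F a b)"
  shows "SW h (\<lambda>p c. SW p (\<lambda>a b. F (S a \<odot> b) c)) = SW one (\<lambda>a b. F a (h \<odot> b))"
  using wantipode.SW_mul_S[OF wantipode_opcop[OF wantipode_axioms], of "\<lambda>a b. F b a" h] F by simp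

lemma SW_S_mul_inner:
  assumes F: "\<And>b. L (\<lambda>a. F a b)" "\<And>a. L (\<lambda>b. F a b)"
  shows "SW h (\<lambda>p c. SW p (\<lambda>a b. F (a \<odot> S b) c)) = SW one (\<lambda>a b. F (S a) (b \<odot> h))"
  using wantipode.SW_mul_S_inner[OF wantipode_opcop[OF wantipode_axioms], of "\<lambda>a b. F b a" h] F by simp

end

section \<open>Weak Hopf algebras with invertible antipode\<close>

text \<open>A list of consequences of the axioms which no longer mentions the counit and which is stable
  under passing to $H^{op,cop}$ (antipode \<open>S\<close>) and to $H^{cop}$ (antipode \<open>T\<close>, the inverse of \<open>S\<close>).\<close>

locale phopf = sweedler sc mul one SW
  for sc :: "'k::field \<Rightarrow> 'h::ab_group_add \<Rightarrow> 'h"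
    and mul :: "'h \<Rightarrow> 'h \<Rightarrow> 'h" (infixl "\<odot>" 70) and one :: 'h
    and SW :: "'h \<Rightarrow> ('h \<Rightarrow> 'h \<Rightarrow> 'k) \<Rightarrow> 'k" +
  fixes S T ps pt :: "'h \<Rightarrow> 'h"
  assumes S_vlin: "vlin sc S" and T_vlin: "vlin sc T" and ps_vlin: "vlin sc ps" and pt_vlin: "vlin sc pt"
    and S_T [simp]: "S (T x) = x" and T_S [simp]: "T (S x) = x"
    and S_mul: "S (x \<odot> y) = S y \<odot> S x" and S_one [simp]: "S one = one"
    and SW_S: "\<lbrakk>\<And>b. lin sc (\<lambda>a. F a b); \<And>a. lin sc (\<lambda>b. F a b)\<rbrakk>
      \<Longrightarrow> SW (S h) F = SW h (\<lambda>a b. F (S b) (S a))"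
    and SW_mul_S: "\<lbrakk>\<And>b. lin sc (\<lambda>a. F a b); \<And>a. lin sc (\<lambda>b. F a b)\<rbrakk>
      \<Longrightarrow> SW h (\<lambda>a r. SW r (\<lambda>b c. F a (b \<odot> S c))) = SW one (\<lambda>a b. F (a \<odot> h) b)"
    and SW_S_mul: "\<lbrakk>\<And>b. lin sc (\<lambda>a. F a b); \<And>a. lin sc (\<lambda>b. F a b)\<rbrakk>
      \<Longrightarrow> SW h (\<lambda>p c. SW p (\<lambda>a b. F (S a \<odot> b) c)) = SW one (\<lambda>a b. F a (h \<odot> b))"
    and SW_mul_S_inner: "\<lbrakk>\<And>b. lin sc (\<lambda>a. F a b); \<And>a. lin sc (\<lambda>b. F a b)\<rbrakk>
      \<Longrightarrow> SW h (\<lambda>a r. SW r (\<lambda>b c. F a (S b \<odot> c))) = SW one (\<lambda>a b. F (h \<odot> a) (S b))"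
    and SW_S_mul_inner: "\<lbrakk>\<And>b. lin sc (\<lambda>a. F a b); \<And>a. lin sc (\<lambda>b. F a b)\<rbrakk>
      \<Longrightarrow> SW h (\<lambda>p c. SW p (\<lambda>a b. F (a \<odot> S b) c)) = SW one (\<lambda>a b. F (S a) (b \<odot> h))"
    and SW_one_mul_S: "lin sc f \<Longrightarrow> SW one (\<lambda>a b. f (a \<odot> S b)) = f one"
    and SW_one_S_mul: "lin sc f \<Longrightarrow> SW one (\<lambda>a b. f (S a \<odot> b)) = f one"
    and Hs_ps: "Hsrc sc mul one SW (ps x)" and Ht_pt: "Htgt sc mul one SW (pt x)"
    and SW_one_ps_pt: "\<lbrakk>\<And>b. lin sc (\<lambda>a. F a b); \<And>a. lin sc (\<lambda>b. F a b)\<rbrakk>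
      \<Longrightarrow> SW one (\<lambda>a b. F (ps a) (pt b)) = SW one F"

lemma (in wantipode) phopf:
  assumes T: "\<And>x. S (T x) = x" "\<And>x. T (S x) = x"
  shows "phopf sc mul one SW S T es et"
proof
  show "VL T"
    unfolding vlin_def
  proof (intro conjI allI)
    fix x y c
    have "S (T x + T y) = x + y" "S (sc c (T x)) = sc c x"
      using S_vlin by (simp_all add: vlin_def T)
    then show "T (x + y) = T x + T y" "T (sc c x) = sc c (T x)"
      using T by metis+
  qed
  show "lin sc f \<Longrightarrow> SW one (\<lambda>a b. f (a \<odot> S b)) = f one" for f
    by (simp add: et_S)
  show "lin sc f \<Longrightarrow> SW one (\<lambda>a b. f (S a \<odot> b)) = f one" for f
    by (simp add: es_S)
  show "VL es" "VL et"
    using vlin_es[of "\<lambda>x. x"] vlin_et[of "\<lambda>x. x"] by simp_all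
qed (simp_all add: T S_vlin S_mul SW_S SW_mul_S SW_S_mul SW_mul_S_inner SW_S_mul_inner
    Ht_et Hs_es SW_one_es_et)

lemma phopf_opcop:
  assumes "phopf sc mul one SW S T ps pt"
  shows "phopf sc (\<lambda>x y. mul y x) one (\<lambda>h F. SW h (\<lambda>a b. F b a)) S T pt ps"
proof -
  interpret phopf sc mul one SW S T ps pt by fact
  interpret o: sweedler sc "\<lambda>x y. mul y x" one "\<lambda>h F. SW h (\<lambda>a b. F b a)"
    by (rule sweedler_op[OF sweedler_cop[OF sweedler_axioms]])
  show ?thesis
  proof
    fix F :: "'b \<Rightarrow> 'b \<Rightarrow> 'a" and h
    assume F: "\<And>b. L (\<lambda>a. F a b)" "\<And>a. L (\<lambda>b. F a b)"
    show "SW h (\<lambda>r a. SW r (\<lambda>c b. F a (mul (S c) b))) = SW one (\<lambda>b a. F (mul h a) b)"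
      using SW_S_mul[of "\<lambda>x y. F y x" h] F by simp
    show "SW h (\<lambda>c p. SW p (\<lambda>b a. F (mul b (S a)) c)) = SW one (\<lambda>b a. F a (mul b h))"
      using SW_mul_S[of "\<lambda>x y. F y x" h] F by simp
    show "SW h (\<lambda>r a. SW r (\<lambda>c b. F a (mul c (S b)))) = SW one (\<lambda>b a. F (mul a h) (S b))"
      using SW_S_mul_inner[of "\<lambda>x y. F y x" h] F by simp
    show "SW h (\<lambda>c p. SW p (\<lambda>b a. F (mul (S b) a) c)) = SW one (\<lambda>b a. F (S a) (mul h b))"
      using SW_mul_S_inner[of "\<lambda>x y. F y x" h] F by simp
    show "SW one (\<lambda>b a. F (pt a) (ps b)) = SW one (\<lambda>b a. F a b)"
      using SW_one_ps_pt[of "\<lambda>x y. F y x"] F by simp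
  qed (simp_all add: S_vlin T_vlin ps_vlin pt_vlin S_mul SW_S SW_one_mul_S SW_one_S_mul Hs_ps Ht_pt)
qed

context phopf
begin

lemma vlin_S [simp]: "VL g \<Longrightarrow> VL (\<lambda>x. S (g x))"
  by (rule vlin_comp[OF S_vlin])
lemma vlin_T [simp]: "VL g \<Longrightarrow> VL (\<lambda>x. T (g x))"
  by (rule vlin_comp[OF T_vlin])

lemma T_mul: "T (x \<odot> y) = T y \<odot> T x"
  by (metis S_T T_S S_mul)

lemma T_one [simp]: "T one = one"
  by (metis S_one T_S)

lemma SW_T:
  assumes F: "\<And>b. L (\<lambda>a. F a b)" "\<And>a. L (\<lambda>b. F a b)"
  shows "SW (T h) F = SW h (\<lambda>a b. F (T b) (T a))"
proof -
  have [simp]: "VL g \<Longrightarrow> L (\<lambda>x. F (g x) b)" "VL g \<Longrightarrow> L (\<lambda>x. F b (g x))" for g b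
    using F by (auto intro: lin_vlin[of sc "\<lambda>x. F x b"] lin_vlin[of sc "F b"])
  show ?thesis
    using SW_S[of "\<lambda>a b. F (T b) (T a)" "T h"] by simp
qed

lemma SW_via_T:
  "\<lbrakk>\<And>b. L (\<lambda>a. F a b); \<And>a. L (\<lambda>b. F a b)\<rbrakk> \<Longrightarrow> SW h F = SW (T h) (\<lambda>a b. F (S b) (S a))"
  using SW_S[of F "T h"] by simp

text \<open>As Delta(1) lies in H_s (x) H_t, expressions contracted with it need to agree only on
  H_s and H_t. This is how the special rules for these subalgebras enter later computations.\<close>

lemma SW_one_cong:
  assumes "\<And>b. L (\<lambda>a. F a b)" "\<And>a. L (\<lambda>b. F a b)" "\<And>b. L (\<lambda>a. G a b)" "\<And>a. L (\<lambda>b. G a b)"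
    and "\<And>a b. Hs a \<Longrightarrow> Ht b \<Longrightarrow> F a b = G a b"
  shows "SW one F = SW one G"
proof -
  have "SW one F = SW one (\<lambda>a b. F (ps a) (pt b))"
    by (rule SW_one_ps_pt[symmetric]) (simp_all add: assms(1,2))
  also have "\<dots> = SW one (\<lambda>a b. G (ps a) (pt b))"
    by (simp add: assms(5) Hs_ps Ht_pt)
  also have "\<dots> = SW one G"
    by (rule SW_one_ps_pt) (simp_all add: assms(3,4))
  finally show ?thesis .
qed

lemma Hs_T: assumes "Ht x" shows "Hs (T x)"
  unfolding Hsrc_def
proof (intro allI impI)
  fix F assume F: "\<forall>b. L (\<lambda>a. F a b)" "\<forall>a. L (\<lambda>b. F a b)"
  have [simp]: "VL g \<Longrightarrow> L (\<lambda>x. F (g x) b)" "VL g \<Longrightarrow> L (\<lambda>x. F b (g x))" for g b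
    using F by (auto intro: lin_vlin[of sc "\<lambda>x. F x b"] lin_vlin[of sc "F b"])
  have "SW (T x) F = SW x (\<lambda>a b. F (T b) (T a))"
    by (rule SW_T) (simp_all add: F)
  moreover have "SW x (\<lambda>a b. F (T b) (T a)) = SW (T one) (\<lambda>a b. F a (b \<odot> T x))"
    by (subst Ht_left[OF assms], simp, simp, subst SW_T) (simp_all add: T_mul)
  moreover have "SW x (\<lambda>a b. F (T b) (T a)) = SW (T one) (\<lambda>a b. F a (T x \<odot> b))"
    by (subst Ht_right[OF assms], simp, simp, subst SW_T) (simp_all add: T_mul)
  ultimately show "SW (T x) F = SW one (\<lambda>a b. F a (T x \<odot> b)) \<and> SW (T x) F = SW one (\<lambda>a b. F a (b \<odot> T x))"
    by simp
qed

lemmas opcop = phopf_opcop[OF phopf_axioms]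

lemma Ht_T: "Hs x \<Longrightarrow> Ht (T x)"
  using phopf.Hs_T[OF opcop, of x] by simp

end

text \<open>Applying T to the leg that carries the product exchanges the \<open>inner\<close>
  identities of S with the outer ones of T. This is the reason why the list of axioms contains both
  kinds.\<close>

lemma phopf_cop:
  assumes "phopf sc mul one SW S T ps pt"
  shows "phopf sc mul one (\<lambda>h F. SW h (\<lambda>a b. F b a)) T S pt ps"
proof -
  interpret phopf sc mul one SW S T ps pt by fact
  interpret c: sweedler sc mul one "\<lambda>h F. SW h (\<lambda>a b. F b a)"
    by (rule sweedler_cop[OF sweedler_axioms])
  show ?thesis
  proof
    fix F :: "'b \<Rightarrow> 'b \<Rightarrow> 'a" and h
    assume F: "\<And>b. L (\<lambda>a. F a b)" "\<And>a. L (\<lambda>b. F a b)"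
    have [simp]: "VL g \<Longrightarrow> L (\<lambda>x. F (g x) b)" "VL g \<Longrightarrow> L (\<lambda>x. F b (g x))" for g b
      using F by (auto intro: lin_vlin[of sc "\<lambda>x. F x b"] lin_vlin[of sc "F b"])
    show "SW h (\<lambda>r a. SW r (\<lambda>c b. F a (mul b (T c)))) = SW one (\<lambda>b a. F (mul a h) b)"
      using SW_S_mul_inner[of "\<lambda>x y. F y (T x)" h] by (simp add: T_mul)
    show "SW h (\<lambda>c p. SW p (\<lambda>b a. F (mul (T a) b) c)) = SW one (\<lambda>b a. F a (mul h b))"
      using SW_mul_S_inner[of "\<lambda>x y. F (T y) x" h] by (simp add: T_mul)
    show "SW h (\<lambda>r a. SW r (\<lambda>c b. F a (mul (T b) c))) = SW one (\<lambda>b a. F (mul h a) (T b))"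
      using SW_S_mul[of "\<lambda>x y. F y (T x)" h] by (simp add: T_mul)
    show "SW h (\<lambda>c p. SW p (\<lambda>b a. F (mul a (T b)) c)) = SW one (\<lambda>b a. F (T a) (mul b h))"
      using SW_mul_S[of "\<lambda>x y. F (T y) x" h] by (simp add: T_mul)
    show "SW one (\<lambda>b a. F (pt a) (ps b)) = SW one (\<lambda>b a. F a b)"
      using SW_one_ps_pt[of "\<lambda>x y. F y x"] F by simp
  next
    fix f assume f: "L f"
    have [simp]: "VL u \<Longrightarrow> L (\<lambda>x. f (u x))" for u by (rule lin_vlin[OF f])
    show "SW one (\<lambda>b a. f (mul a (T b))) = f one"
      using SW_one_mul_S[of "\<lambda>z. f (T z)"] by (simp add: T_mul)
    show "SW one (\<lambda>b a. f (mul (T a) b)) = f one"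
      using SW_one_S_mul[of "\<lambda>z. f (T z)"] by (simp add: T_mul)
  qed (simp_all add: S_vlin T_vlin ps_vlin pt_vlin T_mul SW_T Hs_ps Ht_pt)
qed

context phopf
begin

lemmas cop = phopf_cop[OF phopf_axioms]

lemma Ht_S: "Hs x \<Longrightarrow> Ht (S x)"
  using phopf.Hs_T[OF cop, of x] by simp

end

lemma (in phopf) Hs_S: "Ht x \<Longrightarrow> Hs (S x)"
  using phopf.Ht_S[OF opcop, of x] by simp

section \<open>Functionals on the partial algebra\<close>

text \<open>The linear functionals on the free algebra that vanish on the defining ideal of $H^w_{par}$,
  given by their values on words.\<close>

definition pst :: "('k::field \<Rightarrow> 'h::ab_group_add \<Rightarrow> 'h) \<Rightarrow> ('h \<Rightarrow> 'h \<Rightarrow> 'h) \<Rightarrow> 'h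
    \<Rightarrow> ('h \<Rightarrow> ('h \<Rightarrow> 'h \<Rightarrow> 'k) \<Rightarrow> 'k) \<Rightarrow> ('h \<Rightarrow> 'h) \<Rightarrow> ('h list \<Rightarrow> 'k) \<Rightarrow> bool" where
  "pst sc mul one SW S \<phi> \<longleftrightarrow> pml sc \<phi>
   \<and> (\<forall>u v. \<phi> (u @ one # v) = \<phi> (u @ v))
   \<and> (\<forall>u v h k. SW k (\<lambda>a b. \<phi> (u @ h # a # S b # v)) = SW k (\<lambda>a b. \<phi> (u @ mul h a # S b # v)))
   \<and> (\<forall>u v h k. SW k (\<lambda>a b. \<phi> (u @ h # S a # b # v)) = SW k (\<lambda>a b. \<phi> (u @ mul h (S a) # b # v)))
   \<and> (\<forall>u v h k. SW h (\<lambda>a b. \<phi> (u @ a # S b # k # v)) = SW h (\<lambda>a b. \<phi> (u @ a # mul (S b) k # v)))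
   \<and> (\<forall>u v h k. SW h (\<lambda>a b. \<phi> (u @ S a # b # k # v)) = SW h (\<lambda>a b. \<phi> (u @ S a # mul b k # v)))
   \<and> (\<forall>u v h. \<phi> (u @ h # v) = SW h (\<lambda>a r. SW r (\<lambda>b c. \<phi> (u @ a # S b # c # v))))"

lemma pstI:
  assumes "pml sc \<phi>" "\<And>u v. \<phi> (u @ one # v) = \<phi> (u @ v)"
    "\<And>u v h k. SW k (\<lambda>a b. \<phi> (u @ h # a # S b # v)) = SW k (\<lambda>a b. \<phi> (u @ mul h a # S b # v))"
    "\<And>u v h k. SW k (\<lambda>a b. \<phi> (u @ h # S a # b # v)) = SW k (\<lambda>a b. \<phi> (u @ mul h (S a) # b # v))"
    "\<And>u v h k. SW h (\<lambda>a b. \<phi> (u @ a # S b # k # v)) = SW h (\<lambda>a b. \<phi> (u @ a # mul (S b) k # v))"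
    "\<And>u v h k. SW h (\<lambda>a b. \<phi> (u @ S a # b # k # v)) = SW h (\<lambda>a b. \<phi> (u @ S a # mul b k # v))"
    "\<And>u v h. \<phi> (u @ h # v) = SW h (\<lambda>a r. SW r (\<lambda>b c. \<phi> (u @ a # S b # c # v)))"
  shows "pst sc mul one SW S \<phi>"
  unfolding pst_def by (intro conjI allI assms)

lemma pst_pml: "pst sc mul one SW S \<phi> \<Longrightarrow> pml sc \<phi>"
  by (simp add: pst_def)

lemma pst_one: "pst sc mul one SW S \<phi> \<Longrightarrow> \<phi> (u @ one # v) = \<phi> (u @ v)"
  by (rule pst_def[THEN iffD1, THEN conjunct2, THEN conjunct1, rule_format])

lemma pst_mul_S:
  "pst sc mul one SW S \<phi> \<Longrightarrow>
    SW k (\<lambda>a b. \<phi> (u @ h # a # S b # v)) = SW k (\<lambda>a b. \<phi> (u @ mul h a # S b # v))"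
  by (rule pst_def[THEN iffD1, THEN conjunct2, THEN conjunct2, THEN conjunct1, rule_format])

lemma pst_mul_S':
  "pst sc mul one SW S \<phi> \<Longrightarrow>
    SW k (\<lambda>a b. \<phi> (u @ h # S a # b # v)) = SW k (\<lambda>a b. \<phi> (u @ mul h (S a) # b # v))"
  by (rule pst_def[THEN iffD1, THEN conjunct2, THEN conjunct2, THEN conjunct2, THEN conjunct1, rule_format])

lemma pst_S_mul:
  "pst sc mul one SW S \<phi> \<Longrightarrow>
    SW h (\<lambda>a b. \<phi> (u @ a # S b # k # v)) = SW h (\<lambda>a b. \<phi> (u @ a # mul (S b) k # v))"
  by (rule pst_def[THEN iffD1, THEN conjunct2, THEN conjunct2, THEN conjunct2, THEN conjunct2, THEN conjunct1, rule_format])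

lemma pst_S_mul':
  "pst sc mul one SW S \<phi> \<Longrightarrow>
    SW h (\<lambda>a b. \<phi> (u @ S a # b # k # v)) = SW h (\<lambda>a b. \<phi> (u @ S a # mul b k # v))"
  by (rule pst_def[THEN iffD1, THEN conjunct2, THEN conjunct2, THEN conjunct2, THEN conjunct2, THEN conjunct2, THEN conjunct1, rule_format])

lemma pst_triple:
  "pst sc mul one SW S \<phi> \<Longrightarrow> \<phi> (u @ h # v) = SW h (\<lambda>a r. SW r (\<lambda>b c. \<phi> (u @ a # S b # c # v)))"
  by (rule pst_def[THEN iffD1, THEN conjunct2, THEN conjunct2, THEN conjunct2, THEN conjunct2, THEN conjunct2, THEN conjunct2, rule_format])

lemma pst_shift:
  assumes "pst sc mul one SW S \<phi>"
  shows "pst sc mul one SW S (\<lambda>w. \<phi> (p @ w @ q))"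
proof (rule pstI, goal_cases)
  case 1
  show ?case by (rule pml_comp[OF pst_pml[OF assms]]) simp
next
  case (2 u v)
  show ?case using pst_one[OF assms, of "p @ u" "v @ q"] by simp
next
  case (3 u v h k)
  show ?case using pst_mul_S[OF assms, of k "p @ u" h "v @ q"] by simp
next
  case (4 u v h k)
  show ?case using pst_mul_S'[OF assms, of k "p @ u" h "v @ q"] by simp
next
  case (5 u v h k)
  show ?case using pst_S_mul[OF assms, of h "p @ u" k "v @ q"] by simp
next
  case (6 u v h k)
  show ?case using pst_S_mul'[OF assms, of h "p @ u" k "v @ q"] by simp
next
  case (7 u v h)
  show ?case using pst_triple[OF assms, of "p @ u" h "v @ q"] by simp
qed

lemma pst_Cons: "pst sc mul one SW S \<phi> \<Longrightarrow> pst sc mul one SW S (\<lambda>w. \<phi> (x # w))"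
  using pst_shift[of sc mul one SW S \<phi> "[x]" "[]"] by simp

lemma pst_append_left: "pst sc mul one SW S \<phi> \<Longrightarrow> pst sc mul one SW S (\<lambda>w. \<phi> (u @ w))"
  using pst_shift[of sc mul one SW S \<phi> u "[]"] by simp

lemma pst_append_right: "pst sc mul one SW S \<phi> \<Longrightarrow> pst sc mul one SW S (\<lambda>w. \<phi> (w @ v))"
  using pst_shift[of sc mul one SW S \<phi> "[]" v] by simp

context sweedler
begin

lemma pst_finop:
  assumes \<Theta>: "finop \<Theta>" and K: "\<And>y. pst sc mul one SW S (\<lambda>w. K w y)"
  shows "pst sc mul one SW S (\<lambda>w. \<Theta> (\<lambda>y. K w y))"
proof (rule pstI, goal_cases)
  case 1
  show ?case by (rule pml_finop[OF \<Theta> pst_pml[OF K]])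
next
  case 2
  show ?case by (simp only: pst_one[OF K])
next
  case (7 u v h)
  show ?case unfolding SW_finop_swap[OF \<Theta>] by (simp only: pst_triple[OF K, of u h v])
qed (simp_all only: SW_finop_swap[OF \<Theta>] pst_mul_S[OF K] pst_mul_S'[OF K] pst_S_mul[OF K] pst_S_mul'[OF K])

lemma pst_SW: "(\<And>a b. pst sc mul one SW S (\<lambda>w. K w a b)) \<Longrightarrow> pst sc mul one SW S (\<lambda>w. SW h (\<lambda>a b. K w a b))"
  using pst_finop[OF SW_fin, of S "\<lambda>w (a, b). K w a b"] by auto

end

section \<open>Consequences of the relations: letters from H_s and H_t, and the elements E_h\<close>

context phopf
begin

abbreviation PS where "PS \<equiv> pst sc mul one SW S"

text \<open>Reversing words is an anti-isomorphism onto the partial algebra of H^{op,cop}: relations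
  with the extra letter on the left and on the right change places.\<close>

lemma pst_rev:
  assumes "PS \<phi>"
  shows "pst sc (\<lambda>x y. mul y x) one (\<lambda>h F. SW h (\<lambda>a b. F b a)) S (\<lambda>w. \<phi> (rev w))"
proof (rule pstI, goal_cases)
  case 1
  show ?case by (rule pml_comp[OF pst_pml[OF assms]]) simp
next
  case (2 u v)
  show ?case using pst_one[OF assms, of "rev v" "rev u"] by simp
next
  case (3 u v h k)
  show ?case using pst_S_mul'[OF assms, of k "rev v" h "rev u"] by simp
next
  case (4 u v h k)
  show ?case using pst_S_mul[OF assms, of k "rev v" h "rev u"] by simp
next
  case (5 u v h k)
  show ?case using pst_mul_S'[OF assms, of h "rev v" k "rev u"] by simp
next
  case (6 u v h k)
  show ?case using pst_mul_S[OF assms, of h "rev v" k "rev u"] by simp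
next
  case (7 u v h)
  note [simp] = pml_lin[OF pst_pml[OF assms]]
  show ?case using pst_triple[OF assms, of "rev v" h "rev u"] by (simp add: legs)
qed

text \<open>The triple relation at 1 gives 1 = [1_1][S(1_2)][1_3] = [1_1][S(1_2) 1_3], and the
  identity for h_1 (x) S(h_2) h_3 at h = 1 shortens this to E_1.\<close>

lemma E_one:
  assumes \<phi>: "PS \<phi>"
  shows "SW one (\<lambda>a b. \<phi> (u @ a # S b # v)) = \<phi> (u @ v)"
proof -
  note [simp] = pml_lin[OF pst_pml[OF \<phi>]]
  have "\<phi> (u @ v) = SW one (\<lambda>a r. SW r (\<lambda>b c. \<phi> (u @ a # S b # c # v)))"
    using pst_one[OF \<phi>, of u v] pst_triple[OF \<phi>, of u one v] by simp
  also have "\<dots> = SW one (\<lambda>p c. SW p (\<lambda>a b. \<phi> (u @ a # S b # c # v)))"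
    by (simp add: legs)
  also have "\<dots> = SW one (\<lambda>p c. SW p (\<lambda>a b. \<phi> (u @ a # (S b \<odot> c) # v)))"
    by (simp add: pst_S_mul[OF \<phi>])
  also have "\<dots> = SW one (\<lambda>a r. SW r (\<lambda>b c. \<phi> (u @ a # (S b \<odot> c) # v)))"
    by (simp add: legs)
  also have "\<dots> = SW one (\<lambda>a b. \<phi> (u @ a # S b # v))"
    by (subst SW_mul_S_inner[of "\<lambda>x y. \<phi> (u @ x # y # v)"]) simp_all
  finally show ?thesis ..
qed

text \<open>E_x = [x 1_1][S(1_2)] = [x] E_1 for x in H_t. A letter from H_t can therefore be
  replaced by an E, to which the multiplication relations apply.\<close>

lemma E_Ht:
  assumes \<phi>: "PS \<phi>" and x: "Ht x"
  shows "SW x (\<lambda>a b. \<phi> (u @ a # S b # v)) = \<phi> (u @ x # v)"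
proof -
  note [simp] = pml_lin[OF pst_pml[OF \<phi>]]
  have "SW x (\<lambda>a b. \<phi> (u @ a # S b # v)) = SW one (\<lambda>a b. \<phi> (u @ (x \<odot> a) # S b # v))"
    by (rule Ht_left[OF x]) simp_all
  also have "\<dots> = SW one (\<lambda>a b. \<phi> (u @ x # a # S b # v))"
    by (simp add: pst_mul_S[OF \<phi>])
  also have "\<dots> = \<phi> (u @ x # v)"
    using E_one[OF \<phi>, of "u @ [x]" v] by simp
  finally show ?thesis .
qed

lemma mult_Ht_right:
  assumes \<phi>: "PS \<phi>" and x: "Ht x"
  shows "\<phi> (u @ h # x # v) = \<phi> (u @ (h \<odot> x) # v)"
proof -
  note [simp] = pml_lin[OF pst_pml[OF \<phi>]]
  have "\<phi> (u @ h # x # v) = SW x (\<lambda>a b. \<phi> (u @ h # a # S b # v))"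
    using E_Ht[OF \<phi> x, of "u @ [h]" v] by simp
  also have "\<dots> = SW x (\<lambda>a b. \<phi> (u @ (h \<odot> a) # S b # v))"
    by (rule pst_mul_S[OF \<phi>])
  also have "\<dots> = SW one (\<lambda>a b. \<phi> (u @ ((h \<odot> x) \<odot> a) # S b # v))"
    by (subst Ht_left[OF x]) (simp_all add: mul_assoc)
  also have "\<dots> = SW one (\<lambda>a b. \<phi> (u @ (h \<odot> x) # a # S b # v))"
    by (simp add: pst_mul_S[OF \<phi>])
  also have "\<dots> = \<phi> (u @ (h \<odot> x) # v)"
    using E_one[OF \<phi>, of "u @ [h \<odot> x]" v] by simp
  finally show ?thesis .
qed

text \<open>Insert E_1 in front. Since S(b) x = S(T(x) b) and T(x) is in H_s, the letter x turns E_1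
  into E_{T(x)}, which may then multiply k by the defining relation; the same steps backwards reach
  x k.\<close>

lemma mult_Ht_left:
  assumes \<phi>: "PS \<phi>" and x: "Ht x"
  shows "\<phi> (u @ x # k # v) = \<phi> (u @ (x \<odot> k) # v)"
proof -
  note [simp] = pml_lin[OF pst_pml[OF \<phi>]]
  note y = Hs_T[OF x]
  have "\<phi> (u @ x # k # v) = SW one (\<lambda>a b. \<phi> (u @ a # S b # x # k # v))"
    using E_one[OF \<phi>, of u "x # k # v"] by simp
  also have "\<dots> = SW one (\<lambda>a b. \<phi> (u @ a # (S b \<odot> x) # k # v))"
    by (rule pst_S_mul[OF \<phi>])
  also have "\<dots> = SW (T x) (\<lambda>a b. \<phi> (u @ a # S b # k # v))"
    by (subst Hs_left[OF y]) (simp_all add: S_mul)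
  also have "\<dots> = SW (T x) (\<lambda>a b. \<phi> (u @ a # (S b \<odot> k) # v))"
    by (rule pst_S_mul[OF \<phi>])
  also have "\<dots> = SW one (\<lambda>a b. \<phi> (u @ a # (S b \<odot> (x \<odot> k)) # v))"
    by (subst Hs_left[OF y]) (simp_all add: S_mul mul_assoc)
  also have "\<dots> = SW one (\<lambda>a b. \<phi> (u @ a # S b # (x \<odot> k) # v))"
    by (simp add: pst_S_mul[OF \<phi>])
  also have "\<dots> = \<phi> (u @ (x \<odot> k) # v)"
    using E_one[OF \<phi>, of u "(x \<odot> k) # v"] by simp
  finally show ?thesis .
qed

lemma mult_Hs_right: "PS \<phi> \<Longrightarrow> Hs x \<Longrightarrow> \<phi> (u @ h # x # v) = \<phi> (u @ (h \<odot> x) # v)"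
  using phopf.mult_Ht_left[OF opcop pst_rev, of \<phi> x "rev v" h "rev u"] by simp

lemma mult_Hs_left: "PS \<phi> \<Longrightarrow> Hs x \<Longrightarrow> \<phi> (u @ x # k # v) = \<phi> (u @ (x \<odot> k) # v)"
  using phopf.mult_Ht_right[OF opcop pst_rev, of \<phi> x "rev v" k "rev u"] by simp

text \<open>All products collapse into E_1 [S(h)]. It is the triple relation that
  \<open>pst_cop\<close> requires for the antipode T.\<close>

lemma pst_triple_S:
  assumes \<phi>: "PS \<phi>"
  shows "\<phi> (u @ S h # v) = SW h (\<lambda>a r. SW r (\<lambda>b c. \<phi> (u @ S a # b # S c # v)))"
proof -
  note [simp] = pml_lin[OF pst_pml[OF \<phi>]]
  have "SW h (\<lambda>a r. SW r (\<lambda>b c. \<phi> (u @ S a # b # S c # v))) = SW h (\<lambda>a r. SW r (\<lambda>b c. \<phi> (u @ (S a \<odot> b) # S c # v)))"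
    by (simp add: pst_mul_S[OF \<phi>])
  also have "\<dots> = SW h (\<lambda>p c. SW p (\<lambda>a b. \<phi> (u @ (S a \<odot> b) # S c # v)))"
    by (simp add: legs)
  also have "\<dots> = SW one (\<lambda>a b. \<phi> (u @ a # (S b \<odot> S h) # v))"
    by (subst SW_S_mul[of "\<lambda>x y. \<phi> (u @ x # S y # v)"]) (simp_all add: S_mul)
  also have "\<dots> = SW one (\<lambda>a b. \<phi> (u @ a # S b # S h # v))"
    by (simp add: pst_S_mul[OF \<phi>])
  also have "\<dots> = \<phi> (u @ S h # v)"
    by (rule E_one[OF \<phi>])
  finally show ?thesis ..
qed

text \<open>Writing k = T(h), the product [h_2][T(h_1)] becomes [S(k_1)][k_2]. So H^cop with
  antipode T imposes the relations of H with the roles of E and E~ exchanged.\<close>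

lemma pst_cop:
  assumes \<phi>: "PS \<phi>"
  shows "pst sc mul one (\<lambda>h F. SW h (\<lambda>a b. F b a)) T \<phi>"
proof -
  note [simp] = pml_lin[OF pst_pml[OF \<phi>]]
  have "SW k (\<lambda>a b. \<phi> (u @ h # b # T a # v)) = SW k (\<lambda>a b. \<phi> (u @ (h \<odot> b) # T a # v))" for u h k v
    by (subst (1 2) SW_via_T) (simp_all add: pst_mul_S'[OF \<phi>])
  moreover have "SW k (\<lambda>a b. \<phi> (u @ h # T b # a # v)) = SW k (\<lambda>a b. \<phi> (u @ (h \<odot> T b) # a # v))" for u h k v
    by (subst (1 2) SW_via_T) (simp_all add: pst_mul_S[OF \<phi>])
  moreover have "SW h (\<lambda>a b. \<phi> (u @ b # T a # k # v)) = SW h (\<lambda>a b. \<phi> (u @ b # (T a \<odot> k) # v))" for u h k v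
    by (subst (1 2) SW_via_T) (simp_all add: pst_S_mul'[OF \<phi>])
  moreover have "SW h (\<lambda>a b. \<phi> (u @ T b # a # k # v)) = SW h (\<lambda>a b. \<phi> (u @ T b # (a \<odot> k) # v))" for u h k v
    by (subst (1 2) SW_via_T) (simp_all add: pst_S_mul[OF \<phi>])
  moreover have "\<phi> (u @ h # v) = SW h (\<lambda>r a. SW r (\<lambda>c b. \<phi> (u @ a # T b # c # v)))" for u h v
  proof -
    have "SW h (\<lambda>r a. SW r (\<lambda>c b. \<phi> (u @ a # T b # c # v)))
      = SW (T h) (\<lambda>a r. SW (S r) (\<lambda>c b. \<phi> (u @ S a # T b # c # v)))"
      by (subst SW_via_T) simp_all
    also have "\<dots> = SW (T h) (\<lambda>a r. SW r (\<lambda>c b. \<phi> (u @ S a # c # S b # v)))"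
      by (simp add: SW_S)
    also have "\<dots> = \<phi> (u @ h # v)"
      using pst_triple_S[OF \<phi>, of u "T h" v] by simp
    finally show ?thesis ..
  qed
  ultimately show ?thesis
    by (intro pstI pst_pml[OF \<phi>] pst_one[OF \<phi>])
qed

text \<open>On the right the factor [h_2] is absorbed into the antipode, and h_1 (x) S(h_2) h_3 = h
  1_1 (x) S(1_2) reduces both sides to [h k_1][S(k_2)].\<close>

lemma E_commute:
  assumes \<phi>: "PS \<phi>"
  shows "SW k (\<lambda>a b. \<phi> (u @ h # a # S b # v)) = SW h (\<lambda>x y. SW (x \<odot> k) (\<lambda>a b. \<phi> (u @ a # S b # y # v)))"
proof -
  note [simp] = pml_lin[OF pst_pml[OF \<phi>]]
  have "SW h (\<lambda>x y. SW (x \<odot> k) (\<lambda>a b. \<phi> (u @ a # S b # y # v)))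
      = SW h (\<lambda>x y. SW (x \<odot> k) (\<lambda>a b. \<phi> (u @ a # (S b \<odot> y) # v)))"
    by (simp add: pst_S_mul[OF \<phi>])
  also have "\<dots> = SW h (\<lambda>x y. SW x (\<lambda>p q. SW k (\<lambda>c d. \<phi> (u @ (p \<odot> c) # (S d \<odot> (S q \<odot> y)) # v))))"
    by (simp add: SW_mul S_mul mul_assoc)
  also have "\<dots> = SW h (\<lambda>p r. SW r (\<lambda>q y. SW k (\<lambda>c d. \<phi> (u @ (p \<odot> c) # (S d \<odot> (S q \<odot> y)) # v))))"
    by (simp add: legs)
  also have "\<dots> = SW one (\<lambda>p q. SW k (\<lambda>c d. \<phi> (u @ ((h \<odot> p) \<odot> c) # (S d \<odot> S q) # v)))"
    by (subst SW_mul_S_inner[of "\<lambda>x y. SW k (\<lambda>c d. \<phi> (u @ (x \<odot> c) # (S d \<odot> y) # v))"]) simp_all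
  also have "\<dots> = SW one (\<lambda>p q. SW k (\<lambda>c d. \<phi> (u @ (h \<odot> (p \<odot> c)) # S (q \<odot> d) # v)))"
    by (simp add: S_mul mul_assoc)
  also have "\<dots> = SW k (\<lambda>c d. \<phi> (u @ (h \<odot> c) # S d # v))"
    by (rule SW_one_left[of "\<lambda>x y. \<phi> (u @ (h \<odot> x) # S y # v)"]) simp_all
  also have "\<dots> = SW k (\<lambda>c d. \<phi> (u @ h # c # S d # v))"
    by (rule pst_mul_S[OF \<phi>, symmetric])
  finally show ?thesis ..
qed

lemma Et_commute:
  "PS \<phi> \<Longrightarrow> SW k (\<lambda>a b. \<phi> (u @ S a # b # h # v)) = SW h (\<lambda>x y. SW (k \<odot> y) (\<lambda>a b. \<phi> (u @ x # S a # b # v)))"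
  using phopf.E_commute[OF opcop pst_rev, of \<phi> k "rev v" h "rev u"] by simp

text \<open>Moving E~_k to the right through both letters of E_h gives [h_1][S(h_4)] E~ with index k
  h_2 S(h_3). The product h_2 S(h_3) becomes a leg of Delta(1) in H_t, which is then carried back
  into the letter with S(h_4).\<close>

lemma E_Et_commute:
  assumes \<phi>: "PS \<phi>"
  shows "SW h (\<lambda>a b. SW k (\<lambda>c d. \<phi> (u @ a # S b # S c # d # v)))
       = SW h (\<lambda>a b. SW k (\<lambda>c d. \<phi> (u @ S c # d # a # S b # v)))"
proof -
  note [simp] = pml_lin[OF pst_pml[OF \<phi>]]
  let ?M = "\<lambda>x w q. SW (k \<odot> w) (\<lambda>c d. \<phi> (u @ x # S q # S c # d # v))"
  have "SW h (\<lambda>a b. SW k (\<lambda>c d. \<phi> (u @ S c # d # a # S b # v)))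
      = SW h (\<lambda>a b. SW a (\<lambda>x y. SW (k \<odot> y) (\<lambda>c d. \<phi> (u @ x # S c # d # S b # v))))"
    by (simp add: Et_commute[OF \<phi>])
  also have "\<dots> = SW h (\<lambda>a b. SW a (\<lambda>x y. SW (S b) (\<lambda>z w. SW (k \<odot> y \<odot> w) (\<lambda>c d. \<phi> (u @ x # z # S c # d # v)))))"
    using Et_commute[OF \<phi>, of _ "u @ [_]"] by simp
  also have "\<dots> = SW h (\<lambda>a b. SW a (\<lambda>x y. SW b (\<lambda>p q. ?M x (y \<odot> S p) q)))"
    by (simp add: SW_S mul_assoc)
  also have "\<dots> = SW h (\<lambda>a b. SW b (\<lambda>p q. SW a (\<lambda>x y. ?M x (y \<odot> S p) q)))"
    by (intro SW_cong SW_swap)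
  also have "\<dots> = SW h (\<lambda>g q. SW g (\<lambda>x e. SW e (\<lambda>y p. ?M x (y \<odot> S p) q)))"
    by (simp add: legs)
  also have "\<dots> = SW h (\<lambda>g q. SW one (\<lambda>s t. ?M (s \<odot> g) t q))"
    by (subst SW_mul_S[of "\<lambda>x y. ?M x y _"]) simp_all
  \<comment> \<open>For t in H_t, S(c t) = S(t) S(c) with S(t) in H_s, where brackets multiply. So
    S(t) passes from one letter to its neighbour, giving S(q) S(t) = S(t q).\<close>
  also have "\<dots> = SW h (\<lambda>g q. SW one (\<lambda>s t. SW k (\<lambda>c d. \<phi> (u @ (s \<odot> g) # S (t \<odot> q) # S c # d # v))))"
  proof (rule SW_cong, rule SW_one_cong)
    fix g q s t assume t: "Ht t"
    have "?M (s \<odot> g) t q = SW k (\<lambda>c d. \<phi> (u @ (s \<odot> g) # S q # S (c \<odot> t) # d # v))"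
      by (subst SW_mul_Ht[OF t]) simp_all
    also have "\<dots> = SW k (\<lambda>c d. \<phi> (u @ (s \<odot> g) # S (t \<odot> q) # S c # d # v))"
      using mult_Hs_left[OF \<phi> Hs_S[OF t], of "u @ [s \<odot> g, S q]"]
        mult_Hs_right[OF \<phi> Hs_S[OF t], of "u @ [s \<odot> g]"]
      by (simp add: S_mul)
    finally show "?M (s \<odot> g) t q = SW k (\<lambda>c d. \<phi> (u @ (s \<odot> g) # S (t \<odot> q) # S c # d # v))" .
  qed simp_all
  also have "\<dots> = SW one (\<lambda>s t. SW h (\<lambda>g q. SW k (\<lambda>c d. \<phi> (u @ (s \<odot> g) # S (t \<odot> q) # S c # d # v))))"
    by (rule SW_swap)
  also have "\<dots> = SW h (\<lambda>g q. SW k (\<lambda>c d. \<phi> (u @ g # S q # S c # d # v)))"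
    by (rule SW_one_left[of "\<lambda>g q. SW k (\<lambda>c d. \<phi> (u @ g # S q # S c # d # v))"]) simp_all
  finally show ?thesis ..
qed

end

section \<open>The coproduct of words\<close>

primrec dsw :: "('h \<Rightarrow> ('h \<Rightarrow> 'h \<Rightarrow> 'k) \<Rightarrow> 'k) \<Rightarrow> 'h list \<Rightarrow> ('h list \<Rightarrow> 'h list \<Rightarrow> 'k) \<Rightarrow> 'k" where
  "dsw SW [] F = F [] []"
| "dsw SW (h # w) F = SW h (\<lambda>a b. dsw SW w (\<lambda>x y. F (a # x) (b # y)))"

lemma dsw_cop: "dsw (\<lambda>h F. SW h (\<lambda>a b. F b a)) w F = dsw SW w (\<lambda>x y. F y x)"
  by (induction w arbitrary: F) auto

lemma dsw_append: "dsw SW (u @ v) F = dsw SW u (\<lambda>p q. dsw SW v (\<lambda>r s. F (p @ r) (q @ s)))"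
  by (induction u arbitrary: F) auto

lemma dsw_cong: "(\<And>x y. F x y = G x y) \<Longrightarrow> dsw SW w F = dsw SW w G"
  by presburger

context sweedler
begin

abbreviation dw where "dw \<equiv> dsw SW"

lemma finop_dsw: "finop (\<lambda>f. dw w (\<lambda>x y. f (x, y)))"
proof (induction w)
  case Nil
  show ?case using finop_point[of 1] by simp
next
  case (Cons h w)
  show ?case
    using finop_SW[of "\<lambda>a b f. dw w (\<lambda>x y. f (x, y))" h "\<lambda>a b (x, y). (a # x, b # y)"] Cons by simp
qed

lemma dsw_finop_swap:
  assumes "finop \<Theta>"
  shows "dw w (\<lambda>x y. \<Theta> (\<lambda>z. F x y z)) = \<Theta> (\<lambda>z. dw w (\<lambda>x y. F x y z))"
  using finop_swap[OF finop_dsw assms, of w "\<lambda>(x, y). F x y"] by simp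

lemma SW_dsw_swap: "SW h (\<lambda>a b. dw w (\<lambda>x y. F a b x y)) = dw w (\<lambda>x y. SW h (\<lambda>a b. F a b x y))"
  using dsw_finop_swap[OF SW_fin, of w h "\<lambda>x y (a, b). F a b x y"] by simp

lemma dsw_dsw_swap: "dw v (\<lambda>a b. dw w (\<lambda>x y. F a b x y)) = dw w (\<lambda>x y. dw v (\<lambda>a b. F a b x y))"
  using dsw_finop_swap[OF finop_dsw, of w v "\<lambda>x y (a, b). F a b x y"] by simp

lemma dsw_rev: "dw (rev w) F = dw w (\<lambda>x y. F (rev x) (rev y))"
proof (induction w arbitrary: F)
  case (Cons h w)
  have "dw (rev (h # w)) F = dw w (\<lambda>p q. SW h (\<lambda>a b. F (rev p @ [a]) (rev q @ [b])))"
    by (simp add: dsw_append Cons)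
  also have "\<dots> = dw (h # w) (\<lambda>x y. F (rev x) (rev y))"
    by (simp add: SW_dsw_swap)
  finally show ?case .
qed simp

text \<open>Isolates the coproduct of a middle factor, so that a relation between words u and v is
  the bare relation for a modified functional.\<close>

lemma dsw_context:
  "dw (u @ z @ v) F = dw z (\<lambda>x y. dw u (\<lambda>p q. dw v (\<lambda>r s. F (p @ x @ r) (q @ y @ s))))"
  unfolding dsw_append by (rule dsw_dsw_swap)

lemma lin_dsw_inside [simp]:
  "(\<And>x y. L (\<lambda>z. F z x y)) \<Longrightarrow> L (\<lambda>z. dw w (\<lambda>x y. F z x y))"
  using lin_finop[OF finop_dsw, of sc "\<lambda>z (x, y). F z x y"] by auto

lemma pml_dsw:
  assumes "\<And>q. pml sc (\<lambda>p. F p q)" "\<And>p. pml sc (\<lambda>q. F p q)"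
  shows "pml sc (\<lambda>w. dw w F)"
proof -
  have [simp]: "llin sc G \<Longrightarrow> L (\<lambda>x. F (G x) q)" "llin sc G \<Longrightarrow> L (\<lambda>x. F q (G x))" for G q
    using pml_lin[OF assms(1)] pml_lin[OF assms(2)] by auto
  show ?thesis
    unfolding pml_def by (simp add: dsw_append)
qed

text \<open>This is coassociativity over the field, letter by letter; no balancing over a base
  algebra enters.\<close>

lemma dsw_coassoc:
  assumes "\<And>b c. pml sc (\<lambda>a. F a b c)" "\<And>a c. pml sc (\<lambda>b. F a b c)" "\<And>a b. pml sc (\<lambda>c. F a b c)"
  shows "dw w (\<lambda>x y. dw x (\<lambda>p q. F p q y)) = dw w (\<lambda>x y. dw y (\<lambda>p q. F x p q))"
  using assms
proof (induction w arbitrary: F)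
  case (Cons h w)
  have shift: "pml sc (\<lambda>a. F (x # a) b c)" "pml sc (\<lambda>b. F a (x # b) c)" "pml sc (\<lambda>c. F a b (x # c))" for x a b c
    by (rule pml_comp[where G = "\<lambda>w. x # w"], simp add: Cons.prems, simp)+
  have [simp]: "llin sc G \<Longrightarrow> L (\<lambda>x. F (G x) b c)" "llin sc G \<Longrightarrow> L (\<lambda>x. F b (G x) c)"
    "llin sc G \<Longrightarrow> L (\<lambda>x. F b c (G x))" for G b c
    using Cons.prems by (auto intro: pml_lin[where \<phi> = "\<lambda>a. F a b c"] pml_lin[where \<phi> = "\<lambda>a. F b a c"]
        pml_lin[where \<phi> = "\<lambda>a. F b c a"])
  have "dw (h # w) (\<lambda>x y. dw x (\<lambda>p q. F p q y))
      = SW h (\<lambda>a b. dw w (\<lambda>x y. SW a (\<lambda>c d. dw x (\<lambda>p q. F (c # p) (d # q) (b # y)))))"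
    by simp
  also have "\<dots> = SW h (\<lambda>a b. SW a (\<lambda>c d. dw w (\<lambda>x y. dw x (\<lambda>p q. F (c # p) (d # q) (b # y)))))"
    by (simp add: SW_dsw_swap[of _ w])
  also have "\<dots> = SW h (\<lambda>a b. SW a (\<lambda>c d. dw w (\<lambda>x y. dw y (\<lambda>p q. F (c # x) (d # p) (b # q)))))"
    by (subst Cons.IH) (auto intro: pml_comp[OF shift(1)] pml_comp[OF shift(2)] pml_comp[OF shift(3)] simp: shift)
  also have "\<dots> = SW h (\<lambda>a b. SW b (\<lambda>c d. dw w (\<lambda>x y. dw y (\<lambda>p q. F (a # x) (c # p) (d # q)))))"
    by (rule SW_coassoc) simp_all
  also have "\<dots> = dw (h # w) (\<lambda>x y. dw y (\<lambda>p q. F x p q))"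
    by (simp add: SW_dsw_swap[of _ w])
  finally show ?case .
qed simp

end

section \<open>Balanced functionals and the Takeuchi condition\<close>

text \<open>Functionals on $H^w_{par} \otimes_A H^w_{par}$ (\<open>bal\<close>) and on
  $H^w_{par} \otimes_{\tilde A} H^w_{par}$ (\<open>rbal\<close>); it suffices to balance over the generators
  $E_h$, for which $t(E_h) = [h_2][S^{-1}(h_1)]$, respectively $\tilde E_h$.\<close>

definition bal :: "('k::field \<Rightarrow> 'h::ab_group_add \<Rightarrow> 'h) \<Rightarrow> ('h \<Rightarrow> 'h \<Rightarrow> 'h) \<Rightarrow> 'h
    \<Rightarrow> ('h \<Rightarrow> ('h \<Rightarrow> 'h \<Rightarrow> 'k) \<Rightarrow> 'k) \<Rightarrow> ('h \<Rightarrow> 'h) \<Rightarrow> ('h \<Rightarrow> 'h)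
    \<Rightarrow> ('h list \<Rightarrow> 'h list \<Rightarrow> 'k) \<Rightarrow> bool" where
  "bal sc mul one SW S T F \<longleftrightarrow>
     (\<forall>q. pst sc mul one SW S (\<lambda>p. F p q)) \<and> (\<forall>p. pst sc mul one SW S (\<lambda>q. F p q))
   \<and> (\<forall>h x y. SW h (\<lambda>a b. F (b # T a # x) y) = SW h (\<lambda>a b. F x (a # S b # y)))"

definition rbal :: "('k::field \<Rightarrow> 'h::ab_group_add \<Rightarrow> 'h) \<Rightarrow> ('h \<Rightarrow> 'h \<Rightarrow> 'h) \<Rightarrow> 'h
    \<Rightarrow> ('h \<Rightarrow> ('h \<Rightarrow> 'h \<Rightarrow> 'k) \<Rightarrow> 'k) \<Rightarrow> ('h \<Rightarrow> 'h) \<Rightarrow> ('h \<Rightarrow> 'h)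
    \<Rightarrow> ('h list \<Rightarrow> 'h list \<Rightarrow> 'k) \<Rightarrow> bool" where
  "rbal sc mul one SW S T F \<longleftrightarrow>
     (\<forall>q. pst sc mul one SW S (\<lambda>p. F p q)) \<and> (\<forall>p. pst sc mul one SW S (\<lambda>q. F p q))
   \<and> (\<forall>h x y. SW h (\<lambda>a b. F (x @ [S a, b]) y) = SW h (\<lambda>a b. F x (y @ [T b, a])))"

lemma bal_slot1: "bal sc mul one SW S T F \<Longrightarrow> pst sc mul one SW S (\<lambda>p. F p q)"
  by (simp add: bal_def)
lemma bal_slot2: "bal sc mul one SW S T F \<Longrightarrow> pst sc mul one SW S (\<lambda>q. F p q)"
  by (simp add: bal_def)
lemma bal_move: "bal sc mul one SW S T F \<Longrightarrow> SW h (\<lambda>a b. F (b # T a # x) y) = SW h (\<lambda>a b. F x (a # S b # y))"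
  by (rule bal_def[THEN iffD1, THEN conjunct2, THEN conjunct2, rule_format])

lemma balI:
  assumes "\<And>q. pst sc mul one SW S (\<lambda>p. F p q)" "\<And>p. pst sc mul one SW S (\<lambda>q. F p q)"
    "\<And>h x y. SW h (\<lambda>a b. F (b # T a # x) y) = SW h (\<lambda>a b. F x (a # S b # y))"
  shows "bal sc mul one SW S T F"
  unfolding bal_def by (intro conjI allI assms)

lemma rbal_slot1: "rbal sc mul one SW S T F \<Longrightarrow> pst sc mul one SW S (\<lambda>p. F p q)"
  by (simp add: rbal_def)
lemma rbal_slot2: "rbal sc mul one SW S T F \<Longrightarrow> pst sc mul one SW S (\<lambda>q. F p q)"
  by (simp add: rbal_def)
lemma rbal_move: "rbal sc mul one SW S T F \<Longrightarrow> SW h (\<lambda>a b. F (x @ [S a, b]) y) = SW h (\<lambda>a b. F x (y @ [T b, a]))"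
  by (rule rbal_def[THEN iffD1, THEN conjunct2, THEN conjunct2, rule_format])

lemma bal_append_right:
  assumes "bal sc mul one SW S T F"
  shows "bal sc mul one SW S T (\<lambda>x y. F (x @ r) (y @ s))"
  by (rule balI) (use bal_move[OF assms, of _ "_ @ r" "_ @ s"] in
      \<open>simp_all add: pst_append_right[OF bal_slot1[OF assms]] pst_append_right[OF bal_slot2[OF assms]]\<close>)

section \<open>Stability of balanced functionals under multiplication by coproducts\<close>

context phopf
begin

abbreviation BAL where "BAL \<equiv> bal sc mul one SW S T"
abbreviation RBAL where "RBAL \<equiv> rbal sc mul one SW S T"

lemma bal_lin:
  assumes "BAL F" and "llin sc G"
  shows "L (\<lambda>x. F (G x) q)" and "L (\<lambda>x. F q (G x))"
  using pml_lin[OF pst_pml[OF bal_slot1[OF assms(1)]] assms(2)] pml_lin[OF pst_pml[OF bal_slot2[OF assms(1)]] assms(2)]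
  by simp_all

lemma bal_finop:
  assumes \<Theta>: "finop \<Theta>" and K: "\<And>z. BAL (\<lambda>x y. K x y z)"
  shows "BAL (\<lambda>x y. \<Theta> (\<lambda>z. K x y z))"
proof (rule balI)
  show "PS (\<lambda>p. \<Theta> (\<lambda>z. K p q z))" for q
    by (rule pst_finop[OF \<Theta>]) (rule bal_slot1[OF K])
  show "PS (\<lambda>q. \<Theta> (\<lambda>z. K p q z))" for p
    by (rule pst_finop[OF \<Theta>]) (rule bal_slot2[OF K])
  show "SW h (\<lambda>a b. \<Theta> (\<lambda>z. K (b # T a # x) y z)) = SW h (\<lambda>a b. \<Theta> (\<lambda>z. K x (a # S b # y) z))" for h x y
    by (simp only: SW_finop_swap[OF \<Theta>] bal_move[OF K])
qed

lemma bal_dsw: "(\<And>r s. BAL (\<lambda>x y. K x y r s)) \<Longrightarrow> BAL (\<lambda>x y. dw w (\<lambda>r s. K x y r s))"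
  using bal_finop[OF finop_dsw, of "\<lambda>x y (r, s). K x y r s"] by auto

lemma bal_cop: "BAL F \<Longrightarrow> bal sc mul one (\<lambda>h F. SW h (\<lambda>a b. F b a)) T S (\<lambda>x y. F y x)"
  by (rule balI) (simp_all add: pst_cop bal_slot1 bal_slot2 bal_move)

lemma rbal_opcop:
  "RBAL F \<Longrightarrow> bal sc (\<lambda>x y. mul y x) one (\<lambda>h F. SW h (\<lambda>a b. F b a)) S T (\<lambda>x y. F (rev y) (rev x))"
proof (rule balI)
  assume F: "RBAL F"
  show "pst sc (\<lambda>x y. mul y x) one (\<lambda>h F. SW h (\<lambda>a b. F b a)) S (\<lambda>p. F (rev q) (rev p))" for q
    by (rule pst_rev[OF rbal_slot2[OF F]])
  show "pst sc (\<lambda>x y. mul y x) one (\<lambda>h F. SW h (\<lambda>a b. F b a)) S (\<lambda>q. F (rev q) (rev p))" for p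
    by (rule pst_rev[OF rbal_slot1[OF F, of "rev p"]])
qed (simp add: rbal_move)

lemma pst_triple_T: "PS \<phi> \<Longrightarrow> SW h (\<lambda>r a. SW r (\<lambda>c b. \<phi> (u @ a # T b # c # v))) = \<phi> (u @ h # v)"
  using pst_triple[OF pst_cop, of \<phi> u h v] by simp

lemma pst_T_mul: "PS \<phi> \<Longrightarrow> SW h (\<lambda>a b. \<phi> (u @ b # T a # k # v)) = SW h (\<lambda>a b. \<phi> (u @ b # (T a \<odot> k) # v))"
  using pst_S_mul[OF pst_cop, of \<phi> h u k v] by simp

lemma pst_mul_T: "PS \<phi> \<Longrightarrow> SW k (\<lambda>a b. \<phi> (u @ h # b # T a # v)) = SW k (\<lambda>a b. \<phi> (u @ (h \<odot> b) # T a # v))"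
  using pst_mul_S[OF pst_cop, of \<phi> k u h v] by simp

lemma E_one_T: "PS \<phi> \<Longrightarrow> SW one (\<lambda>a b. \<phi> (u @ b # T a # v)) = \<phi> (u @ v)"
  using phopf.E_one[OF cop pst_cop, of \<phi> u v] by simp

lemma SW_T_mul:
  assumes "\<And>b. L (\<lambda>a. F a b)" "\<And>a. L (\<lambda>b. F a b)"
  shows "SW h (\<lambda>p c. SW p (\<lambda>a b. F (T b \<odot> a) c)) = SW one (\<lambda>a b. F (T a) (h \<odot> b))"
  using phopf.SW_mul_S_inner[OF cop, of "\<lambda>a b. F b a" h] assms by simp

lemma SW_one_T_mul: "L f \<Longrightarrow> SW one (\<lambda>a b. f (T b \<odot> a)) = f one"
  using phopf.SW_one_S_mul[OF cop, of f] by simp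

lemma SW_one_mul_T: "L f \<Longrightarrow> SW one (\<lambda>a b. f (b \<odot> T a)) = f one"
  using phopf.SW_one_mul_S[OF cop, of f] by simp

text \<open>T(h_2) h_1 (x) h_3 equals T(1_1) (x) h 1_2; the coproduct of h 1_2 is then simple
  because 1_2 lies in H_t. This is the cancellation behind \<open>bal_SW\<close> and
  \<open>bal_mul_S\<close>.\<close>

lemma SW_four_T_mul:
  assumes "\<And>b c. L (\<lambda>a. N a b c)" "\<And>a c. L (\<lambda>b. N a b c)" "\<And>a b. L (\<lambda>c. N a b c)"
  shows "SW h (\<lambda>a b. SW b (\<lambda>p q. SW p (\<lambda>p1 p2. N (T p1 \<odot> a) p2 q)))
       = SW one (\<lambda>s t. SW h (\<lambda>a b. N (T s) (a \<odot> t) b))"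
proof -
  have [simp]: "VL g \<Longrightarrow> L (\<lambda>x. N (g x) b c)" "VL g \<Longrightarrow> L (\<lambda>x. N b (g x) c)" "VL g \<Longrightarrow> L (\<lambda>x. N b c (g x))" for g b c
    using assms by (auto intro: lin_vlin[of sc "\<lambda>x. N x b c"] lin_vlin[of sc "\<lambda>x. N b x c"] lin_vlin[of sc "N b c"])
  have "SW h (\<lambda>a b. SW b (\<lambda>p q. SW p (\<lambda>p1 p2. N (T p1 \<odot> a) p2 q))) = SW4 h (\<lambda>a p1 p2 q. N (T p1 \<odot> a) p2 q)"
    by (simp add: legs)
  also have "\<dots> = SW h (\<lambda>g r. SW g (\<lambda>a p1. SW r (\<lambda>p2 q. N (T p1 \<odot> a) p2 q)))"
    by (simp add: legs)
  also have "\<dots> = SW one (\<lambda>s t. SW (h \<odot> t) (\<lambda>a b. N (T s) a b))"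
    by (subst SW_T_mul[of "\<lambda>w r. SW r (\<lambda>p q. N w p q)"]) (simp_all add: assms)
  also have "\<dots> = SW one (\<lambda>s t. SW h (\<lambda>a b. N (T s) (a \<odot> t) b))"
    by (rule SW_one_cong) (simp_all add: SW_mul_Ht assms)
  finally show ?thesis .
qed

text \<open>The Takeuchi condition for a letter. In the second slot E_k moves left past [h_2],
  becoming E_{h_2 k}; it crosses the tensor sign and meets [h_1], where T(h_2) h_1 cancels.\<close>

lemma bal_SW:
  assumes F: "BAL F"
  shows "BAL (\<lambda>x y. SW h (\<lambda>a b. F (a # x) (b # y)))"
proof (rule balI)
  show "PS (\<lambda>p. SW h (\<lambda>a b. F (a # p) (b # q)))" for q
    by (intro pst_SW pst_Cons[where \<phi> = "\<lambda>p. F p _"] bal_slot1[OF F])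
  show "PS (\<lambda>q. SW h (\<lambda>a b. F (a # p) (b # q)))" for p
    by (intro pst_SW pst_Cons[where \<phi> = "\<lambda>q. F _ q"] bal_slot2[OF F])
  note [simp] = bal_lin[OF F]
  fix k x y
  have "SW k (\<lambda>c d. SW h (\<lambda>a b. F (a # x) (b # c # S d # y)))
      = SW h (\<lambda>a b. SW k (\<lambda>c d. F (a # x) (b # c # S d # y)))"
    by (rule SW_swap)
  also have "\<dots> = SW h (\<lambda>a b. SW b (\<lambda>p q. SW (p \<odot> k) (\<lambda>c d. F (a # x) (c # S d # q # y))))"
    by (simp add: E_commute[OF bal_slot2[OF F], where u = "[]", simplified])
  also have "\<dots> = SW h (\<lambda>a b. SW b (\<lambda>p q. SW (p \<odot> k) (\<lambda>c d. F (d # T c # a # x) (q # y))))"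
    by (simp add: bal_move[OF F])
  also have "\<dots> = SW h (\<lambda>a b. SW b (\<lambda>p q. SW (p \<odot> k) (\<lambda>c d. F (d # (T c \<odot> a) # x) (q # y))))"
    by (simp add: pst_T_mul[OF bal_slot1[OF F], where u = "[]", simplified])
  also have "\<dots> = SW h (\<lambda>a b. SW b (\<lambda>p q. SW p (\<lambda>p1 p2. SW k (\<lambda>c d. F ((p2 \<odot> d) # (T c \<odot> (T p1 \<odot> a)) # x) (q # y)))))"
    by (simp add: SW_mul T_mul mul_assoc)
  also have "\<dots> = SW one (\<lambda>s t. SW h (\<lambda>a b. SW k (\<lambda>c d. F (((a \<odot> t) \<odot> d) # (T c \<odot> T s) # x) (b # y))))"
    by (rule SW_four_T_mul[of "\<lambda>w p q. SW k (\<lambda>c d. F ((p \<odot> d) # (T c \<odot> w) # x) (q # y))"]) simp_all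
  also have "\<dots> = SW h (\<lambda>a b. SW one (\<lambda>s t. SW k (\<lambda>c d. F ((a \<odot> (t \<odot> d)) # T (s \<odot> c) # x) (b # y))))"
    by (subst SW_swap) (simp add: T_mul mul_assoc)
  also have "\<dots> = SW h (\<lambda>a b. SW k (\<lambda>c d. F ((a \<odot> d) # T c # x) (b # y)))"
    by (intro SW_cong SW_one_left[of "\<lambda>c d. F ((_ \<odot> d) # T c # x) (_ # y)"]) simp_all
  also have "\<dots> = SW h (\<lambda>a b. SW k (\<lambda>c d. F (a # d # T c # x) (b # y)))"
    by (simp add: pst_mul_T[OF bal_slot1[OF F], where u = "[]", simplified])
  also have "\<dots> = SW k (\<lambda>c d. SW h (\<lambda>a b. F (a # d # T c # x) (b # y)))"
    by (rule SW_swap)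
  finally show "SW k (\<lambda>c d. SW h (\<lambda>a b. F (a # d # T c # x) (b # y)))
      = SW k (\<lambda>c d. SW h (\<lambda>a b. F (a # x) (b # c # S d # y)))" ..
qed

lemma bal_dsw_left: "BAL F \<Longrightarrow> BAL (\<lambda>x y. dw w (\<lambda>p q. F (p @ x) (q @ y)))"
proof (induction w arbitrary: F)
  case (Cons h w)
  from Cons.IH[OF bal_SW[OF Cons.prems, of h]] show ?case
    by (simp add: SW_dsw_swap)
qed simp

lemma bal_context:
  assumes "BAL F"
  shows "BAL (\<lambda>x y. dw u (\<lambda>p q. dw v (\<lambda>r s. F (p @ x @ r) (q @ y @ s))))"
proof -
  have "BAL (\<lambda>x y. dw v (\<lambda>r s. F (x @ r) (y @ s)))"
    by (intro bal_dsw bal_append_right assms)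
  from bal_dsw_left[OF this, of u] show ?thesis by simp
qed

text \<open>$\Delta_l(E_h) = E_h \otimes 1$, with an arbitrary further dependence on $h$ in the first factor.\<close>

lemma bal_absorb:
  assumes F: "BAL F" and w: "llin sc w"
  shows "SW4 k (\<lambda>k1 k2 k3 k4. F (k1 # w k4) (k2 # S k3 # y)) = SW k (\<lambda>a b. F (a # w b) y)"
proof -
  have [simp]: "VL g \<Longrightarrow> llin sc (\<lambda>x. w (g x))" for g
    using w unfolding llin_def by (auto simp: fun_eq_iff) (metis vlin_comp)
  note [simp] = bal_lin[OF F]
  have "SW4 k (\<lambda>k1 k2 k3 k4. F (k1 # w k4) (k2 # S k3 # y))
      = SW3 k (\<lambda>k1 m k4. SW m (\<lambda>k2 k3. F (k1 # w k4) (k2 # S k3 # y)))"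
    by (simp add: legs)
  also have "\<dots> = SW3 k (\<lambda>k1 m k4. SW m (\<lambda>c d. F (d # T c # k1 # w k4) y))"
    by (simp add: bal_move[OF F])
  also have "\<dots> = SW k (\<lambda>r k4. SW r (\<lambda>m d. SW m (\<lambda>k1 c. F (d # T c # k1 # w k4) y)))"
    by (simp add: legs)
  also have "\<dots> = SW k (\<lambda>r k4. F (r # w k4) y)"
    by (simp add: pst_triple_T[OF bal_slot1[OF F], where u = "[]", simplified])
  finally show ?thesis .
qed

text \<open>The leg 1_2 lies in H_t, hence is an E and crosses to the first slot. There it combines
  with 1_1 to T(1_2) 1_1 = 1.\<close>

lemma bal_one:
  assumes F: "BAL F"
  shows "SW one (\<lambda>a b. F [a] [b]) = F [] []"
proof -
  note [simp] = bal_lin[OF F]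
  have "SW one (\<lambda>a b. F [a] [b]) = SW one (\<lambda>a b. F [T b \<odot> a] [])"
  proof (rule SW_one_cong)
    fix a b assume b: "Ht b"
    have "F [a] [b] = SW b (\<lambda>c d. F [a] [c, S d])"
      using E_Ht[OF bal_slot2[OF F, of "[a]"] b, of "[]" "[]"] by simp
    also have "\<dots> = SW b (\<lambda>c d. F [d, T c, a] [])"
      by (simp add: bal_move[OF F])
    also have "\<dots> = SW b (\<lambda>c d. F [d, T c \<odot> a] [])"
      using pst_T_mul[OF bal_slot1[OF F, of "[]"], of b "[]" a "[]"] by simp
    also have "\<dots> = SW one (\<lambda>c d. F [d, T c \<odot> (T b \<odot> a)] [])"
      by (subst Ht_left[OF b]) (simp_all add: T_mul mul_assoc)
    also have "\<dots> = SW one (\<lambda>c d. F [d, T c, T b \<odot> a] [])"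
      using pst_T_mul[OF bal_slot1[OF F, of "[]"], of one "[]" "T b \<odot> a" "[]"] by simp
    also have "\<dots> = F [T b \<odot> a] []"
      using E_one_T[OF bal_slot1[OF F, of "[]"], of "[]" "[T b \<odot> a]"] by simp
    finally show "F [a] [b] = F [T b \<odot> a] []" .
  qed simp_all
  also have "\<dots> = F [one] []"
    by (rule SW_one_T_mul) simp
  also have "\<dots> = F [] []"
    using pst_one[OF bal_slot1[OF F, of "[]"], of "[]" "[]"] by simp
  finally show ?thesis .
qed

text \<open>Both sides reduce to [h_1 k_1][S(k_2)] (x) [h_2]. On the left E_k stays in the first
  slot by \<open>bal_absorb\<close>; on the right the product in the second slot is first split, and
  the resulting E is exchanged and carried across.\<close>

lemma bal_mul_S:
  assumes F: "BAL F"
  shows "SW k (\<lambda>c d. dw [h, c, S d] F) = SW k (\<lambda>c d. dw [h \<odot> c, S d] F)"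
proof -
  note [simp] = bal_lin[OF F] bal_lin[OF bal_SW[OF F]]
  note s1 = bal_slot1[OF F] and s2 = bal_slot2[OF F]
  have "SW k (\<lambda>c d. dw [h, c, S d] F)
      = SW k (\<lambda>c d. SW c (\<lambda>k1 k2. SW d (\<lambda>k3 k4. SW h (\<lambda>a b. F [a, k1, S k4] [b, k2, S k3]))))"
  proof (intro SW_cong)
    fix c d
    have "dw [h, c, S d] F = SW h (\<lambda>a b. SW c (\<lambda>k1 k2. SW d (\<lambda>k3 k4. F [a, k1, S k4] [b, k2, S k3])))"
      by (simp add: SW_S)
    also have "\<dots> = SW c (\<lambda>k1 k2. SW h (\<lambda>a b. SW d (\<lambda>k3 k4. F [a, k1, S k4] [b, k2, S k3])))"
      by (rule SW_swap)
    also have "\<dots> = SW c (\<lambda>k1 k2. SW d (\<lambda>k3 k4. SW h (\<lambda>a b. F [a, k1, S k4] [b, k2, S k3])))"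
      by (intro SW_cong SW_swap)
    finally show "dw [h, c, S d] F = SW c (\<lambda>k1 k2. SW d (\<lambda>k3 k4. SW h (\<lambda>a b. F [a, k1, S k4] [b, k2, S k3])))" .
  qed
  also have "\<dots> = SW k (\<lambda>c d. SW d (\<lambda>k3 k4. SW c (\<lambda>k1 k2. SW h (\<lambda>a b. F [a, k1, S k4] [b, k2, S k3]))))"
    by (intro SW_cong SW_swap)
  also have "\<dots> = SW4 k (\<lambda>k1 k2 k3 k4. SW h (\<lambda>a b. F [a, k1, S k4] [b, k2, S k3]))"
    by (simp add: legs)
  also have "\<dots> = SW k (\<lambda>c d. SW h (\<lambda>a b. F [a, c, S d] [b]))"
    by (rule bal_absorb[OF bal_SW[OF F], where w = "\<lambda>d. [S d]" and y = "[]"]) simp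
  also have "\<dots> = SW h (\<lambda>a b. SW k (\<lambda>c d. F [a, c, S d] [b]))"
    by (rule SW_swap)
  also have "\<dots> = SW h (\<lambda>a b. SW k (\<lambda>c d. F [a \<odot> c, S d] [b]))"
    by (simp add: pst_mul_S[OF s1, where u = "[]", simplified])
  finally have lhs: "SW k (\<lambda>c d. dw [h, c, S d] F) = SW h (\<lambda>a b. SW k (\<lambda>c d. F [a \<odot> c, S d] [b]))" .

  \<comment> \<open>The expression reached after the E has crossed, with w in place of T(h_2) h_1 so
    that \<open>SW_four_T_mul\<close> applies.\<close>
  let ?N = "\<lambda>w p q. SW4 k (\<lambda>c1 m1 m2 d2. F [p \<odot> m2, T m1 \<odot> (w \<odot> c1), S d2] [q])"
  have "SW k (\<lambda>c d. dw [h \<odot> c, S d] F)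
      = SW k (\<lambda>c d. SW h (\<lambda>a b. SW c (\<lambda>c1 c2. SW d (\<lambda>d1 d2. F [a \<odot> c1, S d2] [b \<odot> c2, S d1]))))"
    by (simp add: SW_S SW_mul)
  also have "\<dots> = SW h (\<lambda>a b. SW k (\<lambda>c d. SW c (\<lambda>c1 c2. SW d (\<lambda>d1 d2. F [a \<odot> c1, S d2] [b \<odot> c2, S d1]))))"
    by (rule SW_swap)
  also have "\<dots> = SW h (\<lambda>a b. SW k (\<lambda>c d. SW d (\<lambda>d1 d2. SW c (\<lambda>c1 c2. F [a \<odot> c1, S d2] [b \<odot> c2, S d1]))))"
    by (intro SW_cong SW_swap)
  also have "\<dots> = SW h (\<lambda>a b. SW3 k (\<lambda>c1 m d2. SW m (\<lambda>c2 d1. F [a \<odot> c1, S d2] [b \<odot> c2, S d1])))"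
    by (simp add: legs)
  also have "\<dots> = SW h (\<lambda>a b. SW3 k (\<lambda>c1 m d2. SW m (\<lambda>c2 d1. F [a \<odot> c1, S d2] [b, c2, S d1])))"
    by (simp add: pst_mul_S[OF s2, where u = "[]", simplified])
  also have "\<dots> = SW h (\<lambda>a b. SW3 k (\<lambda>c1 m d2. SW b (\<lambda>p q. SW (p \<odot> m) (\<lambda>e f. F [a \<odot> c1, S d2] [e, S f, q]))))"
    by (simp add: E_commute[OF s2, where u = "[]", simplified])
  also have "\<dots> = SW h (\<lambda>a b. SW3 k (\<lambda>c1 m d2. SW b (\<lambda>p q. SW (p \<odot> m) (\<lambda>e f. F [f, T e, a \<odot> c1, S d2] [q]))))"
    by (simp add: bal_move[OF F])
  also have "\<dots> = SW h (\<lambda>a b. SW3 k (\<lambda>c1 m d2. SW b (\<lambda>p q. SW (p \<odot> m) (\<lambda>e f. F [f, T e \<odot> (a \<odot> c1), S d2] [q]))))"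
    by (simp add: pst_T_mul[OF s1, where u = "[]", simplified])
  also have "\<dots> = SW h (\<lambda>a b. SW b (\<lambda>p q. SW3 k (\<lambda>c1 m d2. SW (p \<odot> m) (\<lambda>e f. F [f, T e \<odot> (a \<odot> c1), S d2] [q]))))"
    by (simp add: SW3_SW_swap)
  also have "\<dots> = SW h (\<lambda>a b. SW b (\<lambda>p q. SW3 k (\<lambda>c1 m d2. SW p (\<lambda>p1 p2. SW m (\<lambda>m1 m2. F [p2 \<odot> m2, T m1 \<odot> (T p1 \<odot> a \<odot> c1), S d2] [q])))))"
    by (simp add: SW_mul T_mul mul_assoc)
  also have "\<dots> = SW h (\<lambda>a b. SW b (\<lambda>p q. SW p (\<lambda>p1 p2. SW3 k (\<lambda>c1 m d2. SW m (\<lambda>m1 m2. F [p2 \<odot> m2, T m1 \<odot> (T p1 \<odot> a \<odot> c1), S d2] [q])))))"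
    by (intro SW_cong SW3_SW_swap)
  also have "\<dots> = SW h (\<lambda>a b. SW b (\<lambda>p q. SW p (\<lambda>p1 p2. ?N (T p1 \<odot> a) p2 q)))"
    by (simp add: SW3_leg2)
  also have "\<dots> = SW one (\<lambda>s t. SW h (\<lambda>a b. ?N (T s) (a \<odot> t) b))"
    by (rule SW_four_T_mul[of ?N]) simp_all
  also have "\<dots> = SW h (\<lambda>a b. SW one (\<lambda>s t. ?N (T s) (a \<odot> t) b))"
    by (rule SW_swap)
  also have "\<dots> = SW h (\<lambda>a b. SW k (\<lambda>c d. F [a \<odot> c, S d] [b]))"
  proof (rule SW_cong)
    fix a b
    have "SW one (\<lambda>s t. ?N (T s) (a \<odot> t) b)
        = SW one (\<lambda>s t. SW3 k (\<lambda>c1 m d2. SW m (\<lambda>m1 m2. F [a \<odot> (t \<odot> m2), T (s \<odot> m1) \<odot> c1, S d2] [b])))"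
      by (simp add: SW3_leg2 T_mul mul_assoc)
    also have "\<dots> = SW3 k (\<lambda>c1 m d2. SW one (\<lambda>s t. SW m (\<lambda>m1 m2. F [a \<odot> (t \<odot> m2), T (s \<odot> m1) \<odot> c1, S d2] [b])))"
      by (rule SW3_SW_swap[symmetric])
    also have "\<dots> = SW3 k (\<lambda>c1 m d2. SW m (\<lambda>m1 m2. F [a \<odot> m2, T m1 \<odot> c1, S d2] [b]))"
      by (simp add: SW_one_left[of "\<lambda>m1 m2. F [a \<odot> m2, T m1 \<odot> _, S _] [b]"])
    also have "\<dots> = SW k (\<lambda>r d2. SW r (\<lambda>q m2. SW q (\<lambda>c1 m1. F [a \<odot> m2, T m1 \<odot> c1, S d2] [b])))"
      by (simp add: legs)
    also have "\<dots> = SW k (\<lambda>r d2. SW one (\<lambda>s t. F [a \<odot> (r \<odot> t), T s, S d2] [b]))"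
      by (subst SW_T_mul[of "\<lambda>x y. F [a \<odot> y, x, S _] [b]"]) simp_all
    \<comment> \<open>With s taken in H_s, T(s) is in H_t and its letter merges with the left
      neighbour; afterwards 1_2 T(1_1) = 1 finishes the cancellation.\<close>
    also have "\<dots> = SW k (\<lambda>r d2. SW one (\<lambda>s t. F [a \<odot> r \<odot> (t \<odot> T s), S d2] [b]))"
    proof (rule SW_cong, rule SW_one_cong)
      fix r d2 s t assume "Hs s"
      from mult_Ht_right[OF s1 Ht_T[OF this], of "[]"]
      show "F [a \<odot> (r \<odot> t), T s, S d2] [b] = F [a \<odot> r \<odot> (t \<odot> T s), S d2] [b]"
        by (simp add: mul_assoc)
    qed simp_all
    also have "\<dots> = SW k (\<lambda>c d. F [a \<odot> c, S d] [b])"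
      by (subst SW_one_mul_T[of "\<lambda>z. F [a \<odot> _ \<odot> z, S _] [b]"]) simp_all
    finally show "SW one (\<lambda>s t. ?N (T s) (a \<odot> t) b) = SW k (\<lambda>c d. F [a \<odot> c, S d] [b])" .
  qed
  finally show ?thesis using lhs by simp
qed

text \<open>Both sides reduce to E_h [k_1] (x) [k_2], since E_h leaves no trace in the second
  slot.\<close>

lemma bal_S_mul:
  assumes F: "BAL F"
  shows "SW h (\<lambda>c d. dw [c, S d, k] F) = SW h (\<lambda>c d. dw [c, S d \<odot> k] F)"
proof -
  note [simp] = bal_lin[OF F]
  note s1 = bal_slot1[OF F] and s2 = bal_slot2[OF F]
  have "SW h (\<lambda>c d. dw [c, S d, k] F)
      = SW h (\<lambda>c d. SW d (\<lambda>d1 d2. SW c (\<lambda>c1 c2. SW k (\<lambda>e f. F [c1, S d2, e] [c2, S d1, f]))))"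
    by (subst SW_swap) (simp add: SW_S)
  also have "\<dots> = SW4 h (\<lambda>c1 c2 d1 d2. SW k (\<lambda>e f. F [c1, S d2, e] [c2, S d1, f]))"
    by (simp add: legs)
  also have "\<dots> = SW k (\<lambda>e f. SW4 h (\<lambda>c1 c2 d1 d2. F [c1, S d2, e] [c2, S d1, f]))"
    by (rule SW4_SW_swap)
  also have "\<dots> = SW k (\<lambda>e f. SW h (\<lambda>a b. F [a, S b, e] [f]))"
    by (simp add: bal_absorb[OF F, where w = "\<lambda>d. [S d, _]"])
  finally have lhs: "SW h (\<lambda>c d. dw [c, S d, k] F) = SW k (\<lambda>e f. SW h (\<lambda>a b. F [a, S b, e] [f]))" .
  have "SW h (\<lambda>c d. dw [c, S d \<odot> k] F)
      = SW h (\<lambda>c d. SW d (\<lambda>d1 d2. SW c (\<lambda>c1 c2. SW k (\<lambda>e f. F [c1, S d2 \<odot> e] [c2, S d1 \<odot> f]))))"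
    by (subst SW_swap) (simp add: SW_S SW_mul)
  also have "\<dots> = SW4 h (\<lambda>c1 c2 d1 d2. SW k (\<lambda>e f. F [c1, S d2 \<odot> e] [c2, S d1 \<odot> f]))"
    by (simp add: legs)
  also have "\<dots> = SW k (\<lambda>e f. SW4 h (\<lambda>c1 c2 d1 d2. F [c1, S d2 \<odot> e] [c2, S d1 \<odot> f]))"
    by (rule SW4_SW_swap)
  also have "\<dots> = SW k (\<lambda>e f. SW3 h (\<lambda>c1 m d2. SW m (\<lambda>c2 d1. F [c1, S d2 \<odot> e] [c2, S d1 \<odot> f])))"
    by (simp add: legs)
  also have "\<dots> = SW k (\<lambda>e f. SW3 h (\<lambda>c1 m d2. SW m (\<lambda>c2 d1. F [c1, S d2 \<odot> e] [c2, S d1, f])))"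
    by (simp add: pst_S_mul[OF s2, where u = "[]", simplified])
  also have "\<dots> = SW k (\<lambda>e f. SW4 h (\<lambda>c1 c2 d1 d2. F [c1, S d2 \<odot> e] [c2, S d1, f]))"
    by (simp add: legs)
  also have "\<dots> = SW k (\<lambda>e f. SW h (\<lambda>a b. F [a, S b \<odot> e] [f]))"
    by (simp add: bal_absorb[OF F, where w = "\<lambda>d. [S d \<odot> _]"])
  also have "\<dots> = SW k (\<lambda>e f. SW h (\<lambda>a b. F [a, S b, e] [f]))"
    by (simp add: pst_S_mul[OF s1, where u = "[]", simplified])
  finally show ?thesis using lhs by simp
qed

text \<open>Absorbing the E formed by the first two letters leaves the triple relation in the first
  slot alone.\<close>

lemma bal_triple:
  assumes F: "BAL F"
  shows "dw [h] F = SW h (\<lambda>a r. SW r (\<lambda>b c. dw [a, S b, c] F))"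
proof -
  note [simp] = bal_lin[OF F]
  have "SW h (\<lambda>a r. SW r (\<lambda>b c. dw [a, S b, c] F))
      = SW h (\<lambda>p c. SW p (\<lambda>a b. SW b (\<lambda>b1 b2. SW a (\<lambda>a1 a2. SW c (\<lambda>c1 c2. F [a1, S b2, c1] [a2, S b1, c2])))))"
  proof -
    have "dw [a, S b, c] F = SW b (\<lambda>b1 b2. SW a (\<lambda>a1 a2. SW c (\<lambda>c1 c2. F [a1, S b2, c1] [a2, S b1, c2])))" for a b c
      by (subst SW_swap) (simp add: SW_S)
    then show ?thesis
      by (simp only:) (rule SW_coassoc[symmetric], simp_all)
  qed
  also have "\<dots> = SW h (\<lambda>p c. SW4 p (\<lambda>a1 a2 b1 b2. SW c (\<lambda>c1 c2. F [a1, S b2, c1] [a2, S b1, c2])))"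
    by (intro SW_cong) (simp add: legs)
  also have "\<dots> = SW h (\<lambda>p c. SW c (\<lambda>c1 c2. SW4 p (\<lambda>a1 a2 b1 b2. F [a1, S b2, c1] [a2, S b1, c2])))"
    by (intro SW_cong SW4_SW_swap)
  also have "\<dots> = SW h (\<lambda>p c. SW c (\<lambda>c1 c2. SW p (\<lambda>a b. F [a, S b, c1] [c2])))"
    by (simp add: bal_absorb[OF F, where w = "\<lambda>d. [S d, _]"])
  also have "\<dots> = SW h (\<lambda>p c2. SW p (\<lambda>a r. SW r (\<lambda>b c1. F [a, S b, c1] [c2])))"
    by (simp add: legs)
  also have "\<dots> = SW h (\<lambda>p c2. F [p] [c2])"
    by (simp add: pst_triple[OF bal_slot1[OF F], where u = "[]", simplified, symmetric])
  finally show ?thesis by simp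
qed

lemma dsw_mul_S:
  assumes F: "BAL F"
  shows "SW k (\<lambda>a b. dw (u @ h # a # S b # v) F) = SW k (\<lambda>a b. dw (u @ (h \<odot> a) # S b # v) F)"
  using bal_mul_S[OF bal_context[OF F, of u v], of k h] dsw_context[of u "[_, _, _]" v F] dsw_context[of u "[_, _]" v F]
  by simp

lemma dsw_S_mul:
  assumes F: "BAL F"
  shows "SW h (\<lambda>a b. dw (u @ a # S b # k # v) F) = SW h (\<lambda>a b. dw (u @ a # (S b \<odot> k) # v) F)"
  using bal_S_mul[OF bal_context[OF F, of u v], of h k] dsw_context[of u "[_, _, _]" v F] dsw_context[of u "[_, _]" v F]
  by simp

lemma bal_pml: "BAL F \<Longrightarrow> pml sc (\<lambda>w. dw w F)"
  by (rule pml_dsw) (rule pst_pml, erule bal_slot1 bal_slot2)+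

text \<open>Well-definedness of $\Delta_l$: functionals on the balanced tensor square pull back to $H^w_{par}$.
  The relations with \<open>S\<close> in front follow from the others for $H^{cop}$.\<close>

lemma pst_Delta:
  assumes F: "BAL F"
  shows "PS (\<lambda>w. dw w F)"
proof (rule pstI, goal_cases)
  case 1
  show ?case by (rule bal_pml[OF F])
next
  case (2 u v)
  show ?case
    using bal_one[OF bal_context[OF F, of u v]] dsw_context[of u "[one]" v F] dsw_context[of u "[]" v F] by simp
next
  case (3 u v h k)
  show ?case by (rule dsw_mul_S[OF F])
next
  case (4 u v h k)
  note [simp] = pml_lin[OF bal_pml[OF F]]
  show ?case
    using phopf.dsw_mul_S[OF cop bal_cop[OF F], of "S k" u h v] by (simp add: dsw_cop SW_S)
next
  case (5 u v h k)
  show ?case by (rule dsw_S_mul[OF F])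
next
  case (6 u v h k)
  note [simp] = pml_lin[OF bal_pml[OF F]]
  show ?case
    using phopf.dsw_S_mul[OF cop bal_cop[OF F], of "S h" u k v] by (simp add: dsw_cop SW_S)
next
  case (7 u v h)
  show ?case
    using bal_triple[OF bal_context[OF F, of u v], of h] dsw_context[of u "[h]" v F] dsw_context[of u "[_, _, _]" v F] by simp
qed

lemma dsw_opcop:
  "dsw (\<lambda>h F. SW h (\<lambda>a b. F b a)) (rev w) (\<lambda>x y. F (rev y) (rev x)) = dw w F"
  by (simp add: dsw_cop dsw_rev)

lemma pst_unrev:
  assumes "pst sc (\<lambda>x y. mul y x) one (\<lambda>h F. SW h (\<lambda>a b. F b a)) S \<phi>"
  shows "PS (\<lambda>w. \<phi> (rev w))"
  using phopf.pst_rev[OF opcop assms] by simp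

lemma pst_Delta_r:
  assumes F: "RBAL F"
  shows "PS (\<lambda>w. dw w F)"
  using pst_unrev[OF phopf.pst_Delta[OF opcop rbal_opcop[OF F]]] by (simp add: dsw_opcop)

end

section \<open>The base algebras\<close>

text \<open>Elements of the free algebra are represented by the evaluation operators they induce on
  functions of words.\<close>

inductive_set galg :: "(('h list \<Rightarrow> 'k::field) \<Rightarrow> 'k) set \<Rightarrow> (('h list \<Rightarrow> 'k) \<Rightarrow> 'k) set" for G where
  galg_unit: "(\<lambda>\<phi>. c * \<phi> []) \<in> galg G"
| galg_gen: "g \<in> G \<Longrightarrow> g \<in> galg G"
| galg_add: "\<alpha> \<in> galg G \<Longrightarrow> \<beta> \<in> galg G \<Longrightarrow> (\<lambda>\<phi>. \<alpha> \<phi> + \<beta> \<phi>) \<in> galg G"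
| galg_mul: "\<alpha> \<in> galg G \<Longrightarrow> \<beta> \<in> galg G \<Longrightarrow> (\<lambda>\<phi>. \<alpha> (\<lambda>u. \<beta> (\<lambda>v. \<phi> (u @ v)))) \<in> galg G"

definition Aop :: "('h \<Rightarrow> ('h \<Rightarrow> 'h \<Rightarrow> 'k::field) \<Rightarrow> 'k) \<Rightarrow> ('h \<Rightarrow> 'h) \<Rightarrow> (('h list \<Rightarrow> 'k) \<Rightarrow> 'k) set" where
  "Aop SW S = galg (range (\<lambda>h \<phi>. SW h (\<lambda>a b. \<phi> [a, S b])))"

definition Bop :: "('h \<Rightarrow> ('h \<Rightarrow> 'h \<Rightarrow> 'k::field) \<Rightarrow> 'k) \<Rightarrow> ('h \<Rightarrow> 'h) \<Rightarrow> (('h list \<Rightarrow> 'k) \<Rightarrow> 'k) set" where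
  "Bop SW S = galg (range (\<lambda>h \<phi>. SW h (\<lambda>a b. \<phi> [S a, b])))"

lemma galg_finop:
  assumes "\<alpha> \<in> galg G" "\<And>g. g \<in> G \<Longrightarrow> finop g"
  shows "finop \<alpha>"
  using assms(1)
proof induction
  case (galg_mul \<alpha> \<beta>)
  then show ?case using finop_comp[of \<alpha> "\<lambda>_. \<beta>" "(@)"] by simp
qed (auto intro: finop_point finop_plus assms(2))

lemma galg_scale:
  assumes "\<alpha> \<in> galg G"
  shows "(\<lambda>\<phi>. c * \<alpha> \<phi>) \<in> galg G"
  using galg_mul[OF galg_unit[of c] assms] by simp

lemma galg_sum:
  assumes \<Theta>: "finop \<Theta>" and \<alpha>: "\<And>z. \<alpha> z \<in> galg G"
  shows "(\<lambda>\<phi>. \<Theta> (\<lambda>z. \<alpha> z \<phi>)) \<in> galg G"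
proof -
  obtain p where p: "\<And>f. \<Theta> f = ev f p" using \<Theta> by (auto simp: finop_def)
  have "(\<lambda>\<phi>. \<Sum>z\<in>I. Poly_Mapping.lookup p z * \<alpha> z \<phi>) \<in> galg G" if "finite I" for I
    using that
  proof induction
    case empty
    show ?case using galg_unit[of 0] by simp
  next
    case (insert x I)
    then show ?case using galg_add[OF galg_scale[OF \<alpha>[of x]] insert.IH] by simp
  qed
  from this[OF finite_keys] show ?thesis by (simp add: p ev_def)
qed

text \<open>Only multilinear \<open>\<phi>\<close> are tested, because the generator hypotheses
  compare the coproducts of f(h) and h by means of such functionals.\<close>

lemma galg_anti:
  assumes "\<alpha> \<in> galg G" and fin: "\<And>g. g \<in> G \<Longrightarrow> finop g" "\<And>g. g \<in> G' \<Longrightarrow> finop g" and f: "vlin sc f"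
    and gen: "\<And>g. g \<in> G \<Longrightarrow> \<exists>\<beta>\<in>galg G'. \<forall>\<phi>. pml sc \<phi> \<longrightarrow> \<beta> \<phi> = g (\<lambda>w. \<phi> (rev (map f w)))"
  shows "\<exists>\<beta>\<in>galg G'. \<forall>\<phi>. pml sc \<phi> \<longrightarrow> \<beta> \<phi> = \<alpha> (\<lambda>w. \<phi> (rev (map f w)))"
  using assms(1)
proof induction
  case (galg_unit c)
  show ?case by (intro bexI[OF _ galg.galg_unit[of c]]) simp
next
  case (galg_gen g)
  then show ?case by (rule gen)
next
  case (galg_add \<alpha> \<beta>)
  then obtain \<alpha>' \<beta>' where "\<alpha>' \<in> galg G'" "\<forall>\<phi>. pml sc \<phi> \<longrightarrow> \<alpha>' \<phi> = \<alpha> (\<lambda>w. \<phi> (rev (map f w)))"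
    "\<beta>' \<in> galg G'" "\<forall>\<phi>. pml sc \<phi> \<longrightarrow> \<beta>' \<phi> = \<beta> (\<lambda>w. \<phi> (rev (map f w)))" by blast
  then show ?case by (intro bexI[OF _ galg.galg_add[of \<alpha>' G' \<beta>']]) auto
next
  case (galg_mul \<alpha> \<beta>)
  then obtain \<alpha>' \<beta>' where \<alpha>': "\<alpha>' \<in> galg G'" "\<And>\<phi>. pml sc \<phi> \<Longrightarrow> \<alpha>' \<phi> = \<alpha> (\<lambda>w. \<phi> (rev (map f w)))"
    and \<beta>': "\<beta>' \<in> galg G'" "\<And>\<phi>. pml sc \<phi> \<Longrightarrow> \<beta>' \<phi> = \<beta> (\<lambda>w. \<phi> (rev (map f w)))" by metis
  note fins = galg_finop[OF galg_mul.hyps(1) fin(1)] galg_finop[OF galg_mul.hyps(2) fin(1)]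
  show ?case
  proof (intro bexI[OF _ galg.galg_mul[OF \<beta>'(1) \<alpha>'(1)]] allI impI)
    fix \<phi> assume \<phi>: "pml sc \<phi>"
    have "\<beta>' (\<lambda>u. \<alpha>' (\<lambda>v. \<phi> (u @ v))) = \<beta>' (\<lambda>u. \<alpha> (\<lambda>v. \<phi> (u @ rev (map f v))))"
      by (simp add: \<alpha>'(2) pml_comp[OF \<phi>])
    also have "\<dots> = \<beta> (\<lambda>u. \<alpha> (\<lambda>v. \<phi> (rev (map f u) @ rev (map f v))))"
      by (rule \<beta>'(2)) (intro pml_finop[OF fins(1)] pml_comp[OF \<phi>], simp_all)
    also have "\<dots> = \<alpha> (\<lambda>v. \<beta> (\<lambda>u. \<phi> (rev (map f u) @ rev (map f v))))"
      by (rule finop_swap[OF fins(2,1)])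
    finally show "\<beta>' (\<lambda>u. \<alpha>' (\<lambda>v. \<phi> (u @ v))) = \<alpha> (\<lambda>u. \<beta> (\<lambda>v. \<phi> (rev (map f (u @ v)))))"
      by simp
  qed
qed

lemma galg_rev:
  assumes "\<alpha> \<in> galg G" and fin: "\<And>g. g \<in> G \<Longrightarrow> finop g"
    and gen: "\<And>g. g \<in> G \<Longrightarrow> (\<lambda>\<phi>. g (\<lambda>w. \<phi> (rev w))) \<in> galg G'"
  shows "(\<lambda>\<phi>. \<alpha> (\<lambda>w. \<phi> (rev w))) \<in> galg G'"
  using assms(1)
proof induction
  case (galg_mul \<alpha> \<beta>)
  note fins = galg_finop[OF galg_mul.hyps(1) fin] galg_finop[OF galg_mul.hyps(2) fin]
  have "(\<lambda>\<phi>. \<alpha> (\<lambda>u. \<beta> (\<lambda>v. \<phi> (rev (u @ v))))) = (\<lambda>\<phi>. \<beta> (\<lambda>v. \<alpha> (\<lambda>u. \<phi> (rev v @ rev u))))"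
    by (simp add: finop_swap[OF fins])
  then show ?case
    using galg.galg_mul[OF galg_mul.IH(2,1)] by simp
qed (auto intro: galg.intros gen)

context sweedler
begin

lemma finop_SW2: "finop (\<lambda>f. SW h (\<lambda>a b. f (g a b)))"
  using finop_map[OF SW_fin, of h "\<lambda>(a, b). g a b"] by simp

lemma Aop_finop: "\<alpha> \<in> Aop SW S \<Longrightarrow> finop \<alpha>"
  unfolding Aop_def by (erule galg_finop) (auto intro: finop_SW2)

lemma Bop_finop: "\<alpha> \<in> Bop SW S \<Longrightarrow> finop \<alpha>"
  unfolding Bop_def by (erule galg_finop) (auto intro: finop_SW2)

lemma Bop_rev: "\<beta> \<in> Bop SW S \<Longrightarrow> (\<lambda>\<phi>. \<beta> (\<lambda>w. \<phi> (rev w))) \<in> Aop (\<lambda>h F. SW h (\<lambda>a b. F b a)) S"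
  unfolding Aop_def Bop_def
  by (erule galg_rev) (auto intro!: finop_SW2 galg_gen)

lemma Aop_rev: "\<alpha> \<in> Aop (\<lambda>h F. SW h (\<lambda>a b. F b a)) S \<Longrightarrow> (\<lambda>\<phi>. \<alpha> (\<lambda>w. \<phi> (rev w))) \<in> Bop SW S"
  unfolding Aop_def Bop_def
  by (erule galg_rev) (auto intro!: finop_SW2 galg_gen)

end

section \<open>Anti-morphisms between the two base algebras, their commutation, and
  balancing\<close>

context phopf
begin

abbreviation A where "A \<equiv> Aop SW S"
abbreviation B where "B \<equiv> Bop SW S"

lemma A_gen: "(\<lambda>\<phi>. SW h (\<lambda>a b. \<phi> [a, S b])) \<in> A"
  unfolding Aop_def by (rule galg_gen) auto
lemma B_gen: "(\<lambda>\<phi>. SW h (\<lambda>a b. \<phi> [S a, b])) \<in> B"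
  unfolding Bop_def by (rule galg_gen) auto

lemma A_into_B:
  assumes "\<alpha> \<in> A" and f: "VL f"
    and anti: "\<And>F h. \<lbrakk>\<And>b. L (\<lambda>a. F a b); \<And>a. L (\<lambda>b. F a b)\<rbrakk> \<Longrightarrow> SW (f h) F = SW h (\<lambda>a b. F (f b) (f a))"
    and fS: "\<And>x. f (S x) = S (f x)"
  shows "\<exists>\<beta>\<in>B. \<forall>\<phi>. pml sc \<phi> \<longrightarrow> \<beta> \<phi> = \<alpha> (\<lambda>w. \<phi> (rev (map f w)))"
  unfolding Bop_def using assms(1) unfolding Aop_def
proof (rule galg_anti)
  fix g assume "g \<in> range (\<lambda>h \<phi>. SW h (\<lambda>a b. \<phi> [a, S b]))"
  then obtain h where g: "g = (\<lambda>\<phi>. SW h (\<lambda>a b. \<phi> [a, S b]))" by auto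
  show "\<exists>\<beta>\<in>galg (range (\<lambda>h \<phi>. SW h (\<lambda>a b. \<phi> [S a, b]))). \<forall>\<phi>. pml sc \<phi> \<longrightarrow> \<beta> \<phi> = g (\<lambda>w. \<phi> (rev (map f w)))"
  proof (rule bexI[OF _ B_gen[of "f h", unfolded Bop_def]], intro allI impI)
    fix \<phi> assume "pml sc \<phi>"
    note [simp] = pml_lin[OF this]
    show "SW (f h) (\<lambda>a b. \<phi> [S a, b]) = g (\<lambda>w. \<phi> (rev (map f w)))"
      by (simp add: g anti fS)
  qed
qed (auto intro: finop_SW2 f)

lemma B_into_A:
  assumes "\<alpha> \<in> B" and f: "VL f"
    and anti: "\<And>F h. \<lbrakk>\<And>b. L (\<lambda>a. F a b); \<And>a. L (\<lambda>b. F a b)\<rbrakk> \<Longrightarrow> SW (f h) F = SW h (\<lambda>a b. F (f b) (f a))"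
    and fS: "\<And>x. f (S x) = S (f x)"
  shows "\<exists>\<beta>\<in>A. \<forall>\<phi>. pml sc \<phi> \<longrightarrow> \<beta> \<phi> = \<alpha> (\<lambda>w. \<phi> (rev (map f w)))"
  unfolding Aop_def using assms(1) unfolding Bop_def
proof (rule galg_anti)
  fix g assume "g \<in> range (\<lambda>h \<phi>. SW h (\<lambda>a b. \<phi> [S a, b]))"
  then obtain h where g: "g = (\<lambda>\<phi>. SW h (\<lambda>a b. \<phi> [S a, b]))" by auto
  show "\<exists>\<beta>\<in>galg (range (\<lambda>h \<phi>. SW h (\<lambda>a b. \<phi> [a, S b]))). \<forall>\<phi>. pml sc \<phi> \<longrightarrow> \<beta> \<phi> = g (\<lambda>w. \<phi> (rev (map f w)))"
  proof (rule bexI[OF _ A_gen[of "f h", unfolded Aop_def]], intro allI impI)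
    fix \<phi> assume "pml sc \<phi>"
    note [simp] = pml_lin[OF this]
    show "SW (f h) (\<lambda>a b. \<phi> [a, S b]) = g (\<lambda>w. \<phi> (rev (map f w)))"
      by (simp add: g anti fS)
  qed
qed (auto intro: finop_SW2 f)

lemma A_S_B: "\<alpha> \<in> A \<Longrightarrow> \<exists>\<beta>\<in>B. \<forall>\<phi>. pml sc \<phi> \<longrightarrow> \<beta> \<phi> = \<alpha> (\<lambda>w. \<phi> (rev (map S w)))"
  by (erule A_into_B[OF _ S_vlin]) (simp_all add: SW_S)

lemma A_T_B: "\<alpha> \<in> A \<Longrightarrow> \<exists>\<beta>\<in>B. \<forall>\<phi>. pml sc \<phi> \<longrightarrow> \<beta> \<phi> = \<alpha> (\<lambda>w. \<phi> (rev (map T w)))"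
  by (erule A_into_B[OF _ T_vlin]) (simp_all add: SW_T)

lemma B_S_A: "\<alpha> \<in> B \<Longrightarrow> \<exists>\<beta>\<in>A. \<forall>\<phi>. pml sc \<phi> \<longrightarrow> \<beta> \<phi> = \<alpha> (\<lambda>w. \<phi> (rev (map S w)))"
  by (erule B_into_A[OF _ S_vlin]) (simp_all add: SW_S)

lemma B_T_A: "\<alpha> \<in> B \<Longrightarrow> \<exists>\<beta>\<in>A. \<forall>\<phi>. pml sc \<phi> \<longrightarrow> \<beta> \<phi> = \<alpha> (\<lambda>w. \<phi> (rev (map T w)))"
  by (erule B_into_A[OF _ T_vlin]) (simp_all add: SW_T)

definition comm where
  "comm \<alpha> \<beta> \<longleftrightarrow> (\<forall>\<phi>. PS \<phi> \<longrightarrow> \<alpha> (\<lambda>u. \<beta> (\<lambda>v. \<phi> (u @ v))) = \<alpha> (\<lambda>u. \<beta> (\<lambda>v. \<phi> (v @ u))))"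

lemma commD: "comm \<alpha> \<beta> \<Longrightarrow> PS \<phi> \<Longrightarrow> \<alpha> (\<lambda>u. \<beta> (\<lambda>v. \<phi> (u @ v))) = \<alpha> (\<lambda>u. \<beta> (\<lambda>v. \<phi> (v @ u)))"
  by (simp add: comm_def)

lemma comm_sym: "finop \<alpha> \<Longrightarrow> finop \<beta> \<Longrightarrow> comm \<alpha> \<beta> \<Longrightarrow> comm \<beta> \<alpha>"
  unfolding comm_def by (simp add: finop_swap[of \<beta> \<alpha>])

lemma galg_comm:
  assumes "\<beta> \<in> galg G" and \<alpha>: "finop \<alpha>" and G: "\<And>g. g \<in> G \<Longrightarrow> finop g" "\<And>g. g \<in> G \<Longrightarrow> comm \<alpha> g"
  shows "comm \<alpha> \<beta>"
  using assms(1)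
proof induction
  case (galg_unit c)
  show ?case by (simp add: comm_def finop_scale_fun[OF \<alpha>])
next
  case (galg_gen g)
  then show ?case by (rule G(2))
next
  case (galg_add \<beta> \<gamma>)
  then show ?case by (simp add: comm_def finop_add_fun[OF \<alpha>])
next
  case (galg_mul \<beta> \<gamma>)
  note \<beta> = galg_finop[OF galg_mul.hyps(1) G(1)] and \<gamma> = galg_finop[OF galg_mul.hyps(2) G(1)]
  show ?case
    unfolding comm_def
  proof (intro allI impI)
    fix \<phi> assume \<phi>: "PS \<phi>"
    have "\<alpha> (\<lambda>u. \<beta> (\<lambda>v. \<gamma> (\<lambda>w. \<phi> (u @ v @ w)))) = \<gamma> (\<lambda>w. \<alpha> (\<lambda>u. \<beta> (\<lambda>v. \<phi> ((u @ v) @ w))))"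
      by (simp add: finop_swap[OF \<beta> \<gamma>] finop_swap[OF \<alpha> \<gamma>])
    also have "\<dots> = \<gamma> (\<lambda>w. \<alpha> (\<lambda>u. \<beta> (\<lambda>v. \<phi> ((v @ u) @ w))))"
      by (simp only: commD[OF galg_mul.IH(1) pst_append_right[OF \<phi>]])
    also have "\<dots> = \<beta> (\<lambda>v. \<alpha> (\<lambda>u. \<gamma> (\<lambda>w. \<phi> (v @ u @ w))))"
      by (simp add: finop_swap[OF \<alpha> \<gamma>] finop_swap[OF \<beta> \<alpha>] finop_swap[OF \<beta> \<gamma>])
    also have "\<dots> = \<beta> (\<lambda>v. \<alpha> (\<lambda>u. \<gamma> (\<lambda>w. \<phi> (v @ w @ u))))"
      by (simp only: commD[OF galg_mul.IH(2) pst_append_left[OF \<phi>]])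
    also have "\<dots> = \<alpha> (\<lambda>u. \<beta> (\<lambda>v. \<gamma> (\<lambda>w. \<phi> ((v @ w) @ u))))"
      by (simp add: finop_swap[OF \<beta> \<alpha>])
    finally show "\<alpha> (\<lambda>u. \<beta> (\<lambda>v. \<gamma> (\<lambda>w. \<phi> (u @ v @ w)))) = \<alpha> (\<lambda>u. \<beta> (\<lambda>v. \<gamma> (\<lambda>w. \<phi> ((v @ w) @ u))))" .
  qed
qed

lemma A_B_comm:
  assumes "\<alpha> \<in> A" "\<beta> \<in> B"
  shows "comm \<alpha> \<beta>"
proof -
  have E: "comm (\<lambda>\<phi>. SW k (\<lambda>c d. \<phi> [S c, d])) (\<lambda>\<phi>. SW h (\<lambda>a b. \<phi> [a, S b]))" for h k
    unfolding comm_def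
  proof (intro allI impI)
    fix \<phi> assume "PS \<phi>"
    from E_Et_commute[OF this, of h k "[]" "[]"]
    show "SW k (\<lambda>c d. SW h (\<lambda>a b. \<phi> ([S c, d] @ [a, S b]))) = SW k (\<lambda>c d. SW h (\<lambda>a b. \<phi> ([a, S b] @ [S c, d])))"
      by (subst (1 2) SW_swap) simp
  qed
  have "comm (\<lambda>\<phi>. SW k (\<lambda>c d. \<phi> [S c, d])) \<alpha>" for k
    using assms(1) unfolding Aop_def
    by (rule galg_comm) (auto intro: finop_SW2 E)
  then have C: "comm \<alpha> (\<lambda>\<phi>. SW k (\<lambda>c d. \<phi> [S c, d]))" for k
    by (intro comm_sym[OF finop_SW2 Aop_finop[OF assms(1)]])
  from assms(2) show ?thesis
    unfolding Bop_def by (rule galg_comm) (auto intro: finop_SW2 C Aop_finop[OF assms(1)])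
qed

text \<open>t maps A into the other base algebra, so commutation of the images of s and t is the
  commutation of E with E~.\<close>

lemma A_tA_comm:
  assumes \<alpha>: "\<alpha> \<in> A" and \<gamma>: "\<gamma> \<in> A" and \<phi>: "PS \<phi>"
  shows "\<alpha> (\<lambda>u. \<gamma> (\<lambda>v. \<phi> (u @ rev (map T v)))) = \<alpha> (\<lambda>u. \<gamma> (\<lambda>v. \<phi> (rev (map T v) @ u)))"
proof -
  obtain \<beta> where \<beta>: "\<beta> \<in> B" "\<And>\<phi>. pml sc \<phi> \<Longrightarrow> \<beta> \<phi> = \<gamma> (\<lambda>w. \<phi> (rev (map T w)))"
    using A_T_B[OF \<gamma>] by blast
  from commD[OF A_B_comm[OF \<alpha> \<beta>(1)] \<phi>] show ?thesis
    by (simp add: \<beta>(2) pml_comp[OF pst_pml[OF \<phi>]])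
qed

lemma bal_move_A:
  assumes "\<alpha> \<in> A" and F: "BAL F"
  shows "\<alpha> (\<lambda>u. F (rev (map T u) @ x) y) = \<alpha> (\<lambda>u. F x (u @ y))"
  using assms(1) unfolding Aop_def
proof (induction arbitrary: x y)
  case (galg_gen g)
  then show ?case using bal_move[OF F] by auto
next
  case (galg_mul \<alpha> \<beta>)
  note fins = Aop_finop[unfolded Aop_def, OF galg_mul.hyps(1)] Aop_finop[unfolded Aop_def, OF galg_mul.hyps(2)]
  have "\<alpha> (\<lambda>u. \<beta> (\<lambda>v. F (rev (map T (u @ v)) @ x) y)) = \<alpha> (\<lambda>u. \<beta> (\<lambda>v. F (rev (map T u) @ x) (v @ y)))"
    using galg_mul.IH(2) by simp
  also have "\<dots> = \<beta> (\<lambda>v. \<alpha> (\<lambda>u. F x (u @ v @ y)))"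
    by (simp add: finop_swap[OF fins] galg_mul.IH(1))
  also have "\<dots> = \<alpha> (\<lambda>u. \<beta> (\<lambda>v. F x ((u @ v) @ y)))"
    by (simp add: finop_swap[OF fins])
  finally show ?case .
qed simp_all

text \<open>Balancedness of the functional in \<open>bal_dsw_left\<close>, read at two empty
  words.\<close>

lemma Takeuchi:
  assumes \<alpha>: "\<alpha> \<in> A" and F: "BAL F"
  shows "\<alpha> (\<lambda>u. dw w (\<lambda>p q. F (p @ rev (map T u)) q)) = \<alpha> (\<lambda>u. dw w (\<lambda>p q. F p (q @ u)))"
  using bal_move_A[OF \<alpha> bal_dsw_left[OF F, of w], of "[]" "[]"] by simp

text \<open>Left multiplication by s(a) in the first slot commutes with t(A), the elements that
  cross the tensor sign.\<close>

lemma bal_A_left: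
  assumes \<alpha>: "\<alpha> \<in> A" and F: "BAL F"
  shows "BAL (\<lambda>x y. \<alpha> (\<lambda>u. F (u @ x) y))"
proof (rule balI)
  note fin = Aop_finop[OF \<alpha>]
  show "PS (\<lambda>p. \<alpha> (\<lambda>u. F (u @ p) q))" for q
    by (intro pst_finop[OF fin] pst_append_left[where \<phi> = "\<lambda>p. F p q"] bal_slot1[OF F])
  show "PS (\<lambda>q. \<alpha> (\<lambda>u. F (u @ p) q))" for p
    by (intro pst_finop[OF fin] bal_slot2[OF F])
  fix h x y
  have "SW h (\<lambda>a b. \<alpha> (\<lambda>u. F (u @ b # T a # x) y)) = \<alpha> (\<lambda>u. SW h (\<lambda>a b. F ((u @ rev (map T [a, S b])) @ x) y))"
    by (simp add: SW_finop_swap[OF fin])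
  also have "\<dots> = \<alpha> (\<lambda>u. SW h (\<lambda>a b. F ((rev (map T [a, S b]) @ u) @ x) y))"
    by (rule A_tA_comm[OF \<alpha> A_gen, of "\<lambda>w. F (w @ x) y"]) (rule pst_append_right[OF bal_slot1[OF F]])
  also have "\<dots> = \<alpha> (\<lambda>u. SW h (\<lambda>a b. F (u @ x) (a # S b # y)))"
    by (simp add: bal_move[OF F])
  also have "\<dots> = SW h (\<lambda>a b. \<alpha> (\<lambda>u. F (u @ x) (a # S b # y)))"
    by (rule SW_finop_swap[OF fin, symmetric])
  finally show "SW h (\<lambda>a b. \<alpha> (\<lambda>u. F (u @ b # T a # x) y)) = SW h (\<lambda>a b. \<alpha> (\<lambda>u. F (u @ x) (a # S b # y)))" .
qed

lemma bal_dsw_right: "BAL F \<Longrightarrow> BAL (\<lambda>x y. dw w (\<lambda>r s. F (x @ r) (y @ s)))"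
  by (intro bal_dsw bal_append_right)

section \<open>The coproduct on the base algebra and on its image under t\<close>

lemma Delta_E:
  assumes F: "BAL F"
  shows "SW h (\<lambda>a b. dw [a, S b] F) = SW h (\<lambda>a b. F [a, S b] [])"
proof -
  note [simp] = bal_lin[OF F]
  have "SW h (\<lambda>a b. dw [a, S b] F) = SW h (\<lambda>c d. SW d (\<lambda>d1 d2. SW c (\<lambda>c1 c2. F [c1, S d2] [c2, S d1])))"
    by (subst SW_swap) (simp add: SW_S)
  also have "\<dots> = SW4 h (\<lambda>c1 c2 d1 d2. F [c1, S d2] [c2, S d1])"
    by (simp add: legs)
  also have "\<dots> = SW h (\<lambda>a b. F [a, S b] [])"
    by (simp add: bal_absorb[OF F, where w = "\<lambda>d. [S d]"])
  finally show ?thesis .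
qed

text \<open>Assuming Delta_l(a) = a (x) 1, it gives Delta_l(a x) = (a (x) 1) Delta_l(x). The
  assumption is explicit so that the lemma also serves within the induction for
  \<open>Delta_A\<close>.\<close>

lemma Delta_A_aux:
  assumes \<alpha>: "\<alpha> \<in> A" and F: "BAL F" and \<beta>: "finop \<beta>"
    and IH: "\<And>F. BAL F \<Longrightarrow> \<alpha> (\<lambda>w. dw w F) = \<alpha> (\<lambda>u. F u [])"
  shows "\<alpha> (\<lambda>u. \<beta> (\<lambda>v. dw (u @ v) F)) = \<beta> (\<lambda>v. dw v (\<lambda>r s. \<alpha> (\<lambda>u. F (u @ r) s)))"
proof -
  note fin = Aop_finop[OF \<alpha>]
  have "\<alpha> (\<lambda>u. \<beta> (\<lambda>v. dw (u @ v) F)) = \<beta> (\<lambda>v. \<alpha> (\<lambda>u. dw u (\<lambda>p q. dw v (\<lambda>r s. F (p @ r) (q @ s)))))"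
    by (simp add: finop_swap[OF fin \<beta>] dsw_append)
  also have "\<dots> = \<beta> (\<lambda>v. \<alpha> (\<lambda>u. dw v (\<lambda>r s. F (u @ r) s)))"
    using IH[OF bal_dsw_right[OF F]] by simp
  also have "\<dots> = \<beta> (\<lambda>v. dw v (\<lambda>r s. \<alpha> (\<lambda>u. F (u @ r) s)))"
    by (simp add: dsw_finop_swap[OF fin])
  finally show ?thesis .
qed

lemma Delta_A:
  assumes "\<alpha> \<in> A" and "BAL F"
  shows "\<alpha> (\<lambda>w. dw w F) = \<alpha> (\<lambda>u. F u [])"
  using assms unfolding Aop_def
proof (induction arbitrary: F)
  case (galg_gen g)
  then show ?case using Delta_E by auto
next
  case (galg_mul \<alpha> \<beta>)
  note \<alpha> = galg_mul.hyps(1)[folded Aop_def] and \<beta> = galg_mul.hyps(2)[folded Aop_def]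
  have "\<alpha> (\<lambda>u. \<beta> (\<lambda>v. dw (u @ v) F)) = \<beta> (\<lambda>v. dw v (\<lambda>r s. \<alpha> (\<lambda>u. F (u @ r) s)))"
    by (rule Delta_A_aux[OF \<alpha> galg_mul.prems Aop_finop[OF \<beta>] galg_mul.IH(1)])
  also have "\<dots> = \<beta> (\<lambda>v. \<alpha> (\<lambda>u. F (u @ v) []))"
    by (rule galg_mul.IH(2)[OF bal_A_left[OF \<alpha> galg_mul.prems]])
  also have "\<dots> = \<alpha> (\<lambda>u. \<beta> (\<lambda>v. F (u @ v) []))"
    by (rule finop_swap[OF Aop_finop[OF \<beta>] Aop_finop[OF \<alpha>]])
  finally show ?case .
qed simp_all

text \<open>t(A) is the algebra generated by the elements E of H^cop, so the coproduct on t(A) is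
  \<open>Delta_A\<close> for that structure with the slots exchanged.\<close>

lemma tA_cop:
  assumes "\<gamma> \<in> A"
  shows "(\<lambda>\<phi>. \<gamma> (\<lambda>v. \<phi> (rev (map T v)))) \<in> Aop (\<lambda>h F. SW h (\<lambda>a b. F b a)) T"
  using assms unfolding Aop_def
proof induction
  case (galg_gen g)
  then show ?case by (auto intro!: galg.galg_gen)
next
  case (galg_mul \<alpha> \<beta>)
  note fins = Aop_finop[unfolded Aop_def, OF galg_mul.hyps(1)] Aop_finop[unfolded Aop_def, OF galg_mul.hyps(2)]
  from galg.galg_mul[OF galg_mul.IH(2,1)] show ?case
    by (simp add: finop_swap[OF fins])
qed (auto intro: galg.intros)

lemma Delta_tA:
  assumes \<gamma>: "\<gamma> \<in> A" and F: "BAL F"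
  shows "\<gamma> (\<lambda>v. dw (rev (map T v)) F) = \<gamma> (\<lambda>v. F [] (rev (map T v)))"
  using phopf.Delta_A[OF cop tA_cop[OF \<gamma>] bal_cop[OF F]] by (simp add: dsw_cop)

lemma Delta_bimodule:
  assumes \<alpha>: "\<alpha> \<in> A" and \<gamma>: "\<gamma> \<in> A" and F: "BAL F"
  shows "\<alpha> (\<lambda>u. \<gamma> (\<lambda>v. dw ((u @ rev (map T v)) @ w) F))
       = \<alpha> (\<lambda>u. \<gamma> (\<lambda>v. dw w (\<lambda>r s. F (u @ r) (rev (map T v) @ s))))"
proof -
  define H where "H = (\<lambda>x y. dw w (\<lambda>r s. F (x @ r) (y @ s)))"
  have H: "BAL H" unfolding H_def by (rule bal_dsw_right[OF F])
  have "\<alpha> (\<lambda>u. \<gamma> (\<lambda>v. dw ((u @ rev (map T v)) @ w) F)) = \<alpha> (\<lambda>u. \<gamma> (\<lambda>v. dw (u @ rev (map T v)) H))"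
    by (simp only: H_def dsw_append[of SW "_ @ _" w])
  also have "\<dots> = \<gamma> (\<lambda>v. dw (rev (map T v)) (\<lambda>r s. \<alpha> (\<lambda>u. H (u @ r) s)))"
    by (rule Delta_A_aux[OF \<alpha> H, of "\<lambda>\<phi>. \<gamma> (\<lambda>v. \<phi> (rev (map T v)))"])
      (simp_all add: finop_map[OF Aop_finop[OF \<gamma>]] Delta_A[OF \<alpha>])
  also have "\<dots> = \<gamma> (\<lambda>v. \<alpha> (\<lambda>u. H u (rev (map T v))))"
    using Delta_tA[OF \<gamma> bal_A_left[OF \<alpha> H]] by simp
  also have "\<dots> = \<alpha> (\<lambda>u. \<gamma> (\<lambda>v. H u (rev (map T v))))"
    by (rule finop_swap[OF Aop_finop[OF \<gamma>] Aop_finop[OF \<alpha>]])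
  finally show ?thesis by (simp add: H_def)
qed

section \<open>The antipode and the second coproduct\<close>

lemma pst_antipode:
  assumes \<phi>: "PS \<phi>"
  shows "PS (\<lambda>w. \<phi> (rev (map S w)))"
proof (rule pstI, goal_cases)
  case 1
  show ?case by (rule pml_comp[OF pst_pml[OF \<phi>]]) simp
next
  case (2 u v)
  show ?case using pst_one[OF \<phi>] by simp
next
  case (3 u v h k)
  note [simp] = pml_lin[OF pst_pml[OF \<phi>]]
  show ?case using pst_S_mul'[OF \<phi>, of "S k" "rev (map S v)" "S h" "rev (map S u)"] by (simp add: SW_S S_mul)
next
  case (4 u v h k)
  note [simp] = pml_lin[OF pst_pml[OF \<phi>]]
  show ?case using pst_S_mul[OF \<phi>, of "S k" "rev (map S v)" "S h" "rev (map S u)"] by (simp add: SW_S S_mul)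
next
  case (5 u v h k)
  note [simp] = pml_lin[OF pst_pml[OF \<phi>]]
  show ?case using pst_mul_S'[OF \<phi>, of "S h" "rev (map S v)" "S k" "rev (map S u)"] by (simp add: SW_S S_mul)
next
  case (6 u v h k)
  note [simp] = pml_lin[OF pst_pml[OF \<phi>]]
  show ?case using pst_mul_S[OF \<phi>, of "S h" "rev (map S v)" "S k" "rev (map S u)"] by (simp add: SW_S S_mul)
next
  case (7 u v h)
  note [simp] = pml_lin[OF pst_pml[OF \<phi>]]
  let ?U = "rev (map S u)" and ?V = "rev (map S v)"
  have "\<phi> (?V @ S h # ?U) = SW (S h) (\<lambda>a r. SW r (\<lambda>b c. \<phi> (?V @ a # S b # c # ?U)))"
    by (rule pst_triple[OF \<phi>])
  also have "\<dots> = SW h (\<lambda>x y. SW (S x) (\<lambda>b c. \<phi> (?V @ S y # S b # c # ?U)))"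
    by (rule SW_S) simp_all
  also have "\<dots> = SW h (\<lambda>x y. SW x (\<lambda>p q. \<phi> (?V @ S y # S (S q) # S p # ?U)))"
    by (simp add: SW_S)
  also have "\<dots> = SW h (\<lambda>a r. SW r (\<lambda>b c. \<phi> (?V @ S c # S (S b) # S a # ?U)))"
    by (simp add: legs)
  finally show ?case by simp
qed

lemma rev_map_S_T [simp]: "rev (map S (rev (map T z))) = z"
  and rev_map_T_S [simp]: "rev (map T (rev (map S z))) = z"
  by (simp_all add: rev_map comp_def)

lemma pst_antipode_T:
  assumes \<phi>: "PS \<phi>"
  shows "PS (\<lambda>w. \<phi> (rev (map T w)))"
  using phopf.pst_cop[OF cop phopf.pst_antipode[OF cop pst_cop[OF \<phi>]]] by simp

text \<open>The antipode undoes t: reversing the second slot with S restores an element of the other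
  base algebra that crossed there as its image under t.\<close>

lemma rbal_conv:
  assumes \<phi>: "PS \<phi>"
  shows "RBAL (\<lambda>x y. \<phi> (x @ rev (map S y)))"
  unfolding rbal_def
  by (simp add: pst_append_right[OF \<phi>] pst_antipode[OF pst_append_left[OF \<phi>]])

lemma bal_unopcop:
  "bal sc (\<lambda>x y. mul y x) one (\<lambda>h F. SW h (\<lambda>a b. F b a)) S T F \<Longrightarrow> RBAL (\<lambda>x y. F (rev y) (rev x))"
  unfolding rbal_def
  using pst_unrev[OF bal_slot1] pst_unrev[OF bal_slot2] bal_move[of sc "\<lambda>x y. mul y x" one "\<lambda>h F. SW h (\<lambda>a b. F b a)" S T F]
  by simp

lemma rbal_append_left:
  assumes "RBAL F"
  shows "RBAL (\<lambda>x y. F (p @ x) (q @ y))"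
  using bal_unopcop[OF bal_append_right[OF rbal_opcop[OF assms], of "rev p" "rev q"]] by simp

lemma rbal_dsw_right:
  assumes "RBAL F"
  shows "RBAL (\<lambda>x y. dw w (\<lambda>r s. F (x @ r) (y @ s)))"
proof -
  from bal_unopcop[OF phopf.bal_dsw_left[OF opcop rbal_opcop[OF assms], of "rev w"]]
  show ?thesis by (simp add: dsw_cop dsw_rev)
qed

lemma Delta_r_B:
  assumes \<beta>: "\<beta> \<in> B" and F: "RBAL F"
  shows "\<beta> (\<lambda>w. dw w F) = \<beta> (\<lambda>u. F [] u)"
  using phopf.Delta_A[OF opcop Bop_rev[OF \<beta>] rbal_opcop[OF F]] by (simp add: dsw_opcop)

text \<open>A is also the image under t of the other base algebra. Hence this is
  \<open>Delta_tA\<close> in H^{op,cop}, after replacing \<open>\<alpha>\<close> by its antipode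
  image.\<close>

lemma Delta_r_A:
  assumes \<alpha>: "\<alpha> \<in> A" and F: "RBAL F"
  shows "\<alpha> (\<lambda>w. dw w F) = \<alpha> (\<lambda>u. F u [])"
proof -
  obtain \<beta> where \<beta>: "\<beta> \<in> B" "\<And>\<phi>. pml sc \<phi> \<Longrightarrow> \<beta> \<phi> = \<alpha> (\<lambda>w. \<phi> (rev (map S w)))"
    using A_S_B[OF \<alpha>] by blast
  note b = Bop_rev[OF \<beta>(1)]
  have "\<alpha> (\<lambda>w. dw w F) = \<beta> (\<lambda>w. dw (rev (map T w)) F)"
    by (subst \<beta>(2)[OF pst_pml[OF pst_antipode_T[OF pst_Delta_r[OF F]]]]) simp
  also have "\<dots> = \<beta> (\<lambda>u. F (rev (map T u)) [])"
    using phopf.Delta_tA[OF opcop b rbal_opcop[OF F]] by (simp add: dsw_opcop[symmetric] rev_map)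
  also have "\<dots> = \<alpha> (\<lambda>u. F u [])"
    by (subst \<beta>(2)[OF pst_pml[OF pst_antipode_T[OF rbal_slot1[OF F]]]]) simp
  finally show ?thesis .
qed

lemma Delta_r_tA:
  assumes \<gamma>: "\<gamma> \<in> A" and F: "RBAL F"
  shows "\<gamma> (\<lambda>v. dw (rev (map T v)) F) = \<gamma> (\<lambda>v. F [] (rev (map T v)))"
proof -
  obtain \<beta> where \<beta>: "\<beta> \<in> B" "\<And>\<phi>. pml sc \<phi> \<Longrightarrow> \<beta> \<phi> = \<gamma> (\<lambda>w. \<phi> (rev (map T w)))"
    using A_T_B[OF \<gamma>] by blast
  from Delta_r_B[OF \<beta>(1) F] show ?thesis
    by (simp only: \<beta>(2)[OF pst_pml[OF pst_Delta_r[OF F]]] \<beta>(2)[OF pst_pml[OF rbal_slot2[OF F]]])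
qed

lemma Delta_r_A_left:
  assumes \<alpha>: "\<alpha> \<in> A" and F: "RBAL F"
  shows "\<alpha> (\<lambda>u. dw (u @ w) F) = \<alpha> (\<lambda>u. dw w (\<lambda>r s. F (u @ r) s))"
  using Delta_r_A[OF \<alpha> rbal_dsw_right[OF F, of w]] by (simp add: dsw_append)

lemma Delta_r_tA_left:
  assumes \<gamma>: "\<gamma> \<in> A" and F: "RBAL F"
  shows "\<gamma> (\<lambda>v. dw (rev (map T v) @ w) F) = \<gamma> (\<lambda>v. dw w (\<lambda>r s. F r (rev (map T v) @ s)))"
  using Delta_r_tA[OF \<gamma> rbal_dsw_right[OF F, of w]] by (simp add: dsw_append)

end

section \<open>The counits\<close>

text \<open>The recursion of \<open>epsl\<close> on functionals. Product and coproduct are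
  parameters, so that the same function computes the right counit from H^{op,cop}.\<close>

fun el :: "('h \<Rightarrow> 'h \<Rightarrow> 'h) \<Rightarrow> ('h \<Rightarrow> ('h \<Rightarrow> 'h \<Rightarrow> 'k) \<Rightarrow> 'k) \<Rightarrow> ('h \<Rightarrow> 'h) \<Rightarrow> 'h list \<Rightarrow> ('h list \<Rightarrow> 'k) \<Rightarrow> 'k" where
  "el mul SW S [] \<phi> = \<phi> []"
| "el mul SW S [h] \<phi> = SW h (\<lambda>a b. \<phi> [a, S b])"
| "el mul SW S (h # g # u) \<phi> = SW h (\<lambda>a b. SW a (\<lambda>c d. el mul SW S (mul b g # u) (\<lambda>w. \<phi> (c # S d # w))))"

context phopf
begin

abbreviation epl where "epl \<equiv> el mul SW S"

lemma epl_A: "epl w \<in> A"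
proof (induction w rule: length_induct)
  case (1 w)
  consider "w = []" | h where "w = [h]" | h g u where "w = h # g # u"
    by (metis list.exhaust)
  then show ?case
  proof cases
    case 1
    then show ?thesis unfolding Aop_def using galg_unit[of 1] by (simp add: fun_eq_iff)
  next
    case (2 h)
    then show ?thesis using A_gen[of h] by simp
  next
    case (3 h g u)
    have IH: "epl ((b \<odot> g) # u) \<in> A" for b
      using 1 3 by simp
    have "(\<lambda>\<phi>. SW a (\<lambda>c d. epl ((b \<odot> g) # u) (\<lambda>w. \<phi> (c # S d # w)))) \<in> A" for a b
      using galg_mul[OF A_gen[unfolded Aop_def, of a] IH[unfolded Aop_def, of b]] by (simp add: Aop_def)
    then have "(\<lambda>\<phi>. SW h (\<lambda>a b. SW a (\<lambda>c d. epl ((b \<odot> g) # u) (\<lambda>w. \<phi> (c # S d # w))))) \<in> A"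
      unfolding Aop_def
      using galg_sum[OF SW_fin, of "\<lambda>(a, b) \<phi>. SW a (\<lambda>c d. epl ((b \<odot> g) # u) (\<lambda>w. \<phi> (c # S d # w)))"] by auto
    with 3 show ?thesis by simp
  qed
qed

text \<open>The relation $[g_1][S(g_2)][k] = [g_1][S(g_2)k]$ persists with an element of the base algebra
  inserted after $[g_1]$, since $[g]E_m = E_{g_1 m}[g_2]$ moves it to the left.\<close>

lemma A_S_mul_aux:
  assumes "\<alpha> \<in> A" and "finop \<beta>" and "PS \<phi>"
    and "\<And>\<phi> g k. PS \<phi> \<Longrightarrow> SW g (\<lambda>a b. \<beta> (\<lambda>w. \<phi> (a # w @ [S b, k]))) = SW g (\<lambda>a b. \<beta> (\<lambda>w. \<phi> (a # w @ [S b \<odot> k])))"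
  shows "SW g (\<lambda>a b. \<alpha> (\<lambda>u. \<beta> (\<lambda>w. \<phi> (a # u @ w @ [S b, k])))) = SW g (\<lambda>a b. \<alpha> (\<lambda>u. \<beta> (\<lambda>w. \<phi> (a # u @ w @ [S b \<odot> k]))))"
  using assms unfolding Aop_def
proof (induction arbitrary: \<beta> \<phi> g k)
  case (galg_unit c)
  then show ?case by (simp add: SW_scale)
next
  case (galg_add \<alpha> \<alpha>')
  from galg_add.IH(1)[OF galg_add.prems] galg_add.IH(2)[OF galg_add.prems] show ?case
    by (simp add: SW_add)
next
  case (galg_mul \<alpha> \<alpha>')
  note fin = Aop_finop[unfolded Aop_def, OF galg_mul.hyps(2)]
  \<comment> \<open>The right factor of the product joins \<open>\<beta>\<close>. What is then
    required of the enlarged \<open>\<beta>\<close> is the induction hypothesis for that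
    factor.\<close>
  have "finop (\<lambda>\<phi>. \<alpha>' (\<lambda>v. \<beta> (\<lambda>w. \<phi> (v @ w))))"
    using finop_comp[OF fin galg_mul.prems(1), of "(@)"] .
  from galg_mul.IH(1)[OF this galg_mul.prems(2)] galg_mul.IH(2)[OF galg_mul.prems(1) _ galg_mul.prems(3)]
  show ?case by simp
next
  case (galg_gen f)
  then obtain m where f: "f = (\<lambda>\<phi>. SW m (\<lambda>a b. \<phi> [a, S b]))" by auto
  note \<beta> = \<open>finop \<beta>\<close> and \<phi> = \<open>PS \<phi>\<close> and C = galg_gen.prems(3)
  note [simp] = pml_lin[OF pst_pml[OF \<phi>]] lin_finop[OF \<beta>]
  have key: "SW g (\<lambda>a b. SW m (\<lambda>c d. \<beta> (\<lambda>w. \<phi> (a # c # S d # w @ Q b))))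
      = SW g (\<lambda>x r. SW (x \<odot> m) (\<lambda>c d. SW r (\<lambda>y b. \<beta> (\<lambda>w. \<phi> (c # S d # y # w @ Q b)))))" if "llin sc Q" for Q
  proof -
    have "SW g (\<lambda>a b. SW m (\<lambda>c d. \<beta> (\<lambda>w. \<phi> (a # c # S d # w @ Q b))))
        = SW g (\<lambda>a b. \<beta> (\<lambda>w. SW m (\<lambda>c d. \<phi> (a # c # S d # w @ Q b))))"
      by (simp add: SW_finop_swap[OF \<beta>])
    also have "\<dots> = SW g (\<lambda>a b. \<beta> (\<lambda>w. SW a (\<lambda>x y. SW (x \<odot> m) (\<lambda>c d. \<phi> (c # S d # y # w @ Q b)))))"
      using E_commute[OF \<phi>, of m "[]"] by simp
    also have "\<dots> = SW g (\<lambda>a b. SW a (\<lambda>x y. SW (x \<odot> m) (\<lambda>c d. \<beta> (\<lambda>w. \<phi> (c # S d # y # w @ Q b)))))"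
      by (simp add: SW_finop_swap[OF \<beta>])
    also have "\<dots> = SW g (\<lambda>x r. SW r (\<lambda>y b. SW (x \<odot> m) (\<lambda>c d. \<beta> (\<lambda>w. \<phi> (c # S d # y # w @ Q b)))))"
      by (rule SW_coassoc) (simp_all add: that)
    also have "\<dots> = SW g (\<lambda>x r. SW (x \<odot> m) (\<lambda>c d. SW r (\<lambda>y b. \<beta> (\<lambda>w. \<phi> (c # S d # y # w @ Q b)))))"
      by (intro SW_cong SW_swap)
    finally show ?thesis .
  qed
  show ?case
    unfolding f using key[of "\<lambda>b. [S b, k]"] key[of "\<lambda>b. [S b \<odot> k]"] C[OF pst_Cons[OF pst_Cons[OF \<phi>]]]
    by simp
qed

lemma A_S_mul:
  assumes \<alpha>: "\<alpha> \<in> A" and \<phi>: "PS \<phi>"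
  shows "SW g (\<lambda>a b. \<alpha> (\<lambda>u. \<phi> (a # u @ [S b, k]))) = SW g (\<lambda>a b. \<alpha> (\<lambda>u. \<phi> (a # u @ [S b \<odot> k])))"
proof -
  \<comment> \<open>Here \<open>\<beta>\<close> is the unit of the free algebra, for which the
    relation demanded of \<open>\<beta>\<close> is a defining one.\<close>
  have 1: "finop (\<lambda>\<phi>. 1 * \<phi> ([] :: 'h list) :: 'k)"
    by (rule finop_point)
  have "SW g (\<lambda>a b. 1 * \<psi> (a # [] @ [S b, k])) = SW g (\<lambda>a b. 1 * \<psi> (a # [] @ [S b \<odot> k]))" if "PS \<psi>" for \<psi> g k
    using pst_S_mul[OF that, of g "[]" k "[]"] by simp
  from A_S_mul_aux[OF \<alpha> 1 \<phi> this, of g k] show ?thesis by simp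
qed

text \<open>The counit as the convolution x_1 S(x_2). By induction for the shorter words the
  recursion yields a product beginning [h_1][S(h_2)][h_3 g_1], which the relations contract to
  [h_1][g_1]; then \<open>A_S_mul\<close> splits the final letter S(g_2) S(h_2).\<close>

lemma epl_eq:
  assumes "PS \<phi>"
  shows "epl w \<phi> = dw w (\<lambda>x y. \<phi> (x @ rev (map S y)))"
  using assms
proof (induction w arbitrary: \<phi> rule: length_induct)
  case (1 w \<phi>)
  note \<phi> = \<open>PS \<phi>\<close>
  note [simp] = pml_lin[OF pst_pml[OF \<phi>]]
  consider "w = []" | h where "w = [h]" | h g u where "w = h # g # u"
    by (metis list.exhaust)
  then show ?case
  proof cases
    case (3 h g u)
    define \<beta> where "\<beta> = epl u"
    have \<beta>A: "\<beta> \<in> A" unfolding \<beta>_def by (rule epl_A)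
    note \<beta> = Aop_finop[OF \<beta>A]
    note [simp] = lin_finop[OF \<beta>]
    have IHu: "dw u (\<lambda>x y. \<psi> (x @ rev (map S y))) = \<beta> \<psi>" if "PS \<psi>" for \<psi>
      using 1 3 that by (simp add: \<beta>_def)
    have IHb: "epl ((b \<odot> g) # u) \<psi> = SW (b \<odot> g) (\<lambda>e f. \<beta> (\<lambda>w. \<psi> (e # w @ [S f])))" if "PS \<psi>" for b \<psi>
    proof -
      have "epl ((b \<odot> g) # u) \<psi> = dw ((b \<odot> g) # u) (\<lambda>x y. \<psi> (x @ rev (map S y)))"
        using 1 3 that by simp
      also have "\<dots> = SW (b \<odot> g) (\<lambda>e f. \<beta> (\<lambda>w. \<psi> (e # w @ [S f])))"
        using IHu[OF pst_append_right[OF pst_Cons[OF that]]] by simp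
      finally show ?thesis .
    qed
    have "epl w \<phi> = SW h (\<lambda>a b. SW a (\<lambda>c d. SW b (\<lambda>b1 b2. SW g (\<lambda>g1 g2. \<beta> (\<lambda>w. \<phi> (c # S d # (b1 \<odot> g1) # w @ [S g2 \<odot> S b2]))))))"
      unfolding 3 by (simp add: IHb[OF pst_Cons[OF pst_Cons[OF \<phi>]]] SW_mul S_mul)
    also have "\<dots> = SW h (\<lambda>a b. SW b (\<lambda>b1 b2. SW a (\<lambda>c d. SW g (\<lambda>g1 g2. \<beta> (\<lambda>w. \<phi> (c # S d # (b1 \<odot> g1) # w @ [S g2 \<odot> S b2]))))))"
      by (intro SW_cong SW_swap)
    also have "\<dots> = SW3 h (\<lambda>c m b2. SW m (\<lambda>d b1. SW g (\<lambda>g1 g2. \<beta> (\<lambda>w. \<phi> (c # S d # (b1 \<odot> g1) # w @ [S g2 \<odot> S b2])))))"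
      by (simp add: legs)
    also have "\<dots> = SW3 h (\<lambda>c m b2. SW g (\<lambda>g1 g2. \<beta> (\<lambda>w. SW m (\<lambda>d b1. \<phi> (c # S d # (b1 \<odot> g1) # w @ [S g2 \<odot> S b2])))))"
      by (subst SW_swap) (simp add: SW_finop_swap[OF \<beta>])
    also have "\<dots> = SW3 h (\<lambda>c m b2. SW g (\<lambda>g1 g2. \<beta> (\<lambda>w. SW m (\<lambda>d b1. \<phi> (c # S d # b1 # g1 # w @ [S g2 \<odot> S b2])))))"
      using pst_S_mul'[OF \<phi>, of _ "[_]"] by simp
    also have "\<dots> = SW3 h (\<lambda>c m b2. SW m (\<lambda>d b1. SW g (\<lambda>g1 g2. \<beta> (\<lambda>w. \<phi> (c # S d # b1 # g1 # w @ [S g2 \<odot> S b2])))))"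
      by (subst SW_swap) (simp add: SW_finop_swap[OF \<beta>])
    also have "\<dots> = SW h (\<lambda>a b2. SW a (\<lambda>c r. SW r (\<lambda>d b1. SW g (\<lambda>g1 g2. \<beta> (\<lambda>w. \<phi> (c # S d # b1 # g1 # w @ [S g2 \<odot> S b2]))))))"
      by (simp add: legs)
    also have "\<dots> = SW h (\<lambda>a b2. SW g (\<lambda>g1 g2. \<beta> (\<lambda>w. \<phi> (a # g1 # w @ [S g2 \<odot> S b2]))))"
    proof (rule SW_cong)
      fix a b2
      have "PS (\<lambda>v. SW g (\<lambda>g1 g2. \<beta> (\<lambda>w. \<phi> (v @ g1 # w @ [S g2 \<odot> S b2]))))"
        by (intro pst_SW pst_finop[OF \<beta>] pst_append_right[OF \<phi>])
      from pst_triple[OF this, of "[]" a "[]"]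
      show "SW a (\<lambda>c r. SW r (\<lambda>d b1. SW g (\<lambda>g1 g2. \<beta> (\<lambda>w. \<phi> (c # S d # b1 # g1 # w @ [S g2 \<odot> S b2])))))
          = SW g (\<lambda>g1 g2. \<beta> (\<lambda>w. \<phi> (a # g1 # w @ [S g2 \<odot> S b2])))"
        by simp
    qed
    also have "\<dots> = SW h (\<lambda>a b2. SW g (\<lambda>g1 g2. \<beta> (\<lambda>w. \<phi> (a # g1 # w @ [S g2, S b2]))))"
      using A_S_mul[OF \<beta>A pst_Cons[OF \<phi>]] by simp
    also have "\<dots> = dw w (\<lambda>x y. \<phi> (x @ rev (map S y)))"
      unfolding 3 using IHu[OF pst_append_right[OF pst_Cons[OF pst_Cons[OF \<phi>]]]] by simp
    finally show ?thesis .
  qed simp_all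
qed

lemma epl_pst: "PS \<phi> \<Longrightarrow> PS (\<lambda>w. epl w \<phi>)"
  using pst_Delta_r[OF rbal_conv] by (simp add: epl_eq)

text \<open>Delta_r(a t(c) x) = a x_1 (x) t(c) x_2, and the antipode turns t(c) x_2 into S(x_2)
  c.\<close>

lemma epl_bimodule:
  assumes \<alpha>: "\<alpha> \<in> A" and \<gamma>: "\<gamma> \<in> A" and \<phi>: "PS \<phi>"
  shows "\<alpha> (\<lambda>u. \<gamma> (\<lambda>v. epl ((u @ rev (map T v)) @ w) \<phi>)) = \<alpha> (\<lambda>u. epl w (\<lambda>z. \<gamma> (\<lambda>v. \<phi> ((u @ z) @ v))))"
proof -
  let ?F = "\<lambda>x y. \<phi> (x @ rev (map S y))"
  note a = Aop_finop[OF \<alpha>] and c = Aop_finop[OF \<gamma>]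
  have "\<alpha> (\<lambda>u. \<gamma> (\<lambda>v. epl ((u @ rev (map T v)) @ w) \<phi>)) = \<gamma> (\<lambda>v. \<alpha> (\<lambda>u. dw (u @ rev (map T v) @ w) ?F))"
    by (simp add: epl_eq[OF \<phi>] finop_swap[OF a c])
  also have "\<dots> = \<gamma> (\<lambda>v. \<alpha> (\<lambda>u. dw (rev (map T v) @ w) (\<lambda>r s. ?F (u @ r) s)))"
    by (simp only: Delta_r_A_left[OF \<alpha> rbal_conv[OF \<phi>]])
  also have "\<dots> = \<alpha> (\<lambda>u. \<gamma> (\<lambda>v. dw (rev (map T v) @ w) (\<lambda>r s. ?F (u @ r) s)))"
    by (rule finop_swap[OF c a])
  also have "\<dots> = \<alpha> (\<lambda>u. \<gamma> (\<lambda>v. dw w (\<lambda>r s. ?F (u @ r) (rev (map T v) @ s))))"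
    by (simp only: Delta_r_tA_left[OF \<gamma> rbal_append_left[OF rbal_conv[OF \<phi>], of _ "[]", unfolded append_Nil]])
  also have "\<dots> = \<alpha> (\<lambda>u. dw w (\<lambda>r s. \<gamma> (\<lambda>v. \<phi> ((u @ r @ rev (map S s)) @ v))))"
    by (simp add: dsw_finop_swap[OF c])
  also have "\<dots> = \<alpha> (\<lambda>u. epl w (\<lambda>z. \<gamma> (\<lambda>v. \<phi> ((u @ z) @ v))))"
    by (simp add: epl_eq pst_finop[OF c] pst_shift[OF \<phi>])
  finally show ?thesis .
qed

text \<open>Peel off a letter h: the counit of the remaining word stands between [h_1] and
  [S(h_2)][h_3]. It commutes with the latter, an E~, so the three letters meet and contract to
  [h].\<close>

lemma epl_counit:
  assumes "PS \<phi>"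
  shows "dw w (\<lambda>u v. epl u (\<lambda>z. \<phi> (z @ v))) = \<phi> w"
  using assms
proof (induction w arbitrary: \<phi>)
  case (Cons h w)
  note \<phi> = \<open>PS \<phi>\<close>
  note [simp] = pml_lin[OF pst_pml[OF \<phi>]] lin_finop[OF Aop_finop[OF epl_A]]
  have el: "epl (a # u) (\<lambda>z. \<phi> (z @ b # v)) = SW a (\<lambda>c d. epl u (\<lambda>z. \<phi> (c # z @ S d # b # v)))" for a b u v
    using epl_eq[OF pst_append_right[OF \<phi>, of "b # v"]]
      epl_eq[OF pst_append_right[OF pst_Cons[OF \<phi>], where v = "S _ # b # v"]] by simp
  have "dw (h # w) (\<lambda>u v. epl u (\<lambda>z. \<phi> (z @ v)))
      = dw w (\<lambda>u v. SW h (\<lambda>a b. SW a (\<lambda>c d. epl u (\<lambda>z. \<phi> (c # z @ S d # b # v)))))"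
    by (simp add: el SW_dsw_swap)
  also have "\<dots> = dw w (\<lambda>u v. SW h (\<lambda>c r. SW r (\<lambda>d b. epl u (\<lambda>z. \<phi> (c # z @ S d # b # v)))))"
    by (subst SW_coassoc) simp_all
  also have "\<dots> = dw w (\<lambda>u v. SW h (\<lambda>c r. SW r (\<lambda>d b. epl u (\<lambda>z. \<phi> (c # S d # b # z @ v)))))"
  proof (rule dsw_cong, rule SW_cong)
    fix u v c r
    note fin = Aop_finop[OF epl_A[of u]]
    from commD[OF A_B_comm[OF epl_A[of u] B_gen[of r]] pst_append_right[OF pst_Cons[OF \<phi>, of c], of v]]
    show "SW r (\<lambda>d b. epl u (\<lambda>z. \<phi> (c # z @ S d # b # v))) = SW r (\<lambda>d b. epl u (\<lambda>z. \<phi> (c # S d # b # z @ v)))"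
      by (simp add: SW_finop_swap[OF fin])
  qed
  also have "\<dots> = dw w (\<lambda>u v. epl u (\<lambda>z. \<phi> (h # z @ v)))"
    using pst_triple[OF \<phi>, of "[]" h] by (simp add: SW_finop_swap[OF Aop_finop[OF epl_A]])
  also have "\<dots> = \<phi> (h # w)"
    by (rule Cons.IH[OF pst_Cons[OF \<phi>]])
  finally show ?case .
qed simp

text \<open>t applied to the counit is the counit of H^cop with antipode T, so this is
  \<open>epl_counit\<close> there.\<close>

lemma epl_counit_T:
  assumes \<phi>: "PS \<phi>"
  shows "dw w (\<lambda>u v. epl v (\<lambda>z. \<phi> (rev (map T z) @ u))) = \<phi> w"
proof -
  have "epl v (\<lambda>z. \<phi> (rev (map T z) @ u)) = dw v (\<lambda>x y. \<phi> (y @ rev (map T x) @ u))" for u v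
    using epl_eq[OF pst_antipode_T[OF pst_append_right[OF \<phi>, of u]], of v]
    by simp
  moreover have "el mul (\<lambda>h F. SW h (\<lambda>a b. F b a)) T v (\<lambda>z. \<phi> (z @ u)) = dw v (\<lambda>x y. \<phi> (y @ rev (map T x) @ u))" for u v
    using phopf.epl_eq[OF cop pst_cop[OF pst_append_right[OF \<phi>, of u]], of v] by (simp add: dsw_cop)
  ultimately show ?thesis
    using phopf.epl_counit[OF cop pst_cop[OF \<phi>], of w] by (simp add: dsw_cop)
qed

text \<open>An element z of A satisfies Delta_r(z) = z (x) 1 and Delta_r(t(z)) = 1 (x) t(z). Under
  convolution both put z between x_1 and S(x_2), where the counit of y belongs.\<close>

lemma epl_mul:
  assumes \<phi>: "PS \<phi>"
  shows "epl (x @ y) \<phi> = epl y (\<lambda>z. epl (x @ z) \<phi>)"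
    and "epl (x @ y) \<phi> = epl y (\<lambda>z. epl (x @ rev (map T z)) \<phi>)"
proof -
  let ?F = "\<lambda>x y. \<phi> (x @ rev (map S y))"
  note F = rbal_append_left[OF rbal_conv[OF \<phi>]] and fin = Aop_finop[OF epl_A[of y]]
  have y: "epl y (\<lambda>z. \<phi> (p @ z @ rev (map S q))) = dw y (\<lambda>r s. ?F (p @ r) (q @ s))" for p q
    using epl_eq[OF pst_shift[OF \<phi>]] by simp
  have "epl y (\<lambda>z. epl (x @ z) \<phi>) = dw x (\<lambda>p q. epl y (\<lambda>z. dw z (\<lambda>r s. ?F (p @ r) (q @ s))))"
    by (simp only: epl_eq[OF \<phi>] dsw_append dsw_finop_swap[OF fin])
  also have "\<dots> = dw x (\<lambda>p q. epl y (\<lambda>z. ?F (p @ z) (q @ [])))"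
    by (simp only: Delta_r_A[OF epl_A F])
  also have "\<dots> = epl (x @ y) \<phi>"
    by (simp add: y epl_eq[OF \<phi>] dsw_append)
  finally show "epl (x @ y) \<phi> = epl y (\<lambda>z. epl (x @ z) \<phi>)" ..
  have "epl y (\<lambda>z. epl (x @ rev (map T z)) \<phi>) = dw x (\<lambda>p q. epl y (\<lambda>z. dw (rev (map T z)) (\<lambda>r s. ?F (p @ r) (q @ s))))"
    by (simp only: epl_eq[OF \<phi>] dsw_append dsw_finop_swap[OF fin])
  also have "\<dots> = dw x (\<lambda>p q. epl y (\<lambda>z. ?F (p @ []) (q @ rev (map T z))))"
    by (simp only: Delta_r_tA[OF epl_A F])
  also have "\<dots> = epl (x @ y) \<phi>"
    by (simp add: y epl_eq[OF \<phi>] dsw_append)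
  finally show "epl (x @ y) \<phi> = epl y (\<lambda>z. epl (x @ rev (map T z)) \<phi>)" ..
qed

text \<open>On the image of t, which is A, Delta_r(a) = a (x) 1 makes the counit the identity. On
  the other base algebra Delta_r(b) = 1 (x) b makes it the antipode, which t undoes.\<close>

lemma epl_tB:
  assumes \<beta>: "\<beta> \<in> B" and \<phi>: "PS \<phi>"
  shows "\<beta> (\<lambda>v. epl (rev (map T v)) \<phi>) = \<beta> (\<lambda>v. \<phi> (rev (map T v)))"
    and "\<beta> (\<lambda>v. epl v (\<lambda>z. \<phi> (rev (map T z)))) = \<beta> \<phi>"
proof -
  obtain \<alpha> where \<alpha>: "\<alpha> \<in> A" "\<And>\<phi>. pml sc \<phi> \<Longrightarrow> \<alpha> \<phi> = \<beta> (\<lambda>w. \<phi> (rev (map T w)))"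
    using B_T_A[OF \<beta>] by blast
  from Delta_r_A[OF \<alpha>(1) rbal_conv[OF \<phi>]]
  show "\<beta> (\<lambda>v. epl (rev (map T v)) \<phi>) = \<beta> (\<lambda>v. \<phi> (rev (map T v)))"
    by (simp add: epl_eq[OF \<phi>, symmetric] \<alpha>(2)[OF pst_pml[OF epl_pst[OF \<phi>]]] \<alpha>(2)[OF pst_pml[OF \<phi>]])
  show "\<beta> (\<lambda>v. epl v (\<lambda>z. \<phi> (rev (map T z)))) = \<beta> \<phi>"
    using Delta_r_B[OF \<beta> rbal_conv[OF pst_antipode_T[OF \<phi>]]]
    by (simp add: epl_eq[OF pst_antipode_T[OF \<phi>]])
qed

end

section \<open>The right-handed statements\<close>

context phopf
begin

definition epr where
  "epr w \<phi> = el (\<lambda>x y. mul y x) (\<lambda>h F. SW h (\<lambda>a b. F b a)) S (rev w) (\<lambda>w. \<phi> (rev w))"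

lemma Aop_rev': "\<alpha> \<in> A \<Longrightarrow> (\<lambda>\<phi>. \<alpha> (\<lambda>w. \<phi> (rev w))) \<in> Bop (\<lambda>h F. SW h (\<lambda>a b. F b a)) S"
  using sweedler.Aop_rev[OF sweedler_op[OF sweedler_cop[OF sweedler_axioms]], of \<alpha> S] by simp

lemma B_tB_comm:
  assumes "\<alpha> \<in> B" "\<gamma> \<in> B" "PS \<phi>"
  shows "\<alpha> (\<lambda>u. \<gamma> (\<lambda>v. \<phi> (u @ rev (map T v)))) = \<alpha> (\<lambda>u. \<gamma> (\<lambda>v. \<phi> (rev (map T v) @ u)))"
  using phopf.A_tA_comm[OF opcop Bop_rev[OF assms(1)] Bop_rev[OF assms(2)] pst_rev[OF assms(3)]]
  by (simp add: rev_map)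

lemma Delta_r_bimodule:
  assumes "\<alpha> \<in> B" "\<gamma> \<in> B" "RBAL F"
  shows "\<alpha> (\<lambda>u. \<gamma> (\<lambda>v. dw (w @ rev (map T v) @ u) F))
       = \<alpha> (\<lambda>u. \<gamma> (\<lambda>v. dw w (\<lambda>r s. F (r @ rev (map T v)) (s @ u))))"
proof -
  have eq: "(rev u @ rev (map T (rev v))) @ rev w = rev (w @ rev (map T v) @ u)" for u v
    by (simp add: rev_map)
  from phopf.Delta_bimodule[OF opcop Bop_rev[OF assms(1)] Bop_rev[OF assms(2)] rbal_opcop[OF assms(3)],
      of "rev w", unfolded eq dsw_opcop]
  show ?thesis by (simp add: dsw_cop dsw_rev rev_map)
qed

lemma Takeuchi_r:
  assumes "\<alpha> \<in> B" "RBAL F"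
  shows "\<alpha> (\<lambda>u. dw w (\<lambda>p q. F (u @ p) q)) = \<alpha> (\<lambda>u. dw w (\<lambda>p q. F p (rev (map T u) @ q)))"
  using phopf.Takeuchi[OF opcop Bop_rev[OF assms(1)] rbal_opcop[OF assms(2)], of "rev w"]
  by (simp add: dsw_cop dsw_rev rev_map)

lemma epr_B: "epr w \<in> B"
  unfolding epr_def using Aop_rev[OF phopf.epl_A[OF opcop, of "rev w"]] by simp

lemma epr_pst: "PS \<phi> \<Longrightarrow> PS (\<lambda>w. epr w \<phi>)"
  unfolding epr_def by (rule pst_unrev[OF phopf.epl_pst[OF opcop pst_rev]])

lemma epr_eq:
  assumes "PS \<phi>"
  shows "epr w \<phi> = dw w (\<lambda>x y. \<phi> (rev (map S x) @ y))"
  unfolding epr_def using phopf.epl_eq[OF opcop pst_rev[OF assms], of "rev w"]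
  by (simp add: dsw_cop dsw_rev rev_map)

lemma epr_bimodule:
  assumes "\<alpha> \<in> B" "\<gamma> \<in> B" "PS \<phi>"
  shows "\<alpha> (\<lambda>u. \<gamma> (\<lambda>v. epr (w @ rev (map T v) @ u) \<phi>)) = \<alpha> (\<lambda>u. epr w (\<lambda>z. \<gamma> (\<lambda>v. \<phi> (v @ z @ u))))"
  using phopf.epl_bimodule[OF opcop Bop_rev[OF assms(1)] Bop_rev[OF assms(2)] pst_rev[OF assms(3)], of "rev w"]
  by (simp add: epr_def rev_map)

lemma epr_counit:
  assumes "PS \<phi>"
  shows "dw w (\<lambda>u v. epr v (\<lambda>z. \<phi> (u @ z))) = \<phi> w"
  using phopf.epl_counit[OF opcop pst_rev[OF assms], of "rev w"]
  by (simp add: epr_def dsw_cop dsw_rev)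

lemma epr_counit_T:
  assumes "PS \<phi>"
  shows "dw w (\<lambda>u v. epr u (\<lambda>z. \<phi> (v @ rev (map T z)))) = \<phi> w"
  using phopf.epl_counit_T[OF opcop pst_rev[OF assms], of "rev w"]
  by (simp add: epr_def dsw_cop dsw_rev rev_map)

lemma epr_mul:
  assumes "PS \<phi>"
  shows "epr (x @ y) \<phi> = epr x (\<lambda>z. epr (z @ y) \<phi>)"
    and "epr (x @ y) \<phi> = epr x (\<lambda>z. epr (rev (map T z) @ y) \<phi>)"
  using phopf.epl_mul[OF opcop pst_rev[OF assms], of "rev y" "rev x"]
  by (simp_all add: epr_def rev_map)

lemma epr_tA:
  assumes "\<alpha> \<in> A" "PS \<phi>"
  shows "\<alpha> (\<lambda>v. epr (rev (map T v)) \<phi>) = \<alpha> (\<lambda>v. \<phi> (rev (map T v)))"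
    and "\<alpha> (\<lambda>v. epr v (\<lambda>z. \<phi> (rev (map T z)))) = \<alpha> \<phi>"
  using phopf.epl_tB[OF opcop Aop_rev'[OF assms(1)] pst_rev[OF assms(2)]]
  by (simp_all add: epr_def rev_map)

end

section \<open>Separation by functionals\<close>

lemma separating_functional:
  fixes s :: "'k::field \<Rightarrow> 'v::ab_group_add \<Rightarrow> 'v"
  assumes "vector_space s" and I: "module.subspace s I" and x: "x \<notin> I"
  shows "\<exists>f. (\<forall>a b. f (a + b) = f a + f b) \<and> (\<forall>c a. f (s c a) = c * f a) \<and> (\<forall>y\<in>I. f y = 0) \<and> f x \<noteq> (0::'k)"
proof -
  interpret vector_space s by fact
  interpret k: vector_space "(*) :: 'k \<Rightarrow> 'k \<Rightarrow> 'k"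
    by unfold_locales (simp_all add: algebra_simps)
  interpret vector_space_pair s "(*) :: 'k \<Rightarrow> 'k \<Rightarrow> 'k" ..
  obtain B where B: "B \<subseteq> I" "independent B" "I \<subseteq> span B"
    using maximal_independent_subset[of I] by blast
  have "span B \<subseteq> I" using B(1) I by (rule span_minimal)
  with x have xB: "x \<notin> span B" by blast
  then have "independent (insert x B)"
    using B(2) by (rule independent_insertI)
  then obtain f where f: "Vector_Spaces.linear s (*) f" "\<forall>y\<in>insert x B. f y = (if y = x then 1 else 0)"
    using linear_independent_extend[of "insert x B" "\<lambda>y. if y = x then 1 else 0"] by blast
  interpret f: Vector_Spaces.linear s "(*)" f by fact
  have "x \<notin> B" using xB span_base by blast
  then have "\<And>y. y \<in> B \<Longrightarrow> f y = 0" using f(2) by auto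
  then have "\<forall>y\<in>I. f y = 0"
    using B(3) linear_eq_0_on_span[OF f(1)] by blast
  moreover have "f x \<noteq> 0" using f(2) by simp
  ultimately show ?thesis
    using f.add f.scale by blast
qed

lemma vector_space_fsc: "vector_space (fsc :: 'k::field \<Rightarrow> ('x \<Rightarrow>\<^sub>0 'k) \<Rightarrow> _)"
proof -
  have l: "Poly_Mapping.lookup (fsc c p) u = c * Poly_Mapping.lookup p u" for c :: 'k and p :: "'x \<Rightarrow>\<^sub>0 'k" and u
    by (simp add: fsc_def map.rep_eq when_def)
  show ?thesis
    by unfold_locales (auto intro!: poly_mapping_eqI simp: l lookup_add algebra_simps)
qed

lemma single_fsc: "Poly_Mapping.single u c = fsc c (Poly_Mapping.single u (1::'k::field))"
  by (simp add: fsc_def)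

text \<open>A functional on formal combinations is \<open>ev\<close> of its values on the basis, so
  the separating one has this form. Only closure properties of \<open>I\<close> are assumed, to
  cover both \<open>lspan\<close> and \<open>fideal\<close>.\<close>

lemma ev_separation:
  fixes I :: "('x \<Rightarrow>\<^sub>0 'k::field) set"
  assumes "0 \<in> I" "\<And>x y. x \<in> I \<Longrightarrow> y \<in> I \<Longrightarrow> x + y \<in> I" "\<And>c x. x \<in> I \<Longrightarrow> fsc c x \<in> I"
    and "\<And>f. (\<And>y. y \<in> I \<Longrightarrow> ev f y = 0) \<Longrightarrow> ev f x = 0"
  shows "x \<in> I"
proof (rule ccontr)
  assume x: "x \<notin> I"
  interpret vector_space "fsc :: 'k \<Rightarrow> ('x \<Rightarrow>\<^sub>0 'k) \<Rightarrow> _" by (rule vector_space_fsc)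
  have "subspace I" using assms(1-3) by (simp add: subspace_def)
  from separating_functional[OF vector_space_fsc this x]
  obtain f :: "('x \<Rightarrow>\<^sub>0 'k) \<Rightarrow> 'k" where f: "\<And>a b. f (a + b) = f a + f b" "\<And>c a. f (fsc c a) = c * f a"
    "\<And>y. y \<in> I \<Longrightarrow> f y = 0" "f x \<noteq> 0" by blast
  have f0: "f 0 = 0" using f(2)[of 0 0] by simp
  have fsum: "f (\<Sum>i\<in>K. p i) = (\<Sum>i\<in>K. f (p i))" for K and p :: "'x \<Rightarrow> _"
    by (induction K rule: infinite_finite_induct) (auto simp: f0 f(1))
  have fev: "ev (\<lambda>u. f (Poly_Mapping.single u 1)) p = f p" for p
  proof -
    have "p = (\<Sum>u\<in>Poly_Mapping.keys p. Poly_Mapping.single u (Poly_Mapping.lookup p u))"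
      by (rule poly_mapping_eqI) (auto simp: lookup_sum lookup_single when_def in_keys_iff)
    then have "f p = (\<Sum>u\<in>Poly_Mapping.keys p. f (Poly_Mapping.single u (Poly_Mapping.lookup p u)))"
      using fsum by metis
    also have "\<dots> = ev (\<lambda>u. f (Poly_Mapping.single u 1)) p"
      unfolding ev_def by (intro sum.cong refl, subst single_fsc) (rule f(2))
    finally show ?thesis ..
  qed
  have "ev (\<lambda>u. f (Poly_Mapping.single u 1)) x = 0"
    by (rule assms(4)) (simp only: fev f(3))
  with f(4) show False by (simp only: fev)
qed

lemma lspan_separation:
  assumes "\<And>f. (\<And>g. g \<in> G \<Longrightarrow> ev f g = 0) \<Longrightarrow> ev f x = 0"
  shows "x \<in> lspan G"
proof (rule ev_separation)
  fix f assume "\<And>y. y \<in> lspan G \<Longrightarrow> ev f y = 0"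
  then show "ev f x = 0" using assms lspan_gen by blast
qed (auto intro: lspan.intros)

section \<open>Evaluation of the concrete operations\<close>

lemma ev_cong: "(\<And>u. u \<in> Poly_Mapping.keys p \<Longrightarrow> f u = g u) \<Longrightarrow> ev f p = ev g p"
  unfolding ev_def by (auto intro: sum.cong)

lemma ev_minus_fun: "ev (\<lambda>x. f x - g x) p = ev f p - ev g p"
  by (simp add: ev_def right_diff_distrib sum_subtractf)

lemma ev_wd [simp]: "ev f (wd u) = f u"
  by (simp add: wd_def)

lemma ev_fone [simp]: "ev f fone = f []"
  by (simp add: fone_def)

lemma ev_fsw [simp]: "ev f (fsw D g) = ev (\<lambda>xs. ev f (g xs)) D"
  unfolding fsw_def ev_sum ev_fsc by (simp add: ev_def)

lemma ev_kcontr: "kcontr f X = ev f X"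
  by (simp add: kcontr_def ev_def)

lemma ev_splice [simp]: "ev f (splice i g X) = ev (\<lambda>xs. ev (\<lambda>ys. f (take i xs @ ys @ drop (Suc i) xs)) (g (xs ! i))) X"
  unfolding splice_def ev_sum ev_single by (simp add: ev_def sum_distrib_left mult.assoc)

lemma ev_tmul [simp]: "ev f (tmul m X Y) = ev (\<lambda>xs. ev (\<lambda>ys. f (map2 m xs ys)) Y) X"
  unfolding tmul_def ev_sum ev_single by (simp add: ev_def sum_distrib_left mult.assoc)

lemma ev_tcons [simp]: "ev f (tcons a X) = ev (\<lambda>xs. f (a # xs)) X"
  unfolding tcons_def ev_sum ev_single by (simp add: ev_def)

lemma ev_tsnoc [simp]: "ev f (tsnoc X a) = ev (\<lambda>xs. f (xs @ [a])) X"
  unfolding tsnoc_def ev_sum ev_single by (simp add: ev_def)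

lemma ev_fmul [simp]: "ev f (fmul p q) = ev (\<lambda>u. ev (\<lambda>v. f (u @ v)) q) p"
  unfolding fmul_def ev_sum ev_single by (simp add: ev_def sum_distrib_left mult.assoc)

lemma ev_antiw [simp]: "ev f (antiw g p) = ev (\<lambda>u. f (rev (map g u))) p"
  unfolding antiw_def ev_sum ev_single by (simp add: ev_def)

lemma ev_DeltaP [simp]: "ev f (DeltaP \<Delta> p) = ev (\<lambda>u. ev f (dword \<Delta> u)) p"
  unfolding DeltaP_def ev_sum ev_fsc by (simp add: ev_def)

lemma ev_EpsL [simp]: "ev f (EpsL \<Delta> S p) = ev (\<lambda>u. ev f (epsl \<Delta> S u)) p"
  unfolding EpsL_def ev_sum ev_fsc by (simp add: ev_def)

lemma ev_EpsR [simp]: "ev f (EpsR \<Delta> S p) = ev (\<lambda>u. ev f (epsr_rev \<Delta> S (rev u))) p"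
  unfolding EpsR_def ev_sum ev_fsc by (simp add: ev_def)

lemma ev_ttens_Nil [simp]: "ev f (ttens []) = f []"
  by simp

lemma ev_ttens_Cons [simp]: "ev f (ttens (p # ps)) = ev (\<lambda>u. ev (\<lambda>ws. f (u # ws)) (ttens ps)) p"
  unfolding ttens.simps ev_sum ev_single by (simp add: ev_def sum_distrib_left mult.assoc)

declare ttens.simps [simp del]

lemma ev_slotl [simp]: "ev f (slotl i p X) = ev (\<lambda>ws. ev (\<lambda>u. f (ws[i := u @ ws ! i])) p) X"
  unfolding slotl_def ev_sum ev_single by (simp add: ev_def sum_distrib_left ac_simps)

lemma ev_slotr [simp]: "ev f (slotr i p X) = ev (\<lambda>ws. ev (\<lambda>u. f (ws[i := ws ! i @ u])) p) X"
  unfolding slotr_def ev_sum ev_single by (simp add: ev_def sum_distrib_left ac_simps)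

lemma ev_tcontr [simp]: "ev \<phi> (tcontr f X) = ev (\<lambda>ws. ev \<phi> (f (ws ! 0) (ws ! 1))) X"
  unfolding tcontr_def ev_sum ev_fsc by (simp add: ev_def)

lemma ev_Ep [simp]: "ev f (Ep \<Delta> S h) = ev (\<lambda>xs. f [xs ! 0, S (xs ! 1)]) (\<Delta> h)"
  by (simp add: Ep_def)

lemma ev_Et [simp]: "ev f (Et \<Delta> S h) = ev (\<lambda>xs. f [S (xs ! 0), xs ! 1]) (\<Delta> h)"
  by (simp add: Et_def)

section \<open>The concrete weak Hopf algebra\<close>

text \<open>The value 0 on lists of other lengths makes this linear in each letter on words of every
  length, as \<open>pml\<close> demands.\<close>

definition fn2 :: "('h \<Rightarrow> 'h \<Rightarrow> 'k) \<Rightarrow> 'h list \<Rightarrow> 'k::field" where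
  "fn2 F xs = (case xs of [a, b] \<Rightarrow> F a b | _ \<Rightarrow> 0)"
definition fn3 :: "('h \<Rightarrow> 'h \<Rightarrow> 'h \<Rightarrow> 'k) \<Rightarrow> 'h list \<Rightarrow> 'k::field" where
  "fn3 F xs = (case xs of [a, b, c] \<Rightarrow> F a b c | _ \<Rightarrow> 0)"

lemma fn2 [simp]: "fn2 F [a, b] = F a b"
  by (simp add: fn2_def)
lemma fn3 [simp]: "fn3 F [a, b, c] = F a b c"
  by (simp add: fn3_def)

lemma lin_zero: "lin sc (\<lambda>x. 0)"
  by (simp add: lin_def)

lemma pml_fn2:
  fixes sc :: "'k::field \<Rightarrow> 'h::ab_group_add \<Rightarrow> 'h"
  assumes "\<And>b. lin sc (\<lambda>a. F a b)" "\<And>a. lin sc (\<lambda>b. F a b)"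
  shows "pml sc (fn2 F)"
  unfolding pml_def
proof (intro allI)
  fix u v :: "'h list"
  consider b where "u = []" "v = [b]" | a where "u = [a]" "v = []" | "length u + length v \<noteq> 1"
    by (cases u; cases v) auto
  then show "lin sc (\<lambda>x. fn2 F (u @ x # v))"
  proof cases
    case 3
    then have "fn2 F (u @ x # v) = 0" for x
      by (auto simp: fn2_def Cons_eq_append_conv append_eq_Cons_conv split: list.split)
    then show ?thesis by (simp add: lin_zero)
  qed (simp_all add: assms)
qed

lemma pml_fn3:
  fixes sc :: "'k::field \<Rightarrow> 'h::ab_group_add \<Rightarrow> 'h"
  assumes "\<And>b c. lin sc (\<lambda>a. F a b c)" "\<And>a c. lin sc (\<lambda>b. F a b c)" "\<And>a b. lin sc (\<lambda>c. F a b c)"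
  shows "pml sc (fn3 F)"
  unfolding pml_def
proof (intro allI)
  fix u v :: "'h list"
  consider b c where "u = []" "v = [b, c]" | a c where "u = [a]" "v = [c]" | a b where "u = [a, b]" "v = []"
    | "length u + length v \<noteq> 2"
    by (cases u; cases v; cases "tl u"; cases "tl v") auto
  then show "lin sc (\<lambda>x. fn3 F (u @ x # v))"
  proof cases
    case 4
    then have "fn3 F (u @ x # v) = 0" for x
      by (auto simp: fn3_def Cons_eq_append_conv append_eq_Cons_conv split: list.split)
    then show ?thesis by (simp add: lin_zero)
  qed (simp_all add: assms)
qed

lemma htens_eq_ev:
  assumes "htens_eq sc X Y" "pml sc f"
  shows "ev f X = ev f Y"
proof -
  have "ev f z = 0" if "z \<in> lspan (mlin_gens sc)" for z
    using that
  proof induction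
    case (lspan_gen g)
    then show ?case
      using assms(2) unfolding mlin_gens_def pml_def lin_def by auto
  qed simp_all
  from this[of "X - Y"] assms(1) show ?thesis by (simp add: htens_eq_def)
qed

lemma lin_at_zero: "lin sc f \<Longrightarrow> f 0 = 0"
proof -
  assume "lin sc f"
  then have "f (0 + 0) = f 0 + f 0" unfolding lin_def by blast
  then show ?thesis by (metis add.right_neutral add_left_cancel)
qed

lemma lin_sum: "lin sc f \<Longrightarrow> f (\<Sum>i\<in>K. g i) = (\<Sum>i\<in>K. f (g i))"
  by (induction K rule: infinite_finite_induct) (auto simp: lin_at_zero, simp add: lin_def)

lemma lin_hcontr: "lin sc f \<Longrightarrow> f (hcontr sc g X) = ev (\<lambda>xs. f (g xs)) X"
  unfolding hcontr_def ev_def by (subst lin_sum[of sc]) (simp_all add: lin_def)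

lemma subalg_galg:
  assumes "a \<in> subalg G" "\<And>g. g \<in> G \<Longrightarrow> (\<lambda>\<phi>. ev \<phi> g) \<in> galg G'"
  shows "(\<lambda>\<phi>. ev \<phi> a) \<in> galg G'"
  using assms(1) by induction (auto intro: galg.intros assms(2))

lemma galg_subalg:
  assumes "\<alpha> \<in> galg G'" "\<And>g. g \<in> G' \<Longrightarrow> \<exists>a\<in>G. \<forall>\<phi>. ev \<phi> a = g \<phi>"
  shows "\<exists>a\<in>subalg G. \<forall>\<phi>. ev \<phi> a = \<alpha> \<phi>"
  using assms(1)
proof induction
  case (galg_unit c)
  show ?case by (rule bexI[OF _ subalg_scalar[of c]]) simp
next
  case (galg_gen g)
  then show ?case using assms(2) subalg_gen by blast
next
  case (galg_add \<alpha> \<beta>)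
  then obtain a b where "a \<in> subalg G" "\<forall>\<phi>. ev \<phi> a = \<alpha> \<phi>" "b \<in> subalg G" "\<forall>\<phi>. ev \<phi> b = \<beta> \<phi>" by blast
  then show ?case by (intro bexI[OF _ subalg_add[of a _ b]]) simp_all
next
  case (galg_mul \<alpha> \<beta>)
  then obtain a b where "a \<in> subalg G" "\<forall>\<phi>. ev \<phi> a = \<alpha> \<phi>" "b \<in> subalg G" "\<forall>\<phi>. ev \<phi> b = \<beta> \<phi>" by blast
  then show ?case by (intro bexI[OF _ subalg_mul[of a _ b]]) simp_all
qed

locale weak_hopf_algebra =
  fixes sc :: "'k::field \<Rightarrow> 'h::ring_1 \<Rightarrow> 'h"
    and \<Delta> :: "'h \<Rightarrow> ('h list \<Rightarrow>\<^sub>0 'k)"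
    and \<epsilon> :: "'h \<Rightarrow> 'k"
    and S :: "'h \<Rightarrow> 'h"
  assumes wh: "weak_hopf sc \<Delta> \<epsilon> S" and bij: "bij S"
begin

definition SW :: "'h \<Rightarrow> ('h \<Rightarrow> 'h \<Rightarrow> 'k) \<Rightarrow> 'k" where
  "SW h F = ev (\<lambda>xs. F (xs ! 0) (xs ! 1)) (\<Delta> h)"

lemmas weak_hopf_axioms = wh[unfolded weak_hopf_def]
lemmas kalg = weak_hopf_axioms[THEN conjunct1, rule_format]
lemmas len = weak_hopf_axioms[THEN conjunct2, THEN conjunct1, rule_format]
lemmas Delta_add = weak_hopf_axioms[THEN conjunct2, THEN conjunct2, THEN conjunct1, rule_format]
lemmas Delta_sc = weak_hopf_axioms[THEN conjunct2, THEN conjunct2, THEN conjunct2, THEN conjunct1, rule_format]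
lemmas eps_add = weak_hopf_axioms[THEN conjunct2, THEN conjunct2, THEN conjunct2, THEN conjunct2, THEN conjunct1, rule_format]
lemmas eps_sc = weak_hopf_axioms[THEN conjunct2, THEN conjunct2, THEN conjunct2, THEN conjunct2, THEN conjunct2, THEN conjunct1, rule_format]
lemmas S_add = weak_hopf_axioms[THEN conjunct2, THEN conjunct2, THEN conjunct2, THEN conjunct2, THEN conjunct2, THEN conjunct2, THEN conjunct1, rule_format]
lemmas S_sc = weak_hopf_axioms[THEN conjunct2, THEN conjunct2, THEN conjunct2, THEN conjunct2, THEN conjunct2, THEN conjunct2, THEN conjunct2, THEN conjunct1, rule_format]
lemmas Delta_coassoc = weak_hopf_axioms[THEN conjunct2, THEN conjunct2, THEN conjunct2, THEN conjunct2, THEN conjunct2, THEN conjunct2, THEN conjunct2, THEN conjunct2, THEN conjunct1, rule_format]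
lemmas counit_left = weak_hopf_axioms[THEN conjunct2, THEN conjunct2, THEN conjunct2, THEN conjunct2, THEN conjunct2, THEN conjunct2, THEN conjunct2, THEN conjunct2, THEN conjunct2, THEN conjunct1, rule_format]
lemmas counit_right = weak_hopf_axioms[THEN conjunct2, THEN conjunct2, THEN conjunct2, THEN conjunct2, THEN conjunct2, THEN conjunct2, THEN conjunct2, THEN conjunct2, THEN conjunct2, THEN conjunct2, THEN conjunct1, rule_format]
lemmas Delta_mul = weak_hopf_axioms[THEN conjunct2, THEN conjunct2, THEN conjunct2, THEN conjunct2, THEN conjunct2, THEN conjunct2, THEN conjunct2, THEN conjunct2, THEN conjunct2, THEN conjunct2, THEN conjunct2, THEN conjunct1, rule_format]
lemmas eps_mul = weak_hopf_axioms[THEN conjunct2, THEN conjunct2, THEN conjunct2, THEN conjunct2, THEN conjunct2, THEN conjunct2, THEN conjunct2, THEN conjunct2, THEN conjunct2, THEN conjunct2, THEN conjunct2, THEN conjunct2, THEN conjunct1, rule_format]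
lemmas eps_mul_flip = weak_hopf_axioms[THEN conjunct2, THEN conjunct2, THEN conjunct2, THEN conjunct2, THEN conjunct2, THEN conjunct2, THEN conjunct2, THEN conjunct2, THEN conjunct2, THEN conjunct2, THEN conjunct2, THEN conjunct2, THEN conjunct2, THEN conjunct1, rule_format]
lemmas Delta_unit = weak_hopf_axioms[THEN conjunct2, THEN conjunct2, THEN conjunct2, THEN conjunct2, THEN conjunct2, THEN conjunct2, THEN conjunct2, THEN conjunct2, THEN conjunct2, THEN conjunct2, THEN conjunct2, THEN conjunct2, THEN conjunct2, THEN conjunct2, THEN conjunct1, rule_format]
lemmas Delta_unit_flip = weak_hopf_axioms[THEN conjunct2, THEN conjunct2, THEN conjunct2, THEN conjunct2, THEN conjunct2, THEN conjunct2, THEN conjunct2, THEN conjunct2, THEN conjunct2, THEN conjunct2, THEN conjunct2, THEN conjunct2, THEN conjunct2, THEN conjunct2, THEN conjunct2, THEN conjunct1, rule_format]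
lemmas S_target = weak_hopf_axioms[THEN conjunct2, THEN conjunct2, THEN conjunct2, THEN conjunct2, THEN conjunct2, THEN conjunct2, THEN conjunct2, THEN conjunct2, THEN conjunct2, THEN conjunct2, THEN conjunct2, THEN conjunct2, THEN conjunct2, THEN conjunct2, THEN conjunct2, THEN conjunct2, THEN conjunct1, rule_format]
lemmas S_source = weak_hopf_axioms[THEN conjunct2, THEN conjunct2, THEN conjunct2, THEN conjunct2, THEN conjunct2, THEN conjunct2, THEN conjunct2, THEN conjunct2, THEN conjunct2, THEN conjunct2, THEN conjunct2, THEN conjunct2, THEN conjunct2, THEN conjunct2, THEN conjunct2, THEN conjunct2, THEN conjunct2, THEN conjunct1, rule_format]
lemmas S_triple = weak_hopf_axioms[THEN conjunct2, THEN conjunct2, THEN conjunct2, THEN conjunct2, THEN conjunct2, THEN conjunct2, THEN conjunct2, THEN conjunct2, THEN conjunct2, THEN conjunct2, THEN conjunct2, THEN conjunct2, THEN conjunct2, THEN conjunct2, THEN conjunct2, THEN conjunct2, THEN conjunct2, THEN conjunct2, rule_format]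

lemma eps_lin: "lin sc \<epsilon>" and S_vlin: "vlin sc S"
  by (simp_all add: lin_def vlin_def eps_add eps_sc S_add S_sc)

lemma ev_Delta: "ev f (\<Delta> h) = SW h (\<lambda>a b. f [a, b])"
  unfolding SW_def
proof (rule ev_cong)
  fix xs assume "xs \<in> Poly_Mapping.keys (\<Delta> h)"
  from len[OF this] show "f xs = f [xs ! 0, xs ! 1]"
    by (cases xs; cases "tl xs") auto
qed

lemma sweedler: "sweedler sc (*) 1 SW"
proof
  show "vlin sc (\<lambda>x. x * y)" "vlin sc (\<lambda>x. y * x)" for y
    using kalg by (auto simp: vlin_def kalg_def algebra_simps)
  show "finop (\<lambda>f. SW h (\<lambda>a b. f (a, b)))" for h
    unfolding SW_def using finop_map[OF finop_ev, where g = "\<lambda>xs. (xs ! 0, xs ! 1)"] by simp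
next
  fix F :: "'h \<Rightarrow> 'h \<Rightarrow> 'k" and x y
  assume F: "\<And>b. lin sc (\<lambda>a. F a b)" "\<And>a. lin sc (\<lambda>b. F a b)"
  note f = pml_fn2[OF F]
  show "lin sc (\<lambda>h. SW h F)"
    using htens_eq_ev[OF Delta_add f] htens_eq_ev[OF Delta_sc f] by (simp add: lin_def ev_Delta)
  show "SW (x * y) F = SW x (\<lambda>a b. SW y (\<lambda>c d. F (a * c) (b * d)))"
    using htens_eq_ev[OF Delta_mul f, of x y] by (simp add: ev_Delta)
next
  fix G :: "'h \<Rightarrow> 'h \<Rightarrow> 'h \<Rightarrow> 'k" and h
  assume G: "\<And>b c. lin sc (\<lambda>a. G a b c)" "\<And>a c. lin sc (\<lambda>b. G a b c)" "\<And>a b. lin sc (\<lambda>c. G a b c)"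
  show "SW h (\<lambda>a b. SW a (\<lambda>c d. G c d b)) = SW h (\<lambda>a b. SW b (\<lambda>c d. G a c d))"
    using htens_eq_ev[OF Delta_coassoc pml_fn3[OF G], of h] by (simp add: ev_Delta)
qed (simp_all add: algebra_simps)

lemma separation:
  assumes "\<And>f. lin sc f \<Longrightarrow> f x = f y"
  shows "x = y"
proof (rule ccontr)
  assume "x \<noteq> y"
  interpret vector_space sc
    using kalg by unfold_locales (simp_all add: kalg_def)
  have "\<exists>f. (\<forall>a b. f (a + b) = f a + f b) \<and> (\<forall>c a. f (sc c a) = c * f a) \<and> (\<forall>z\<in>{0}. f z = 0) \<and> f (x - y) \<noteq> (0::'k)"
    by (rule separating_functional) (use \<open>x \<noteq> y\<close> in \<open>auto simp: subspace_def intro: vector_space_axioms\<close>)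
  then obtain f :: "'h \<Rightarrow> 'k" where f: "lin sc f" "f (x - y) \<noteq> 0"
    unfolding lin_def by blast
  then have "f ((x - y) + y) = f (x - y) + f y" unfolding lin_def by blast
  with f assms[OF f(1)] show False by simp
qed

lemma wbialg: "wbialg sc (*) 1 SW \<epsilon>"
proof -
  interpret sweedler sc "(*)" 1 SW by (rule sweedler)
  show ?thesis
  proof
    show "\<exists>z. \<forall>f. lin sc f \<longrightarrow> f z = SW h (\<lambda>a b. f (\<gamma> a b))" for h \<gamma>
      by (rule exI[of _ "hcontr sc (\<lambda>xs. \<gamma> (xs ! 0) (xs ! 1)) (\<Delta> h)"]) (simp add: lin_hcontr SW_def)
    show "SW h (\<lambda>a b. \<epsilon> a * f b) = f h" "SW h (\<lambda>a b. \<epsilon> b * f a) = f h" if "lin sc f" for f h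
      using lin_hcontr[OF that, of "\<lambda>xs. sc (\<epsilon> (xs!0)) (xs!1)" "\<Delta> h", unfolded counit_left]
        lin_hcontr[OF that, of "\<lambda>xs. sc (\<epsilon> (xs!1)) (xs!0)" "\<Delta> h", unfolded counit_right] that
      by (simp_all add: SW_def lin_def)
    show "SW h (\<lambda>a b. \<epsilon> (k * a) * \<epsilon> (b * g)) = \<epsilon> (k * h * g)"
      "SW h (\<lambda>a b. \<epsilon> (k * b) * \<epsilon> (a * g)) = \<epsilon> (k * h * g)" for h k g
      using eps_mul[of k g h] eps_mul_flip[of k g h] by (simp_all add: ev_kcontr SW_def)
    fix G :: "'h \<Rightarrow> 'h \<Rightarrow> 'h \<Rightarrow> 'k"
    assume G: "\<And>b c. lin sc (\<lambda>a. G a b c)" "\<And>a c. lin sc (\<lambda>b. G a b c)" "\<And>a b. lin sc (\<lambda>c. G a b c)"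
    \<comment> \<open>The concrete axiom forms Delta^2(1) by splitting the first leg, the locale by
      splitting the second.\<close>
    have *: "SW 1 (\<lambda>a b. SW b (\<lambda>c d. G a c d)) = SW 1 (\<lambda>a b. SW a (\<lambda>c d. G c d b))"
      using G by (rule SW_coassoc[symmetric])
    show "SW 1 (\<lambda>a b. SW b (\<lambda>c d. G a c d)) = SW 1 (\<lambda>a b. SW 1 (\<lambda>c d. G a (c * b) d))"
      unfolding * using htens_eq_ev[OF Delta_unit pml_fn3[OF G]] by (subst SW_swap) (simp add: ev_Delta)
    show "SW 1 (\<lambda>a b. SW b (\<lambda>c d. G a c d)) = SW 1 (\<lambda>a b. SW 1 (\<lambda>c d. G a (b * c) d))"
      unfolding * using htens_eq_ev[OF Delta_unit_flip pml_fn3[OF G]] by (simp add: ev_Delta)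
  qed (simp_all add: separation eps_lin)
qed

lemma wantipode: "wantipode sc (*) 1 SW \<epsilon> S"
proof -
  interpret wbialg sc "(*)" 1 SW \<epsilon> by (rule wbialg)
  show ?thesis
  proof
    fix f :: "'h \<Rightarrow> 'k" and h assume f: "lin sc f"
    have [simp]: "VL u \<Longrightarrow> L (\<lambda>x. f (u x))" "VL u \<Longrightarrow> VL (\<lambda>x. S (u x))" for u
      by (auto intro: lin_vlin[OF f] vlin_comp[OF S_vlin])
    have fsc: "f (sc c x) = c * f x" for c x using f by (simp add: lin_def)
    show "SW h (\<lambda>a b. f (a * S b)) = SW 1 (\<lambda>a b. \<epsilon> (a * h) * f b)"
      using arg_cong[OF S_target, of f h] by (simp add: lin_hcontr[OF f] fsc SW_def)
    show "SW h (\<lambda>a b. f (S a * b)) = SW 1 (\<lambda>a b. \<epsilon> (h * b) * f a)"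
      using arg_cong[OF S_source, of f h] by (simp add: lin_hcontr[OF f] fsc SW_def)
    show "f (S h) = SW h (\<lambda>a r. SW r (\<lambda>b c. f (S a * b * S c)))"
      using arg_cong[OF S_triple, of f h] by (subst SW_coassoc[symmetric]) (simp_all add: lin_hcontr[OF f] ev_Delta)
  qed (rule S_vlin)
qed

lemma phopf: "phopf sc (*) 1 SW S (inv S) (wbialg.es sc (*) 1 SW \<epsilon>) (wbialg.et sc (*) 1 SW \<epsilon>)"
  by (rule wantipode.phopf[OF wantipode]) (use bij in \<open>simp_all add: bij_is_surj surj_f_inv_f bij_is_inj inv_f_f\<close>)

end

sublocale weak_hopf_algebra \<subseteq> ph: phopf sc "(*)" 1 SW S "inv S" "wbialg.es sc (*) 1 SW \<epsilon>" "wbialg.et sc (*) 1 SW \<epsilon>"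
  by (rule phopf)

section \<open>Functionals on the concrete quotients\<close>

context weak_hopf_algebra
begin

abbreviation "T \<equiv> inv S"

lemma pst_kills:
  assumes "x \<in> fideal (par_gens sc \<Delta> S)" "ph.PS \<phi>"
  shows "ev \<phi> x = 0"
  using assms
proof (induction arbitrary: \<phi>)
  case (fideal_gen g)
  note \<phi> = \<open>ph.PS \<phi>\<close>
  note [simp] = pml_lin[OF pst_pml[OF \<phi>]]
  have l: "lin sc (\<lambda>x. \<phi> (u @ x # v))" for u v by simp
  have add: "\<phi> (u @ (a + b) # v) = \<phi> (u @ a # v) + \<phi> (u @ b # v)" for u v a b
    using l[of u v] unfolding lin_def by blast
  have scale: "\<phi> (u @ sc c a # v) = c * \<phi> (u @ a # v)" for u v a c
    using l[of u v] unfolding lin_def by blast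
  have triple: "\<phi> [h] = SW h (\<lambda>a b. SW a (\<lambda>c d. \<phi> [c, S d, b]))" for h
    using pst_triple[OF \<phi>, of "[]" h "[]"] by (subst ph.SW_coassoc) simp_all
  from fideal_gen.hyps show ?case
    unfolding par_gens_def
    using add scale pst_one[OF \<phi>, of "[]" "[]"] pst_mul_S[OF \<phi>, of _ "[]" _ "[]"] pst_mul_S'[OF \<phi>, of _ "[]" _ "[]"]
      pst_S_mul[OF \<phi>, of _ "[]" _ "[]"] pst_S_mul'[OF \<phi>, of _ "[]" _ "[]"] triple
    by (auto simp: ev_minus_fun ev_Delta)
next
  case (fideal_lmul x a)
  then show ?case by (simp add: pst_append_left) (simp add: ev_def)
next
  case (fideal_rmul x a)
  have "ev (\<lambda>u. ev (\<lambda>v. \<phi> (u @ v)) a) x = 0"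
    by (rule fideal_rmul.IH) (intro ph.pst_finop[OF finop_ev] pst_append_right fideal_rmul.prems)
  then show ?case by simp
qed simp_all

text \<open>An ideal contains u g v with every relation g, which supplies the surrounding words in
  the definition of \<open>pst\<close>.\<close>

lemma kills_pst:
  assumes kills: "\<And>g. g \<in> fideal (par_gens sc \<Delta> S) \<Longrightarrow> ev \<phi> g = 0"
  shows "ph.PS \<phi>"
proof -
  have ctx: "ev (\<lambda>w. \<phi> (u @ w @ v)) g = 0" if "g \<in> par_gens sc \<Delta> S" for u v g
    using kills[OF fideal_rmul[OF fideal_lmul[OF fideal_gen[OF that]], of "wd u" "wd v"]] by simp
  have pml: "pml sc \<phi>"
    unfolding pml_def lin_def
  proof (intro allI conjI)
    fix u v x y c
    have "wd (u @ [x + y] @ v) - wd (u @ [x] @ v) - wd (u @ [y] @ v) \<in> par_gens sc \<Delta> S"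
      "wd (u @ [sc c x] @ v) - fsc c (wd (u @ [x] @ v)) \<in> par_gens sc \<Delta> S"
      unfolding par_gens_def by blast+
    from kills[OF fideal_gen[OF this(1)]] kills[OF fideal_gen[OF this(2)]]
    show "\<phi> (u @ (x + y) # v) = \<phi> (u @ x # v) + \<phi> (u @ y # v)" "\<phi> (u @ sc c x # v) = c * \<phi> (u @ x # v)"
      by (simp_all add: algebra_simps)
  qed
  note [simp] = pml_lin[OF pml]
  show ?thesis
  proof (rule pstI[OF pml])
    fix u v h k
    have "wd [1] - wd [] \<in> par_gens sc \<Delta> S" unfolding par_gens_def by blast
    from ctx[OF this, of u v] show "\<phi> (u @ 1 # v) = \<phi> (u @ v)" by simp
    have "fsw (\<Delta> k) (\<lambda>xs. wd [h, xs!0, S (xs!1)] - wd [h * xs!0, S (xs!1)]) \<in> par_gens sc \<Delta> S"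
      unfolding par_gens_def by blast
    from ctx[OF this, of u v] show "SW k (\<lambda>a b. \<phi> (u @ h # a # S b # v)) = SW k (\<lambda>a b. \<phi> (u @ (h * a) # S b # v))"
      by (simp add: ev_minus_fun ev_Delta)
    have "fsw (\<Delta> k) (\<lambda>xs. wd [h, S (xs!0), xs!1] - wd [h * S (xs!0), xs!1]) \<in> par_gens sc \<Delta> S"
      unfolding par_gens_def by blast
    from ctx[OF this, of u v] show "SW k (\<lambda>a b. \<phi> (u @ h # S a # b # v)) = SW k (\<lambda>a b. \<phi> (u @ (h * S a) # b # v))"
      by (simp add: ev_minus_fun ev_Delta)
    have "fsw (\<Delta> h) (\<lambda>xs. wd [xs!0, S (xs!1), k] - wd [xs!0, S (xs!1) * k]) \<in> par_gens sc \<Delta> S"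
      unfolding par_gens_def by blast
    from ctx[OF this, of u v] show "SW h (\<lambda>a b. \<phi> (u @ a # S b # k # v)) = SW h (\<lambda>a b. \<phi> (u @ a # (S b * k) # v))"
      by (simp add: ev_minus_fun ev_Delta)
    have "fsw (\<Delta> h) (\<lambda>xs. wd [S (xs!0), xs!1, k] - wd [S (xs!0), xs!1 * k]) \<in> par_gens sc \<Delta> S"
      unfolding par_gens_def by blast
    from ctx[OF this, of u v] show "SW h (\<lambda>a b. \<phi> (u @ S a # b # k # v)) = SW h (\<lambda>a b. \<phi> (u @ S a # (b * k) # v))"
      by (simp add: ev_minus_fun ev_Delta)
    have "wd [h] - fsw (splice 0 \<Delta> (\<Delta> h)) (\<lambda>xs. wd [xs!0, S (xs!1), xs!2]) \<in> par_gens sc \<Delta> S"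
      unfolding par_gens_def by blast
    from ctx[OF this, of u v] show "\<phi> (u @ h # v) = SW h (\<lambda>a r. SW r (\<lambda>b c. \<phi> (u @ a # S b # c # v)))"
      by (subst ph.SW_coassoc[symmetric]) (simp_all add: ev_Delta)
  qed
qed

abbreviation "P \<equiv> peq sc \<Delta> S"

lemma P_D: "P x y \<Longrightarrow> ph.PS \<phi> \<Longrightarrow> ev \<phi> x = ev \<phi> y"
  unfolding peq_def using pst_kills[of "x - y" \<phi>] by simp

lemma P_I:
  assumes "\<And>\<phi>. ph.PS \<phi> \<Longrightarrow> ev \<phi> x = ev \<phi> y"
  shows "P x y"
  unfolding peq_def
proof (rule ev_separation)
  fix c z assume z: "z \<in> fideal (par_gens sc \<Delta> S)"
  \<comment> \<open>\<open>fideal\<close> has no rule for scalars; a scalar multiple is the product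
    with a multiple of the empty word.\<close>
  have "fmul (fsc c fone) z = fsc c z"
  proof -
    have "ev f (fmul (fsc c fone) z) = ev f (fsc c z)" for f by simp
    then have "Poly_Mapping.lookup (fmul (fsc c fone) z) w = Poly_Mapping.lookup (fsc c z) w" for w
    proof -
      have "ev (\<lambda>u. if u = w then 1 else 0) p = Poly_Mapping.lookup p w" for p :: "'h list \<Rightarrow>\<^sub>0 'k"
        by (simp add: ev_def if_distrib sum.delta in_keys_iff cong: if_cong)
      then show ?thesis using \<open>\<And>f. ev f (fmul (fsc c fone) z) = ev f (fsc c z)\<close> by metis
    qed
    then show ?thesis by (rule poly_mapping_eqI)
  qed
  then show "fsc c z \<in> fideal (par_gens sc \<Delta> S)"
    using fideal_lmul[OF z, of "fsc c fone"] by simp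
next
  fix f assume "\<And>z. z \<in> fideal (par_gens sc \<Delta> S) \<Longrightarrow> ev f z = 0"
  then have "ph.PS f" by (rule kills_pst)
  from assms[OF this] show "ev f (x - y) = 0" by simp
qed (auto intro: fideal.intros)

lemma Apar_Aop: "a \<in> Apar \<Delta> S \<Longrightarrow> (\<lambda>\<phi>. ev \<phi> a) \<in> ph.A"
  unfolding Apar_def Aop_def by (erule subalg_galg) (auto intro!: galg_gen simp: ev_Delta)

lemma Atpar_Bop: "a \<in> Atpar \<Delta> S \<Longrightarrow> (\<lambda>\<phi>. ev \<phi> a) \<in> ph.B"
  unfolding Atpar_def Bop_def by (erule subalg_galg) (auto intro!: galg_gen simp: ev_Delta)

lemma Aop_Apar: "\<alpha> \<in> ph.A \<Longrightarrow> \<exists>a\<in>Apar \<Delta> S. \<forall>\<phi>. ev \<phi> a = \<alpha> \<phi>"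
  unfolding Apar_def Aop_def by (erule galg_subalg) (auto simp: ev_Delta)

lemma Bop_Atpar: "\<alpha> \<in> ph.B \<Longrightarrow> \<exists>a\<in>Atpar \<Delta> S. \<forall>\<phi>. ev \<phi> a = \<alpha> \<phi>"
  unfolding Atpar_def Bop_def by (erule galg_subalg) (auto simp: ev_Delta)

lemma ev_dword [simp]: "ev \<Phi> (dword \<Delta> u) = ph.dw u (\<lambda>x y. \<Phi> [x, y])"
proof (induction u arbitrary: \<Phi>)
  case (Cons h u)
  have "ev \<Phi> (dword \<Delta> (h # u)) = ev (\<lambda>xs. ev (\<lambda>ws. \<Phi> [xs!0 # ws!0, xs!1 # ws!1]) (dword \<Delta> u)) (\<Delta> h)"
    unfolding dword.simps ev_sum ev_single by (simp add: ev_def sum_distrib_left mult.assoc)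
  then show ?case by (simp add: Cons ev_Delta)
qed simp

declare dword.simps [simp del]

lemma ev_epsl [simp]: "ev \<phi> (epsl \<Delta> S u) = ph.epl u \<phi>"
proof (induction u arbitrary: \<phi> rule: length_induct)
  case (1 u)
  consider "u = []" | h where "u = [h]" | h g w where "u = h # g # w"
    by (metis list.exhaust)
  then show ?case
    by cases (use 1 in \<open>simp_all add: ev_Delta\<close>)
qed

lemma ev_epsr [simp]: "ev \<phi> (epsr_rev \<Delta> S (rev u)) = ph.epr u \<phi>"
proof -
  have "ev \<phi> (epsr_rev \<Delta> S u) = el (\<lambda>x y. y * x) (\<lambda>h F. SW h (\<lambda>a b. F b a)) S u (\<lambda>w. \<phi> (rev w))" for u \<phi>
  proof (induction u arbitrary: \<phi> rule: length_induct)
    case (1 u)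
    consider "u = []" | h where "u = [h]" | h g w where "u = h # g # w"
      by (metis list.exhaust)
    then show ?case
    proof cases
      case (3 h g w)
      have IH: "ev \<psi> (epsr_rev \<Delta> S ((g * a) # w)) = el (\<lambda>x y. y * x) (\<lambda>h F. SW h (\<lambda>a b. F b a)) S ((g * a) # w) (\<lambda>w. \<psi> (rev w))" for \<psi> a
        using 1 3 by simp
      have "ev \<phi> (epsr_rev \<Delta> S u) = SW h (\<lambda>a b. ev (\<lambda>u. ev (\<lambda>xs. \<phi> (u @ [S (xs ! 0), xs ! 1])) (\<Delta> b)) (epsr_rev \<Delta> S ((g * a) # w)))"
        unfolding 3 by (simp add: ev_Delta)
      also have "\<dots> = SW h (\<lambda>a b. SW b (\<lambda>c d. ev (\<lambda>u. \<phi> (u @ [S c, d])) (epsr_rev \<Delta> S ((g * a) # w))))"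
        by (subst ev_swap) (simp add: ev_Delta)
      finally show ?thesis unfolding 3 by (simp add: IH)
    qed (simp_all add: ev_Delta)
  qed
  then show ?thesis by (simp add: ph.epr_def)
qed

lemma tgens_slot:
  assumes "length ps = Suc (length bs)" "i < length ps" "x \<in> fideal (par_gens sc \<Delta> S)"
  shows "ttens (ps[i := x]) \<in> tgens sc \<Delta> S bs"
  unfolding tgens_def
  by (rule UnI1, rule UnI1, rule CollectI, rule exI[of _ ps], rule exI[of _ i], rule exI[of _ x]) (intro conjI refl assms)

lemma tgens_LA:
  assumes "length ps = Suc (length bs)" "i < length bs" "bs ! i = LA" "a \<in> Apar \<Delta> S"
  shows "ttens (ps[i := fmul (antiw T a) x, Suc i := y]) - ttens (ps[i := x, Suc i := fmul a y]) \<in> tgens sc \<Delta> S bs"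
  unfolding tgens_def
  by (rule UnI1, rule UnI2, rule CollectI, rule exI[of _ ps], rule exI[of _ i], rule exI[of _ x], rule exI[of _ y],
      rule exI[of _ a]) (intro conjI refl assms)

lemma tgens_RA:
  assumes "length ps = Suc (length bs)" "i < length bs" "bs ! i = RA" "a \<in> Atpar \<Delta> S"
  shows "ttens (ps[i := fmul x a, Suc i := y]) - ttens (ps[i := x, Suc i := fmul y (antiw T a)]) \<in> tgens sc \<Delta> S bs"
  unfolding tgens_def
  by (rule UnI2, rule CollectI, rule exI[of _ ps], rule exI[of _ i], rule exI[of _ x], rule exI[of _ y],
      rule exI[of _ a]) (intro conjI refl assms)

text \<open>A functional that kills the relations over all of A kills those for the generators E_h,
  hence is balanced. Identities valid for balanced functionals thus hold in the quotient.\<close>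

lemma teq_LA_I:
  assumes "\<And>\<Phi>. ph.BAL (\<lambda>x y. \<Phi> [x, y]) \<Longrightarrow> ev \<Phi> X = ev \<Phi> Y"
  shows "teq sc \<Delta> S [LA] X Y"
  unfolding teq_def
proof (rule lspan_separation)
  fix \<Phi> assume \<Phi>: "\<And>g. g \<in> tgens sc \<Delta> S [LA] \<Longrightarrow> ev \<Phi> g = 0"
  have "ph.BAL (\<lambda>x y. \<Phi> [x, y])"
  proof (rule balI)
    show "ph.PS (\<lambda>p. \<Phi> [p, q])" for q
    proof (rule kills_pst)
      fix g assume "g \<in> fideal (par_gens sc \<Delta> S)"
      then have "ttens ([wd [], wd q][0 := g]) \<in> tgens sc \<Delta> S [LA]"
        by (intro tgens_slot) simp_all
      from \<Phi>[OF this] show "ev (\<lambda>p. \<Phi> [p, q]) g = 0" by simp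
    qed
    show "ph.PS (\<lambda>q. \<Phi> [p, q])" for p
    proof (rule kills_pst)
      fix g assume "g \<in> fideal (par_gens sc \<Delta> S)"
      then have "ttens ([wd p, wd []][1 := g]) \<in> tgens sc \<Delta> S [LA]"
        by (intro tgens_slot) simp_all
      from \<Phi>[OF this] show "ev (\<lambda>q. \<Phi> [p, q]) g = 0" by simp
    qed
    fix h x y
    have "Ep \<Delta> S h \<in> Apar \<Delta> S"
      unfolding Apar_def by (rule subalg_gen) simp
    then have "ttens ([wd [], wd []][0 := fmul (antiw T (Ep \<Delta> S h)) (wd x), Suc 0 := wd y])
        - ttens ([wd [], wd []][0 := wd x, Suc 0 := fmul (Ep \<Delta> S h) (wd y)]) \<in> tgens sc \<Delta> S [LA]"
      by (intro tgens_LA) simp_all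
    from \<Phi>[OF this] show "SW h (\<lambda>a b. \<Phi> [b # T a # x, y]) = SW h (\<lambda>a b. \<Phi> [x, a # S b # y])"
      by (simp add: ev_Delta)
  qed
  from assms[OF this] show "ev \<Phi> (X - Y) = 0" by simp
qed

lemma teq_RA_I:
  assumes "\<And>\<Phi>. ph.RBAL (\<lambda>x y. \<Phi> [x, y]) \<Longrightarrow> ev \<Phi> X = ev \<Phi> Y"
  shows "teq sc \<Delta> S [RA] X Y"
  unfolding teq_def
proof (rule lspan_separation)
  fix \<Phi> assume \<Phi>: "\<And>g. g \<in> tgens sc \<Delta> S [RA] \<Longrightarrow> ev \<Phi> g = 0"
  have "ph.RBAL (\<lambda>x y. \<Phi> [x, y])"
    unfolding rbal_def
  proof (intro conjI allI)
    show "ph.PS (\<lambda>p. \<Phi> [p, q])" for q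
    proof (rule kills_pst)
      fix g assume "g \<in> fideal (par_gens sc \<Delta> S)"
      then have "ttens ([wd [], wd q][0 := g]) \<in> tgens sc \<Delta> S [RA]"
        by (intro tgens_slot) simp_all
      from \<Phi>[OF this] show "ev (\<lambda>p. \<Phi> [p, q]) g = 0" by simp
    qed
    show "ph.PS (\<lambda>q. \<Phi> [p, q])" for p
    proof (rule kills_pst)
      fix g assume "g \<in> fideal (par_gens sc \<Delta> S)"
      then have "ttens ([wd p, wd []][1 := g]) \<in> tgens sc \<Delta> S [RA]"
        by (intro tgens_slot) simp_all
      from \<Phi>[OF this] show "ev (\<lambda>q. \<Phi> [p, q]) g = 0" by simp
    qed
    fix h x y
    have "Et \<Delta> S h \<in> Atpar \<Delta> S"
      unfolding Atpar_def by (rule subalg_gen) simp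
    then have "ttens ([wd [], wd []][0 := fmul (wd x) (Et \<Delta> S h), Suc 0 := wd y])
        - ttens ([wd [], wd []][0 := wd x, Suc 0 := fmul (wd y) (antiw T (Et \<Delta> S h))]) \<in> tgens sc \<Delta> S [RA]"
      by (intro tgens_RA) simp_all
    from \<Phi>[OF this] show "SW h (\<lambda>a b. \<Phi> [x @ [S a, b], y]) = SW h (\<lambda>a b. \<Phi> [x, y @ [T b, a]])"
      by (simp add: ev_Delta)
  qed
  from assms[OF this] show "ev \<Phi> (X - Y) = 0" by simp
qed

text \<open>Only multilinearity in the three slots enters, so \<open>i\<close> and \<open>j\<close>
  are arbitrary: coassociativity of both coproducts and both mixed conditions (ii) are
  instances.\<close>

lemma teq_coassoc:
  "teq sc \<Delta> S [i, j] (splice 0 (dword \<Delta>) (DeltaP \<Delta> h)) (splice 1 (dword \<Delta>) (DeltaP \<Delta> h))"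
  unfolding teq_def
proof (rule lspan_separation)
  fix \<Phi> assume \<Phi>: "\<And>g. g \<in> tgens sc \<Delta> S [i, j] \<Longrightarrow> ev \<Phi> g = 0"
  have kill: "ev \<Phi> (ttens (ps[k := g])) = 0" if "g \<in> fideal (par_gens sc \<Delta> S)" "length ps = 3" "k < 3" for ps k g
    using that by (intro \<Phi> tgens_slot) simp_all
  have 1: "pml sc (\<lambda>x. \<Phi> [x, y, z])" for y z
    by (rule pst_pml[OF kills_pst]) (use kill[of _ "[wd [], wd y, wd z]" 0] in simp)
  have 2: "pml sc (\<lambda>y. \<Phi> [x, y, z])" for x z
    by (rule pst_pml[OF kills_pst]) (use kill[of _ "[wd x, wd [], wd z]" 1] in simp)
  have 3: "pml sc (\<lambda>z. \<Phi> [x, y, z])" for x y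
    by (rule pst_pml[OF kills_pst]) (use kill[of _ "[wd x, wd y, wd []]" 2] in simp)
  show "ev \<Phi> (splice 0 (dword \<Delta>) (DeltaP \<Delta> h) - splice 1 (dword \<Delta>) (DeltaP \<Delta> h)) = 0"
    using ph.dsw_coassoc[of "\<lambda>x y z. \<Phi> [x, y, z]", OF 1 2 3] by simp
qed

end

section \<open>The Hopf algebroid structure\<close>

context weak_hopf_algebra
begin

lemma antiw_congruence: "P x y \<Longrightarrow> P (antiw T x) (antiw T y)" "P x y \<Longrightarrow> P (antiw S x) (antiw S y)"
  by (rule P_I, simp add: P_D ph.pst_antipode_T ph.pst_antipode)+

lemma antiw_fmul: "P (antiw f (fmul x y)) (fmul (antiw f y) (antiw f x))"
  by (rule P_I, simp) (rule ev_swap)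

lemma antiw_add: "P (antiw f (x + y)) (antiw f x + antiw f y)"
  and antiw_fsc: "P (antiw f (fsc c x)) (fsc c (antiw f x))"
  and antiw_fone: "P (antiw f fone) fone"
  by (rule P_I, simp)+

text \<open>The numbered cases follow the conjuncts of the definition. Those without a case are
  linearity and unit laws and the properties of \<open>antiw\<close> proved above.\<close>

lemma left_bialgebroid: "par_left_bialgebroid sc \<Delta> S"
  unfolding par_left_bialgebroid_def Let_def
proof (intro conjI ballI allI impI, goal_cases)
  case (6 a b)
  show ?case
    by (rule P_I, simp, subst (2) ev_swap) (rule ph.A_tA_comm[OF Apar_Aop[OF 6(1)] Apar_Aop[OF 6(2)]])
next
  case (7 x y)
  show ?case by (rule teq_LA_I) (simp add: P_D[OF 7 ph.pst_Delta])
next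
  case (10 a b h)
  note a = Apar_Aop[OF 10(1)] and b = Apar_Aop[OF 10(2)]
  show ?case
  proof (rule teq_LA_I)
    fix \<Phi> assume F: "ph.BAL (\<lambda>x y. \<Phi> [x, y])"
    have "ev \<Phi> (DeltaP \<Delta> (fmul (fmul a (antiw T b)) h))
        = ev (\<lambda>w. ev (\<lambda>u. ev (\<lambda>v. ph.dw ((u @ rev (map T v)) @ w) (\<lambda>x y. \<Phi> [x, y])) b) a) h"
      by (simp add: ev_swap[of _ h b] ev_swap[of _ h a])
    also have "\<dots> = ev (\<lambda>w. ev (\<lambda>u. ev (\<lambda>v. ph.dw w (\<lambda>r s. \<Phi> [u @ r, rev (map T v) @ s])) b) a) h"
      by (simp only: ph.Delta_bimodule[OF a b F])
    also have "\<dots> = ev (\<lambda>w. ph.dw w (\<lambda>r s. ev (\<lambda>v. ev (\<lambda>u. \<Phi> [u @ r, rev (map T v) @ s]) a) b)) h"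
      by (simp add: ph.dsw_finop_swap[OF finop_ev] ev_swap[of _ b a])
    also have "\<dots> = ev \<Phi> (slotl 0 a (slotl 1 (antiw T b) (DeltaP \<Delta> h)))"
      by simp
    finally show "ev \<Phi> (DeltaP \<Delta> (fmul (fmul a (antiw T b)) h)) = ev \<Phi> (slotl 0 a (slotl 1 (antiw T b) (DeltaP \<Delta> h)))" .
  qed
next
  case (11 h)
  show ?case by (rule teq_coassoc)
next
  case (12 x y)
  show ?case by (rule P_I) (simp add: P_D[OF 12 ph.epl_pst])
next
  case (13 x)
  have "(\<lambda>\<phi>. ev (\<lambda>u. ph.epl u \<phi>) x) \<in> ph.A"
    using ph.epl_A unfolding Aop_def by (intro galg_sum[OF finop_ev])
  from Aop_Apar[OF this] obtain a where "a \<in> Apar \<Delta> S" "\<And>\<phi>. ev \<phi> a = ev (\<lambda>u. ph.epl u \<phi>) x" by blast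
  then show ?case by (intro bexI P_I) simp_all
next
  case (16 a b h)
  note a = Apar_Aop[OF 16(1)] and b = Apar_Aop[OF 16(2)]
  show ?case
  proof (rule P_I)
    fix \<phi> assume \<phi>: "ph.PS \<phi>"
    have "ev \<phi> (EpsL \<Delta> S (fmul (fmul a (antiw T b)) h))
        = ev (\<lambda>w. ev (\<lambda>u. ev (\<lambda>v. ph.epl ((u @ rev (map T v)) @ w) \<phi>) b) a) h"
      by (simp add: ev_swap[of _ h b] ev_swap[of _ h a])
    also have "\<dots> = ev (\<lambda>w. ev (\<lambda>u. ph.epl w (\<lambda>z. ev (\<lambda>v. \<phi> ((u @ z) @ v)) b)) a) h"
      by (simp only: ph.epl_bimodule[OF a b \<phi>])
    also have "\<dots> = ev \<phi> (fmul (fmul a (EpsL \<Delta> S h)) b)"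
      by (simp add: ev_swap[of _ a h])
    finally show "ev \<phi> (EpsL \<Delta> S (fmul (fmul a (antiw T b)) h)) = ev \<phi> (fmul (fmul a (EpsL \<Delta> S h)) b)" .
  qed
next
  case (17 h)
  show ?case by (rule P_I) (simp add: ph.epl_counit)
next
  case (18 h)
  show ?case by (rule P_I) (simp add: ph.epl_counit_T)
next
  case (19 a h)
  show ?case
  proof (rule teq_LA_I)
    fix \<Phi> assume F: "ph.BAL (\<lambda>x y. \<Phi> [x, y])"
    from ph.Takeuchi[OF Apar_Aop[OF 19] F] show "ev \<Phi> (slotr 0 (antiw T a) (DeltaP \<Delta> h)) = ev \<Phi> (slotr 1 a (DeltaP \<Delta> h))"
      by (simp add: ph.dsw_finop_swap[OF finop_ev])
  qed
next
  case (20 x y)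
  show ?case by (rule teq_LA_I) (simp add: dsw_append ph.dsw_finop_swap[OF finop_ev])
next
  case (22 x y)
  show ?case by (rule P_I) (simp add: ph.epl_mul(1)[symmetric])
next
  case (23 x y)
  show ?case by (rule P_I) (simp add: ph.epl_mul(2)[symmetric])
qed (simp_all add: antiw_congruence antiw_add antiw_fmul antiw_fsc antiw_fone, (rule P_I teq_LA_I, simp)+)

lemma right_bialgebroid: "par_right_bialgebroid sc \<Delta> S"
  unfolding par_right_bialgebroid_def Let_def
proof (intro conjI ballI allI impI, goal_cases)
  case (6 a b)
  show ?case
    by (rule P_I, simp, subst (2) ev_swap) (rule ph.B_tB_comm[OF Atpar_Bop[OF 6(1)] Atpar_Bop[OF 6(2)]])
next
  case (7 x y)
  show ?case by (rule teq_RA_I) (simp add: P_D[OF 7 ph.pst_Delta_r])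
next
  case (10 a b h)
  note a = Atpar_Bop[OF 10(1)] and b = Atpar_Bop[OF 10(2)]
  show ?case
  proof (rule teq_RA_I)
    fix \<Phi> assume F: "ph.RBAL (\<lambda>x y. \<Phi> [x, y])"
    have "ev \<Phi> (DeltaP \<Delta> (fmul h (fmul (antiw T a) b)))
        = ev (\<lambda>w. ev (\<lambda>u. ev (\<lambda>v. ph.dw (w @ rev (map T v) @ u) (\<lambda>x y. \<Phi> [x, y])) a) b) h"
      by (simp add: ev_swap[of _ a b])
    also have "\<dots> = ev (\<lambda>w. ev (\<lambda>u. ev (\<lambda>v. ph.dw w (\<lambda>r s. \<Phi> [r @ rev (map T v), s @ u])) a) b) h"
      by (simp only: ph.Delta_r_bimodule[OF b a F])
    also have "\<dots> = ev (\<lambda>w. ph.dw w (\<lambda>r s. ev (\<lambda>u. ev (\<lambda>v. \<Phi> [r @ rev (map T v), s @ u]) a) b)) h"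
      by (simp add: ph.dsw_finop_swap[OF finop_ev])
    also have "\<dots> = ev \<Phi> (slotr 0 (antiw T a) (slotr 1 b (DeltaP \<Delta> h)))"
      by simp
    finally show "ev \<Phi> (DeltaP \<Delta> (fmul h (fmul (antiw T a) b))) = ev \<Phi> (slotr 0 (antiw T a) (slotr 1 b (DeltaP \<Delta> h)))" .
  qed
next
  case (11 h)
  show ?case by (rule teq_coassoc)
next
  case (12 x y)
  show ?case by (rule P_I) (simp add: P_D[OF 12 ph.epr_pst])
next
  case (13 x)
  have "(\<lambda>\<phi>. ev (\<lambda>u. ph.epr u \<phi>) x) \<in> ph.B"
    using ph.epr_B unfolding Bop_def by (intro galg_sum[OF finop_ev])
  from Bop_Atpar[OF this] obtain a where "a \<in> Atpar \<Delta> S" "\<And>\<phi>. ev \<phi> a = ev (\<lambda>u. ph.epr u \<phi>) x" by blast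
  then show ?case by (intro bexI P_I) simp_all
next
  case (16 a b h)
  note a = Atpar_Bop[OF 16(1)] and b = Atpar_Bop[OF 16(2)]
  show ?case
  proof (rule P_I)
    fix \<phi> assume \<phi>: "ph.PS \<phi>"
    have "(\<lambda>f. ev (\<lambda>w. ph.epr w f) h) \<in> ph.B"
      using ph.epr_B unfolding Bop_def by (intro galg_sum[OF finop_ev])
    then have fin: "finop (\<lambda>f. ev (\<lambda>w. ph.epr w f) h)"
      by (rule ph.Bop_finop)
    have "ev \<phi> (EpsR \<Delta> S (fmul h (fmul (antiw T a) b)))
        = ev (\<lambda>w. ev (\<lambda>u. ev (\<lambda>v. ph.epr (w @ rev (map T v) @ u) \<phi>) a) b) h"
      by (simp add: ev_swap[of _ a b])
    also have "\<dots> = ev (\<lambda>w. ev (\<lambda>u. ph.epr w (\<lambda>z. ev (\<lambda>v. \<phi> (v @ z @ u)) a)) b) h"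
      by (simp only: ph.epr_bimodule[OF b a \<phi>])
    also have "\<dots> = ev (\<lambda>u. ev (\<lambda>w. ph.epr w (\<lambda>z. ev (\<lambda>v. \<phi> (v @ z @ u)) a)) h) b"
      by (rule ev_swap)
    also have "\<dots> = ev (\<lambda>u. ev (\<lambda>v. ev (\<lambda>w. ph.epr w (\<lambda>z. \<phi> (v @ z @ u))) h) a) b"
      by (simp only: finop_swap[OF fin finop_ev[of a]])
    also have "\<dots> = ev (\<lambda>v. ev (\<lambda>w. ph.epr w (\<lambda>z. ev (\<lambda>u. \<phi> (v @ z @ u)) b)) h) a"
      by (simp only: ev_swap[of _ a b] finop_swap[OF fin finop_ev[of b]])
    also have "\<dots> = ev \<phi> (fmul (fmul a (EpsR \<Delta> S h)) b)"
      by simp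
    finally show "ev \<phi> (EpsR \<Delta> S (fmul h (fmul (antiw T a) b))) = ev \<phi> (fmul (fmul a (EpsR \<Delta> S h)) b)" .
  qed
next
  case (17 h)
  show ?case by (rule P_I) (simp add: ph.epr_counit_T)
next
  case (18 h)
  show ?case by (rule P_I) (simp add: ph.epr_counit)
next
  case (19 a h)
  show ?case
  proof (rule teq_RA_I)
    fix \<Phi> assume F: "ph.RBAL (\<lambda>x y. \<Phi> [x, y])"
    from ph.Takeuchi_r[OF Atpar_Bop[OF 19] F] show "ev \<Phi> (slotl 0 a (DeltaP \<Delta> h)) = ev \<Phi> (slotl 1 (antiw T a) (DeltaP \<Delta> h))"
      by (simp add: ph.dsw_finop_swap[OF finop_ev])
  qed
next
  case (20 x y)
  show ?case by (rule teq_RA_I) (simp add: dsw_append ph.dsw_finop_swap[OF finop_ev])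
next
  case (22 x y)
  show ?case
  proof (rule P_I)
    fix \<phi> assume \<phi>: "ph.PS \<phi>"
    have fin: "finop (ph.epr u)" for u by (rule ph.Bop_finop[OF ph.epr_B])
    have "ev \<phi> (EpsR \<Delta> S (fmul (EpsR \<Delta> S x) y)) = ev (\<lambda>u. ev (\<lambda>v. ph.epr u (\<lambda>z. ph.epr (z @ v) \<phi>)) y) x"
      by (simp add: finop_swap[OF fin finop_ev])
    then show "ev \<phi> (EpsR \<Delta> S (fmul x y)) = ev \<phi> (EpsR \<Delta> S (fmul (EpsR \<Delta> S x) y))"
      by (simp add: ph.epr_mul(1)[OF \<phi>, symmetric])
  qed
next
  case (23 x y)
  show ?case
  proof (rule P_I)
    fix \<phi> assume \<phi>: "ph.PS \<phi>"
    have fin: "finop (ph.epr u)" for u by (rule ph.Bop_finop[OF ph.epr_B])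
    have "ev \<phi> (EpsR \<Delta> S (fmul (antiw T (EpsR \<Delta> S x)) y)) = ev (\<lambda>u. ev (\<lambda>v. ph.epr u (\<lambda>z. ph.epr (rev (map T z) @ v) \<phi>)) y) x"
      by (simp add: finop_swap[OF fin finop_ev])
    then show "ev \<phi> (EpsR \<Delta> S (fmul x y)) = ev \<phi> (EpsR \<Delta> S (fmul (antiw T (EpsR \<Delta> S x)) y))"
      by (simp add: ph.epr_mul(2)[OF \<phi>, symmetric])
  qed
qed (simp_all add: antiw_congruence antiw_add antiw_fmul antiw_fsc antiw_fone, (rule P_I teq_RA_I, simp)+)

lemma antiw_cancel: "P (antiw S (antiw T x)) x" "P (antiw T (antiw S x)) x"
  by (rule P_I, simp)+

lemma peq_sym: "P x y \<Longrightarrow> P y x"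
  by (rule P_I) (simp add: P_D)

lemma peq_trans: "P x y \<Longrightarrow> P y z \<Longrightarrow> P x z"
  by (rule P_I) (simp add: P_D)

lemma Apar_antiw: "a \<in> Apar \<Delta> S \<Longrightarrow> \<exists>b\<in>Atpar \<Delta> S. P (antiw T a) b"
proof -
  assume "a \<in> Apar \<Delta> S"
  from ph.A_T_B[OF Apar_Aop[OF this]] obtain \<beta> where \<beta>: "\<beta> \<in> ph.B"
    "\<And>\<phi>. pml sc \<phi> \<Longrightarrow> \<beta> \<phi> = ev (\<lambda>w. \<phi> (rev (map T w))) a" by blast
  from Bop_Atpar[OF \<beta>(1)] obtain b where "b \<in> Atpar \<Delta> S" "\<And>\<phi>. ev \<phi> b = \<beta> \<phi>" by blast
  then show ?thesis by (intro bexI[of _ b] P_I) (simp_all add: \<beta>(2) pst_pml)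
qed

lemma Atpar_antiw: "b \<in> Atpar \<Delta> S \<Longrightarrow> \<exists>a\<in>Apar \<Delta> S. P (antiw T a) b"
proof -
  assume "b \<in> Atpar \<Delta> S"
  from ph.B_S_A[OF Atpar_Bop[OF this]] obtain \<alpha> where \<alpha>: "\<alpha> \<in> ph.A"
    "\<And>\<phi>. pml sc \<phi> \<Longrightarrow> \<alpha> \<phi> = ev (\<lambda>w. \<phi> (rev (map S w))) b" by blast
  from Aop_Apar[OF \<alpha>(1)] obtain a where a: "a \<in> Apar \<Delta> S" "\<And>\<phi>. ev \<phi> a = \<alpha> \<phi>" by blast
  have "P (antiw T a) b"
  proof (rule P_I)
    fix \<phi> assume "ph.PS \<phi>"
    from pst_pml[OF ph.pst_antipode_T[OF this]] show "ev \<phi> (antiw T a) = ev \<phi> b"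
      by (simp add: a(2) \<alpha>(2))
  qed
  with a(1) show ?thesis by blast
qed

lemma hopf_compat: "par_hopf_compat sc \<Delta> S"
  unfolding par_hopf_compat_def Let_def
proof (intro conjI)
  show "\<exists>\<phi>. (\<forall>a\<in>Apar \<Delta> S. \<exists>b\<in>Atpar \<Delta> S. P (\<phi> a) b) \<and>
        (\<forall>a\<in>Apar \<Delta> S. \<forall>b\<in>Apar \<Delta> S. P a b = P (\<phi> a) (\<phi> b)) \<and>
        (\<forall>b\<in>Atpar \<Delta> S. \<exists>a\<in>Apar \<Delta> S. P (\<phi> a) b) \<and>
        (\<forall>a\<in>Apar \<Delta> S. \<forall>b\<in>Apar \<Delta> S. P (\<phi> (a + b)) (\<phi> a + \<phi> b) \<and> P (\<phi> (fmul a b)) (fmul (\<phi> b) (\<phi> a))) \<and>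
        (\<forall>a\<in>Apar \<Delta> S. \<forall>c. P (\<phi> (fsc c a)) (fsc c (\<phi> a))) \<and> P (\<phi> fone) fone"
  \<comment> \<open>The witness is t itself, which reverses products; the antipode undoes it and so
    gives injectivity.\<close>
  proof (rule exI[of _ "antiw T"], intro conjI ballI allI)
    fix a b
    show "P a b = P (antiw T a) (antiw T b)"
      using antiw_congruence[of a b] antiw_congruence(2)[of "antiw T a" "antiw T b"] antiw_cancel(1) peq_sym peq_trans
      by metis
  qed (simp_all add: Apar_antiw Atpar_antiw antiw_add antiw_fmul antiw_fsc antiw_fone)
next
  show "\<forall>b\<in>Atpar \<Delta> S. P (EpsL \<Delta> S (antiw T b)) (antiw T b) \<and> P (antiw T (EpsL \<Delta> S b)) b"
    by (intro ballI conjI; rule P_I) (simp_all add: ph.epl_tB[OF Atpar_Bop])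
  show "\<forall>a\<in>Apar \<Delta> S. P (EpsR \<Delta> S (antiw T a)) (antiw T a) \<and> P (antiw T (EpsR \<Delta> S a)) a"
    by (intro ballI conjI; rule P_I) (simp_all add: ph.epr_tA[OF Apar_Aop])
  show "\<forall>h. teq sc \<Delta> S [LA, RA] (Defs.splice 0 (dword \<Delta>) (DeltaP \<Delta> h)) (Defs.splice 1 (dword \<Delta>) (DeltaP \<Delta> h))"
    by (intro allI teq_coassoc)
  \<comment> \<open>The second mixed condition is stated in the opposite direction, so symmetry of
    the congruence is supplied.\<close>
  have "teq sc \<Delta> S [RA, LA] Y X" if "teq sc \<Delta> S [RA, LA] X Y" for X Y
  proof -
    from that have "fsc (- 1) (X - Y) \<in> lspan (tgens sc \<Delta> S [RA, LA])"
      unfolding teq_def by (rule lspan_sc)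
    moreover have "fsc (- 1) (X - Y) = Y - X"
      by (rule poly_mapping_eqI) (simp add: fsc_def map.rep_eq when_def lookup_minus)
    ultimately show ?thesis by (simp add: teq_def)
  qed
  then show "\<forall>h. teq sc \<Delta> S [RA, LA] (Defs.splice 1 (dword \<Delta>) (DeltaP \<Delta> h)) (Defs.splice 0 (dword \<Delta>) (DeltaP \<Delta> h))"
    using teq_coassoc by blast
  show "\<forall>a\<in>Apar \<Delta> S. \<forall>b\<in>Atpar \<Delta> S. \<forall>h. P (antiw S (fmul (fmul (antiw T a) h) (antiw T b))) (fmul (fmul b (antiw S h)) a)"
  proof (intro ballI allI, rule P_I)
    fix a b h \<phi>
    have "ev \<phi> (antiw S (fmul (fmul (antiw T a) h) (antiw T b)))
        = ev (\<lambda>u. ev (\<lambda>w. ev (\<lambda>v. \<phi> (v @ rev (map S w) @ u)) b) h) a"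
      by simp
    also have "\<dots> = ev (\<lambda>v. ev (\<lambda>w. ev (\<lambda>u. \<phi> (v @ rev (map S w) @ u)) a) h) b"
      by (simp only: ev_swap[of _ b h] ev_swap[of _ b a] ev_swap[of _ h a])
    finally show "ev \<phi> (antiw S (fmul (fmul (antiw T a) h) (antiw T b))) = ev \<phi> (fmul (fmul b (antiw S h)) a)"
      by simp
  qed
\<comment> \<open>Condition (iv) consists of the convolution formulas \<open>epr_eq\<close> and
  \<open>epl_eq\<close>.\<close>
qed (auto simp: antiw_congruence antiw_add antiw_fmul antiw_fsc antiw_fone
    intro!: P_I simp: ph.epr_eq ph.epl_eq)

end

theorem theorem5p2:
  fixes sc :: "'k::field \<Rightarrow> 'h::ring_1 \<Rightarrow> 'h"
    and \<Delta> :: "'h \<Rightarrow> ('h list \<Rightarrow>\<^sub>0 'k)"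
    and \<epsilon> :: "'h \<Rightarrow> 'k"
    and S :: "'h \<Rightarrow> 'h"
  assumes "weak_hopf sc \<Delta> \<epsilon> S"
    and "bij S"
  shows "par_left_bialgebroid sc \<Delta> S \<and> par_right_bialgebroid sc \<Delta> S \<and> par_hopf_compat sc \<Delta> S"
proof -
  interpret weak_hopf_algebra sc \<Delta> \<epsilon> S
    by unfold_locales (fact assms)+
  show ?thesis
    by (intro conjI left_bialgebroid right_bialgebroid hopf_compat)
qed

end
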